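(* Let $\mathbb{F}$ denote either $\mathbb{C}$ or $\mathbb{F}_p$ (the field with $p$ elements, $p$ prime). For every $0<\alpha<1$ there is a constant $C_\alpha>0$ such that \[ \frac{1}{C_\alpha}\sqrt{\frac{\log N}{\log\log N}}\leq \log\,\mathrm{RLGP}(\mathbb{F},N,\alpha)\leq C_\alpha\frac{\log N}{\log\log N}. \] If $\mathbb{F}=\mathbb{F}_p$, the upper bound is asserted only when $N^{1+\log(2/\alpha)/\log\log N}\leq p$.
   Context: For a field $\mathbb{F}$, a finite set $Y\subseteq\mathbb{F}$ and $0<\alpha\leq 1$, a line $\ell$ in $\mathbb{F}^2$ is called $\alpha$-rich in $Y\times Y$ if $|\ell\cap(Y\times Y)|\geq\alpha|Y|$. A set of lines is in general position if no two of them are parallel and no three of them pass through a common point. $\mathrm{RLGP}(Y,\alpha)$ denotes the maximum number of lines that are $\alpha$-rich in $Y\times Y$ and in general position, and $\mathrm{RLGP}(\mathbb{F},N,\alpha):=\max_{Y\subseteq\mathbb{F},\,|Y|=N}\mathrm{RLGP}(Y,\alpha)$. *)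

theory Defs
  imports
    "HOL-Analysis.Analysis"
    "HOL-Algebra.Algebraic_Closure_Type"
    "HOL-Number_Theory.Residues"
begin

definition affine_lines :: "('a, 'b) ring_scheme \<Rightarrow> ('a \<times> 'a) set set" where
  "affine_lines F =
     {{(x, y). x \<in> carrier F \<and> y \<in> carrier F \<and> a \<otimes>\<^bsub>F\<^esub> x \<oplus>\<^bsub>F\<^esub> b \<otimes>\<^bsub>F\<^esub> y = c} | a b c.
        a \<in> carrier F \<and> b \<in> carrier F \<and> c \<in> carrier F \<and> (a \<noteq> \<zero>\<^bsub>F\<^esub> \<or> b \<noteq> \<zero>\<^bsub>F\<^esub>)}"

definition rich :: "'a set \<Rightarrow> real \<Rightarrow> ('a \<times> 'a) set \<Rightarrow> bool" where
  "rich Y \<alpha> l \<longleftrightarrow> real (card (l \<inter> (Y \<times> Y))) \<ge> \<alpha> * real (card Y)"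

text \<open>Two distinct lines of the affine plane are parallel iff they do not meet.\<close>

definition general_position :: "('a \<times> 'a) set set \<Rightarrow> bool" where
  "general_position L \<longleftrightarrow>
     (\<forall>l\<in>L. \<forall>m\<in>L. l \<noteq> m \<longrightarrow> l \<inter> m \<noteq> {}) \<and>
     (\<forall>l\<in>L. \<forall>m\<in>L. \<forall>n\<in>L. l \<noteq> m \<and> l \<noteq> n \<and> m \<noteq> n \<longrightarrow> l \<inter> m \<inter> n = {})"

definition rich_gp_families ::
    "('a, 'b) ring_scheme \<Rightarrow> 'a set \<Rightarrow> real \<Rightarrow> ('a \<times> 'a) set set set" where
  "rich_gp_families F Y \<alpha> =
     {L. L \<subseteq> affine_lines F \<and> finite L \<and> (\<forall>l\<in>L. rich Y \<alpha> l) \<and> general_position L}"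

definition RLGP_set :: "('a, 'b) ring_scheme \<Rightarrow> 'a set \<Rightarrow> real \<Rightarrow> nat" where
  "RLGP_set F Y \<alpha> = Max (card ` rich_gp_families F Y \<alpha>)"

definition RLGP :: "('a, 'b) ring_scheme \<Rightarrow> nat \<Rightarrow> real \<Rightarrow> nat" where
  "RLGP F N \<alpha> =
     Max ((\<lambda>Y. RLGP_set F Y \<alpha>) ` {Y. Y \<subseteq> carrier F \<and> finite Y \<and> card Y = N})"

text \<open>
  The lemmas below show that the maxima are taken over finite nonempty sets whenever
  \<open>\<alpha> > 0\<close>, \<open>N > 0\<close> and \<open>F\<close> has at least \<open>N\<close> elements. They also show that no infinite
  family of rich lines is in general position, so that \<open>finite L\<close> above excludes nothing.
\<close>

lemma subset_of_card:
  assumes "infinite A \<or> n \<le> card A"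
  obtains B where "B \<subseteq> A" "card B = n"
proof (cases "finite A")
  case True
  with assms obtain_subset_with_card_n[of n A] that show ?thesis by blast
next
  case False
  with infinite_arbitrarily_large[of A n] that show ?thesis by blast
qed

lemma rich_gp_bound:
  assumes "finite Y" "Y \<noteq> {}" "\<alpha> > 0" "\<forall>l\<in>L. rich Y \<alpha> l" "general_position L"
  shows "finite L \<and> card L \<le> 2 * (card Y)\<^sup>2"
proof -
  define M where "M q = {l \<in> L. q \<in> l}" for q
  have M2: "finite (M q) \<and> card (M q) \<le> 2" for q
  proof (rule ccontr)
    assume "\<not> (finite (M q) \<and> card (M q) \<le> 2)"
    then have "infinite (M q) \<or> 3 \<le> card (M q)" by auto
    then obtain T where T: "T \<subseteq> M q" "card T = 3"
      by (rule subset_of_card)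
    then obtain l m n where "T = {l, m, n}" "l \<noteq> m" "l \<noteq> n" "m \<noteq> n"
      unfolding card_3_iff by blast
    moreover from this T(1) have "l \<in> L" "m \<in> L" "n \<in> L" "q \<in> l \<inter> m \<inter> n"
      unfolding M_def by auto
    ultimately show False
      using assms(5) unfolding general_position_def by (metis empty_iff)
  qed
  have sub: "L \<subseteq> (\<Union>q\<in>Y \<times> Y. M q)"
  proof
    fix l assume l: "l \<in> L"
    have "0 < \<alpha> * real (card Y)"
      using assms by (simp add: card_gt_0_iff)
    with l assms(4) have "card (l \<inter> (Y \<times> Y)) \<noteq> 0"
      unfolding rich_def by fastforce
    then have "l \<inter> (Y \<times> Y) \<noteq> {}" by auto
    with l show "l \<in> (\<Union>q\<in>Y \<times> Y. M q)" unfolding M_def by blast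
  qed
  have fin: "finite (\<Union>q\<in>Y \<times> Y. M q)"
    using M2 assms(1) by (intro finite_UN_I finite_cartesian_product) simp_all
  have "card L \<le> card (\<Union>q\<in>Y \<times> Y. M q)"
    by (rule card_mono[OF fin sub])
  also have "\<dots> \<le> (\<Sum>q\<in>Y \<times> Y. card (M q))"
    by (rule card_UN_le) (simp add: assms(1))
  also have "\<dots> \<le> (\<Sum>q\<in>Y \<times> Y. 2)"
    by (rule sum_mono) (simp add: M2)
  also have "\<dots> = 2 * (card Y)\<^sup>2"
    by (simp add: card_cartesian_product power2_eq_square)
  finally show ?thesis
    using finite_subset[OF sub fin] by blast
qed

lemma RLGP_set_Max:
  assumes "finite Y" "Y \<noteq> {}" "\<alpha> > 0"
  shows "finite (card ` rich_gp_families F Y \<alpha>)" "card ` rich_gp_families F Y \<alpha> \<noteq> {}"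
    "RLGP_set F Y \<alpha> \<le> 2 * (card Y)\<^sup>2"
proof -
  have sub: "card ` rich_gp_families F Y \<alpha> \<subseteq> {..2 * (card Y)\<^sup>2}"
  proof (rule image_subsetI)
    fix L assume "L \<in> rich_gp_families F Y \<alpha>"
    then have "\<forall>l\<in>L. rich Y \<alpha> l" "general_position L"
      unfolding rich_gp_families_def by blast+
    from rich_gp_bound[OF assms this] show "card L \<in> {..2 * (card Y)\<^sup>2}" by simp
  qed
  then show fin: "finite (card ` rich_gp_families F Y \<alpha>)"
    by (rule finite_subset) simp
  have "{} \<in> rich_gp_families F Y \<alpha>"
    unfolding rich_gp_families_def general_position_def by auto
  then show ne: "card ` rich_gp_families F Y \<alpha> \<noteq> {}" by blast
  show "RLGP_set F Y \<alpha> \<le> 2 * (card Y)\<^sup>2"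
    unfolding RLGP_set_def using Max_in[OF fin ne] sub by blast
qed

lemma RLGP_Max:
  assumes "\<alpha> > 0" "N > 0" "infinite (carrier F) \<or> N \<le> card (carrier F)"
  shows "finite ((\<lambda>Y. RLGP_set F Y \<alpha>) ` {Y. Y \<subseteq> carrier F \<and> finite Y \<and> card Y = N})"
    "(\<lambda>Y. RLGP_set F Y \<alpha>) ` {Y. Y \<subseteq> carrier F \<and> finite Y \<and> card Y = N} \<noteq> {}"
proof -
  have "(\<lambda>Y. RLGP_set F Y \<alpha>) ` {Y. Y \<subseteq> carrier F \<and> finite Y \<and> card Y = N}
      \<subseteq> {..2 * N\<^sup>2}"
  proof (rule image_subsetI)
    fix Y assume Y: "Y \<in> {Y. Y \<subseteq> carrier F \<and> finite Y \<and> card Y = N}"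
    then have "finite Y" "Y \<noteq> {}" using assms(2) by auto
    from RLGP_set_Max(3)[OF this assms(1), of F] Y
    show "RLGP_set F Y \<alpha> \<in> {..2 * N\<^sup>2}" by simp
  qed
  then show "finite ((\<lambda>Y. RLGP_set F Y \<alpha>) ` {Y. Y \<subseteq> carrier F \<and> finite Y \<and> card Y = N})"
    by (rule finite_subset) simp
  obtain Y where Y: "Y \<subseteq> carrier F" "card Y = N"
    by (rule subset_of_card[OF assms(3)])
  moreover from this assms(2) have "finite Y"
    by (metis card.infinite less_irrefl)
  ultimately show "(\<lambda>Y. RLGP_set F Y \<alpha>) ` {Y. Y \<subseteq> carrier F \<and> finite Y \<and> card Y = N} \<noteq> {}"
    by blast
qed

end

theory Submission
  imports Defs
begin

text \<open>
  \<^bold>\<open>Upper bound.\<close> A rich line that is neither horizontal nor vertical is the graph of an affine map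
  \<open>f\<close> with \<open>\<bar>Y \<inter> f Y\<bar> \<ge> \<alpha> N\<close>. By Cauchy-Schwarz, random words of length \<open>2 ^ n\<close> in these maps
  and their inverses are \<open>\<alpha> ^ (2 ^ n)\<close>-rich on average, while at most \<open>N ^ 4\<close> maps can be rich.
  Hence the number of words, measured by the least size of a set carrying a tiny proportion of them, grows by at
  most \<open>K = N ^ O(1 / log log N)\<close> at some scale \<open>n \<le> c log log N\<close>. A Balog-Szemeredi-Gowers argument
  then gives a symmetric set \<open>S\<close> of affine maps with \<open>\<bar>S ^ j\<bar> \<le> K ^ O(j) \<bar>S\<bar>\<close> such that some
  coset \<open>S g\<close> contains a proportion \<open>K ^ - O(1)\<close> of the given lines. General position provides many
  slopes in \<open>S\<^sup>2\<close> and a nontrivial translation in \<open>S ^ 8\<close>, and the pivot argument shows that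
  \<open>S ^ O(1)\<close> contains either (number of slopes) times as many translations as \<open>S ^ 8\<close>, or half of all
  translations. The first contradicts the small growth of \<open>S\<close>; the second contradicts the bound
  \<open>4 p / \<delta>\<^sup>2\<close> for the number of \<open>\<delta>\<close>-rich lines over a field with \<open>p \<ge> 2 N / \<delta>\<close> elements.

  \<^bold>\<open>Lower bound.\<close> Take \<open>d\<close> primes of size \<open>O(d\<^sup>2)\<close>, the \<open>2 ^ d\<close> products \<open>a\<close> of distinct such primes,
  and the lines \<open>y = a x + a\<^sup>2 Q\<close>, where \<open>Q\<close> is a high power of the product of the primes. These maps
  almost preserve the set of maps \<open>x \<mapsto> u (x + n)\<close> with \<open>u dvd Q\<close> and \<open>n\<close> in a long interval,
  which has \<open>exp (O (d\<^sup>2 log d))\<close> elements. A union of orbits of this set is the required \<open>Y\<close>.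
\<close>

section \<open>Sets carrying a proportion of random words\<close>

text \<open>Parallel lines come from a coset of the translations, concurrent lines from a coset of
  the maps fixing a point. Both groups are abelian, so products in them need not grow, and general
  position serves to exclude exactly these two cases: distinct slopes make \<open>slope\<close>
  injective on the family, and three lines without a common point yield two quotients without a
  common fixed point, whose commutator is the nontrivial translation.

  The number \<open>J\<close> of scales is a compromise. The bound \<open>N ^ 4\<close> allows
  growth by \<open>K = N ^ (4 / J)\<close> per scale, so a large \<open>J\<close> is wanted. But
  words at scale \<open>n\<close> are only \<open>\<alpha> ^ (2 ^ n)\<close>-rich, and the
  proportion of words that can be controlled is raised to the fourth power with each scale, which
  makes a total loss of \<open>exp (O (8 ^ J))\<close>. With \<open>8 ^ J\<close> about
  \<open>sqrt (ln N)\<close> this loss is negligible against \<open>exp (O (ln N / J))\<close>. The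
  same richness dictates how large \<open>p\<close> has to be.

  In the lower bound \<open>d\<close> may grow as long as \<open>d^2 * ln d\<close> is
  \<open>O (ln N)\<close>; solving for \<open>d\<close> produces the square root.\<close>

lemma mult_card_le_of_reps:
  assumes "finite B" "\<And>g. g \<in> D \<Longrightarrow> s \<le> card {p \<in> B. \<phi> p = g}"
  shows "s * card D \<le> card B"
proof (cases "finite D")
  case True
  have "s * card D = (\<Sum>g\<in>D. s)" by simp
  also have "\<dots> \<le> (\<Sum>g\<in>D. card {p \<in> B. \<phi> p = g})"
    by (rule sum_mono) (rule assms(2))
  also have "\<dots> = card (\<Union>g\<in>D. {p \<in> B. \<phi> p = g})"
    using True assms(1) by (subst card_UN_disjoint) auto
  also have "\<dots> \<le> card B"
    using assms(1) by (intro card_mono) auto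
  finally show ?thesis .
qed simp

text \<open>Nonnegativity of the variance of \<open>f\<close> under the probability
  \<open>m\<close>.\<close>

lemma weighted_sum_square_le:
  fixes m f :: "'a \<Rightarrow> real"
  assumes "\<And>x. x \<in> W \<Longrightarrow> 0 \<le> m x" "sum m W = 1"
  shows "(\<Sum>x\<in>W. m x * f x)\<^sup>2 \<le> (\<Sum>x\<in>W. m x * (f x)\<^sup>2)"
proof -
  define c where "c = (\<Sum>x\<in>W. m x * f x)"
  have "0 \<le> (\<Sum>x\<in>W. m x * (f x - c)\<^sup>2)"
    by (intro sum_nonneg mult_nonneg_nonneg assms) auto
  also have "\<dots> = (\<Sum>x\<in>W. m x * (f x)\<^sup>2 - 2 * c * (m x * f x) + c\<^sup>2 * m x)"
    by (intro sum.cong refl) (simp add: power2_eq_square algebra_simps)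
  also have "\<dots> = (\<Sum>x\<in>W. m x * (f x)\<^sup>2) - 2 * c * c + c\<^sup>2 * 1"
    by (simp add: sum.distrib sum_subtractf sum_distrib_left[symmetric] c_def assms(2))
  finally show ?thesis by (simp add: c_def power2_eq_square)
qed

lemma weighted_average_attained:
  fixes m f :: "'a \<Rightarrow> real"
  assumes "\<And>x. x \<in> W \<Longrightarrow> 0 \<le> m x" "sum m W = 1" "c \<le> (\<Sum>x\<in>W. m x * f x)"
  shows "\<exists>x\<in>W. c \<le> f x"
proof (rule ccontr)
  assume "\<not> ?thesis"
  then have less: "f x < c" if "x \<in> W" for x using that by force
  obtain x0 where x0: "x0 \<in> W" "m x0 > 0"
  proof (rule ccontr)
    assume "\<not> thesis"
    with that have "\<And>x. x \<in> W \<Longrightarrow> m x \<le> 0" by force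
    then have "sum m W \<le> 0" by (rule sum_nonpos)
    with assms(2) show False by simp
  qed
  have "finite W" using assms(2) by (metis sum.infinite zero_neq_one)
  have "(\<Sum>x\<in>W. m x * f x) < (\<Sum>x\<in>W. m x * c)"
    using x0 less assms(1) \<open>finite W\<close>
    by (intro sum_strict_mono_ex1) (auto intro!: mult_left_mono bexI[of _ x0] simp: less_imp_le)
  also have "\<dots> = c" by (simp add: sum_distrib_right[symmetric] assms(2))
  finally show False using assms(3) by simp
qed

text \<open>A weighted Balog-Szemeredi-Gowers step by dependent random choice. Call \<open>w\<close>
  a neighbour of \<open>z\<close> when \<open>w - z \<in> V\<close>. The neighbourhood
  \<open>N\<close> of a random \<open>z\<close> contains few pairs with a small common
  neighbourhood. Deleting the elements that lie in too many such pairs leaves \<open>H\<close>, any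
  two elements of which are linked through many intermediate elements of \<open>N\<close>. The
  hypothesis \<open>min\<close> replaces regularity: it converts mass at least
  \<open>\<theta>\<close> into at least \<open>s\<close> elements.\<close>

lemma popular_differences_step:
  fixes m :: "'g::group_add \<Rightarrow> real" and s :: nat and \<eta> \<theta> :: real
  assumes fin: "finite W" "finite V" and nonneg: "\<And>x. x \<in> W \<Longrightarrow> 0 \<le> m x"
    and tot: "sum m W = 1"
    and min: "\<And>Z. Z \<subseteq> W \<Longrightarrow> \<theta> \<le> sum m Z \<Longrightarrow> s \<le> card Z"
    and \<theta>: "\<theta> \<le> \<eta>\<^sup>2 / 16" and \<eta>: "0 < \<eta>" "\<eta> \<le> 1"
    and dens: "\<eta> \<le> (\<Sum>x\<in>W. \<Sum>y\<in>W. m x * m y * of_bool (x - y \<in> V))"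
  obtains H where "H \<subseteq> W" "\<eta> / 4 \<le> sum m H"
    "s ^ 3 * card ((\<lambda>(a, b). a - b) ` (H \<times> H)) \<le> card V ^ 4"
proof -
  define i where "i w z = (of_bool (w - z \<in> V) :: real)" for w z
  define mN where "mN z = (\<Sum>w\<in>W. m w * i w z)" for z
  define D where "D w w' = (\<Sum>z\<in>W. m z * (i w z * i w' z))" for w w'
  define bad where "bad w w' = (of_bool (D w w' < \<eta>\<^sup>2 / 16) :: real)" for w w'
  define bm where "bm z = (\<Sum>w\<in>W. \<Sum>w'\<in>W. m w * m w' * (i w z * i w' z) * bad w w')" for z
  have EN: "\<eta> \<le> (\<Sum>z\<in>W. m z * mN z)"
  proof -
    have "(\<Sum>z\<in>W. m z * mN z) = (\<Sum>z\<in>W. \<Sum>w\<in>W. m w * m z * of_bool (w - z \<in> V))"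
      by (simp add: mN_def i_def sum_distrib_left mult_ac)
    also have "\<dots> = (\<Sum>w\<in>W. \<Sum>z\<in>W. m w * m z * of_bool (w - z \<in> V))"
      by (rule sum.swap)
    finally show ?thesis using dens by simp
  qed
  have "\<eta>\<^sup>2 \<le> (\<Sum>z\<in>W. m z * mN z)\<^sup>2" using EN \<eta> by (intro power_mono) auto
  also have "\<dots> \<le> (\<Sum>z\<in>W. m z * (mN z)\<^sup>2)" by (rule weighted_sum_square_le[OF nonneg tot])
  finally have EN2: "\<eta>\<^sup>2 \<le> (\<Sum>z\<in>W. m z * (mN z)\<^sup>2)" .
  have Ebm: "(\<Sum>z\<in>W. m z * bm z) \<le> \<eta>\<^sup>2 / 16"
  proof -
    have "(\<Sum>z\<in>W. m z * bm z)
        = (\<Sum>z\<in>W. \<Sum>w\<in>W. \<Sum>w'\<in>W. m w * m w' * bad w w' * (m z * (i w z * i w' z)))"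
      by (simp add: bm_def sum_distrib_left mult_ac)
    also have "\<dots> = (\<Sum>w\<in>W. \<Sum>z\<in>W. \<Sum>w'\<in>W. m w * m w' * bad w w' * (m z * (i w z * i w' z)))"
      by (rule sum.swap)
    also have "\<dots> = (\<Sum>w\<in>W. \<Sum>w'\<in>W. \<Sum>z\<in>W. m w * m w' * bad w w' * (m z * (i w z * i w' z)))"
      by (intro sum.cong refl sum.swap)
    also have "\<dots> = (\<Sum>w\<in>W. \<Sum>w'\<in>W. m w * m w' * (bad w w' * D w w'))"
      by (simp add: D_def sum_distrib_left mult_ac)
    also have "\<dots> \<le> (\<Sum>w\<in>W. \<Sum>w'\<in>W. m w * m w' * (\<eta>\<^sup>2 / 16))"
      using nonneg by (intro sum_mono mult_left_mono) (auto simp: bad_def)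
    also have "\<dots> = (\<Sum>w\<in>W. \<Sum>w'\<in>W. m w * m w') * (\<eta>\<^sup>2 / 16)"
      by (simp add: sum_distrib_right)
    also have "(\<Sum>w\<in>W. \<Sum>w'\<in>W. m w * m w') = 1"
      by (simp add: sum_distrib_left[symmetric] sum_distrib_right[symmetric] tot)
    finally show ?thesis by simp
  qed
  have "\<eta>\<^sup>2 / 2 \<le> (\<Sum>z\<in>W. m z * ((mN z)\<^sup>2 - 8 * bm z))"
  proof -
    have "(\<Sum>z\<in>W. m z * ((mN z)\<^sup>2 - 8 * bm z)) = (\<Sum>z\<in>W. m z * (mN z)\<^sup>2) - 8 * (\<Sum>z\<in>W. m z * bm z)"
      by (simp add: algebra_simps sum_subtractf sum_distrib_left)
    with EN2 Ebm show ?thesis by simp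
  qed
  \<comment> \<open>The weight \<open>8\<close> balances the two averages, as
    \<open>8 * (1 / 16) = 1 / 2\<close>. The chosen \<open>z\<close> has a neighbourhood of mass at
    least \<open>\<eta> / 2\<close>, in which the bad pairs have mass at most an eighth of the
    square.\<close>
  from weighted_average_attained[OF nonneg tot this]
  obtain z where z: "z \<in> W" and z2: "\<eta>\<^sup>2 / 2 \<le> (mN z)\<^sup>2 - 8 * bm z" by auto
  define N where "N = {w \<in> W. w - z \<in> V}"
  have finN: "finite N" and NW: "N \<subseteq> W" using fin by (auto simp: N_def)
  have mN: "mN z = sum m N"
    unfolding mN_def N_def i_def using fin by (simp add: sum.inter_filter of_bool_def if_distrib cong: if_cong)
  have bmN: "bm z = (\<Sum>w\<in>N. \<Sum>w'\<in>N. m w * m w' * bad w w')"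
  proof -
    have "(\<Sum>w'\<in>W. m w * m w' * (i w z * i w' z) * bad w w')
        = (if w - z \<in> V then \<Sum>w'\<in>N. m w * m w' * bad w w' else 0)" for w
      unfolding N_def i_def using fin by (auto simp: sum.inter_filter intro!: sum.cong)
    then have "bm z = (\<Sum>w\<in>W. if w - z \<in> V then \<Sum>w'\<in>N. m w * m w' * bad w w' else 0)"
      unfolding bm_def by simp
    also have "\<dots> = (\<Sum>w\<in>N. \<Sum>w'\<in>N. m w * m w' * bad w w')"
      unfolding N_def by (rule sum.inter_filter[OF fin(1), symmetric])
    finally show ?thesis .
  qed
  have bm0: "0 \<le> bm z" unfolding bmN bad_def using nonneg NW by (intro sum_nonneg mult_nonneg_nonneg) auto
  have mN0: "0 \<le> sum m N" using nonneg NW by (intro sum_nonneg) auto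
  have mNge: "\<eta> / 2 \<le> sum m N"
  proof (rule power2_le_imp_le)
    have "(\<eta> / 2)\<^sup>2 = \<eta>\<^sup>2 / 4" by (simp add: power_divide)
    with z2 bm0 zero_le_power2[of "sum m N"] show "(\<eta> / 2)\<^sup>2 \<le> (sum m N)\<^sup>2"
      unfolding mN by linarith
  qed (rule mN0)
  have mNpos: "0 < sum m N" using mNge \<eta> by simp
  define bp where "bp w = (\<Sum>w'\<in>N. m w' * bad w w')" for w
  \<comment> \<open>By Markov's inequality the deleted elements have at most half of the mass of
    \<open>N\<close>. The threshold \<open>1 / 4\<close> ensures that two elements of
    \<open>H\<close> together are bad with at most half of \<open>N\<close>.\<close>
  define H where "H = {w \<in> N. bp w \<le> sum m N / 4}"
  have HN: "H \<subseteq> N" by (auto simp: H_def)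
  have "sum m (N - H) * (sum m N / 4) \<le> (\<Sum>w\<in>N - H. m w * bp w)"
    unfolding sum_distrib_right using nonneg NW
    by (intro sum_mono mult_left_mono) (auto simp: H_def)
  also have "\<dots> \<le> (\<Sum>w\<in>N. m w * bp w)"
    using nonneg NW finN by (intro sum_mono2) (auto simp: bp_def bad_def intro!: sum_nonneg mult_nonneg_nonneg)
  also have "\<dots> = bm z" by (simp add: bmN bp_def sum_distrib_left mult_ac)
  also have "\<dots> \<le> (sum m N)\<^sup>2 / 8" using z2 zero_le_power2[of \<eta>] unfolding mN by linarith
  finally have "sum m N * (sum m (N - H)) \<le> sum m N * (sum m N / 2)"
    by (simp add: power2_eq_square algebra_simps)
  then have "sum m (N - H) \<le> sum m N / 2" using mNpos by (simp add: mult_le_cancel_left)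
  moreover have "sum m (N - H) = sum m N - sum m H" by (rule sum_diff[OF finN HN])
  ultimately have mH: "sum m N / 2 \<le> sum m H" by simp
  have \<theta>4: "\<theta> \<le> \<eta> / 4"
  proof -
    have "\<eta>\<^sup>2 \<le> \<eta> * 1" unfolding power2_eq_square using \<eta> by (intro mult_left_mono) auto
    with \<theta> \<eta> show ?thesis by simp
  qed
  \<comment> \<open>The popular differences of \<open>V\<close>. A pair that is not bad belongs to
    it in both orders, because \<open>w - w' = (w - y) - (w' - y)\<close> for every common neighbour
    \<open>y\<close>.\<close>
  define Q where "Q = {q \<in> (\<lambda>(a, b). a - b) ` (W \<times> W). s \<le> card {p \<in> V \<times> V. fst p - snd p = q}}"
  have finQ: "finite Q" using fin by (simp add: Q_def)
  have good: "w - w' \<in> Q \<and> w' - w \<in> Q" if "w \<in> W" "w' \<in> W" "bad w w' = 0" for w w'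
  proof -
    define Z where "Z = {y \<in> W. w - y \<in> V \<and> w' - y \<in> V}"
    have "\<eta>\<^sup>2 / 16 \<le> D w w'" using that(3) by (auto simp: bad_def)
    also have "D w w' = sum m Z"
    proof -
      have "D w w' = (\<Sum>y\<in>W. if w - y \<in> V \<and> w' - y \<in> V then m y else 0)"
        unfolding D_def i_def by (intro sum.cong) auto
      then show ?thesis unfolding Z_def using fin by (simp add: sum.inter_filter)
    qed
    finally have sZ: "s \<le> card Z" using \<theta> by (intro min) (auto simp: Z_def)
    have finX2: "finite {p \<in> V \<times> V. fst p - snd p = q}" for q using fin by auto
    have "card Z \<le> card {p \<in> V \<times> V. fst p - snd p = w - w'}"
      by (rule card_inj_on_le[where f = "\<lambda>y. (w - y, w' - y)", OF _ _ finX2])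
        (auto simp: inj_on_def Z_def diff_conv_add_uminus minus_add add.assoc simp del: add_uminus_conv_diff)
    moreover have "card Z \<le> card {p \<in> V \<times> V. fst p - snd p = w' - w}"
      by (rule card_inj_on_le[where f = "\<lambda>y. (w' - y, w - y)", OF _ _ finX2])
        (auto simp: inj_on_def Z_def diff_conv_add_uminus minus_add add.assoc simp del: add_uminus_conv_diff)
    moreover have "x - y \<in> (\<lambda>(a, b). a - b) ` (W \<times> W)" if "x \<in> W" "y \<in> W" for x y
      using that by (intro image_eqI[of _ _ "(x, y)"]) auto
    ultimately show ?thesis using sZ that(1,2) unfolding Q_def by auto
  qed
  have Q: "s * card Q \<le> card V ^ 2"
    using mult_card_le_of_reps[of "V \<times> V" Q s "\<lambda>p. fst p - snd p"] fin
    by (auto simp: Q_def card_cartesian_product power2_eq_square)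
  define HH where "HH = (\<lambda>(a, b). a - b) ` (H \<times> H)"
  \<comment> \<open>Each \<open>a - b\<close> splits as \<open>(a - w) + (w - b)\<close> with both
    terms in \<open>Q\<close>, for at least \<open>s\<close> intermediate elements \<open>w\<close>.
    Squaring the bound for \<open>card Q\<close> later supplies the other two factors
    \<open>s\<close>.\<close>
  have HHs: "s * card HH \<le> card Q ^ 2"
  proof -
    have "s \<le> card {p \<in> Q \<times> Q. fst p + snd p = g}" if "g \<in> HH" for g
    proof -
      from that obtain a b where ab: "a \<in> H" "b \<in> H" "g = a - b" by (auto simp: HH_def)
      define Z where "Z = {w \<in> N. bad a w = 0 \<and> bad b w = 0}"
      have "sum m N - sum m Z = sum m (N - Z)"
        by (rule sum_diff[OF finN, symmetric]) (auto simp: Z_def)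
      also have "\<dots> \<le> (\<Sum>w\<in>N - Z. m w * (bad a w + bad b w))"
      proof (rule sum_mono)
        fix w assume w: "w \<in> N - Z"
        then have "1 \<le> bad a w + bad b w" by (auto simp: Z_def bad_def split: if_splits)
        then show "m w \<le> m w * (bad a w + bad b w)"
          using w NW nonneg[of w] by (simp add: mult_le_cancel_left1 subset_iff)
      qed
      also have "\<dots> \<le> (\<Sum>w\<in>N. m w * (bad a w + bad b w))"
        using nonneg NW finN by (intro sum_mono2) (auto simp: bad_def)
      also have "\<dots> = bp a + bp b" by (simp add: bp_def algebra_simps sum.distrib)
      also have "\<dots> \<le> sum m N / 2" using ab by (auto simp: H_def)
      finally have "sum m N / 2 \<le> sum m Z" by simp
      then have "s \<le> card Z" using mNge \<theta>4 NW by (intro min) (auto simp: Z_def)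
      also have "\<dots> \<le> card {p \<in> Q \<times> Q. fst p + snd p = g}"
      proof (rule card_inj_on_le[where f = "\<lambda>w. (a - w, w - b)"])
        show "inj_on (\<lambda>w. (a - w, w - b)) Z"
          by (rule inj_onI) (metis diff_add_cancel prod.inject)
        show "(\<lambda>w. (a - w, w - b)) ` Z \<subseteq> {p \<in> Q \<times> Q. fst p + snd p = g}"
          using good ab HN NW by (fastforce simp: Z_def diff_conv_add_uminus add.assoc simp del: add_uminus_conv_diff)
        show "finite {p \<in> Q \<times> Q. fst p + snd p = g}" using finQ by auto
      qed
      finally show ?thesis .
    qed
    then have "s * card HH \<le> card (Q \<times> Q)"
      using finQ by (intro mult_card_le_of_reps[where \<phi> = "\<lambda>p. fst p + snd p"]) auto
    then show ?thesis by (simp add: card_cartesian_product power2_eq_square)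
  qed
  have "s ^ 3 * card HH = s\<^sup>2 * (s * card HH)" by (simp add: power2_eq_square power3_eq_cube)
  also have "\<dots> \<le> s\<^sup>2 * card Q ^ 2" by (rule mult_left_mono[OF HHs]) simp
  also have "\<dots> = (s * card Q) ^ 2" by (simp add: power_mult_distrib)
  also have "\<dots> \<le> (card V ^ 2) ^ 2" by (rule power_mono[OF Q]) simp
  also have "\<dots> = card V ^ 4" by (simp flip: power_mult)
  finally have "s ^ 3 * card HH \<le> card V ^ 4" .
  moreover have "\<eta> / 4 \<le> sum m H" using mH mNge by simp
  ultimately show thesis using that[of H] HN NW by (auto simp: HH_def)
qed

section \<open>Collisions, iterated sum sets and popular quotients\<close>

lemma sum_card_fibres:
  assumes "finite B"
  shows "(\<Sum>g\<in>\<phi> ` B. card {p \<in> B. \<phi> p = g}) = card B"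
  using sum.image_gen[OF assms, of "\<lambda>_. 1::nat" \<phi>] by simp

lemma card_collisions:
  assumes "finite B"
  shows "card {(p, q). p \<in> B \<and> q \<in> B \<and> \<phi> p = \<phi> q} = (\<Sum>g\<in>\<phi> ` B. (card {p \<in> B. \<phi> p = g})\<^sup>2)"
proof -
  have "{(p, q). p \<in> B \<and> q \<in> B \<and> \<phi> p = \<phi> q}
      = (\<Union>g\<in>\<phi> ` B. {p \<in> B. \<phi> p = g} \<times> {p \<in> B. \<phi> p = g})" by auto
  also have "card \<dots> = (\<Sum>g\<in>\<phi> ` B. card ({p \<in> B. \<phi> p = g} \<times> {p \<in> B. \<phi> p = g}))"
    using assms by (intro card_UN_disjoint) auto
  finally show ?thesis by (simp add: card_cartesian_product power2_eq_square)
qed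

lemma card_square_le_collisions:
  assumes "finite B"
  shows "(card B)\<^sup>2 \<le> card (\<phi> ` B) * card {(p, q). p \<in> B \<and> q \<in> B \<and> \<phi> p = \<phi> q}"
proof -
  have "(real (card B))\<^sup>2 = (\<Sum>g\<in>\<phi> ` B. 1 * real (card {p \<in> B. \<phi> p = g}))\<^sup>2"
    using sum_card_fibres[OF assms, of \<phi>] by (simp flip: of_nat_sum)
  also have "\<dots> \<le> (\<Sum>g\<in>\<phi> ` B. 1\<^sup>2) * (\<Sum>g\<in>\<phi> ` B. (real (card {p \<in> B. \<phi> p = g}))\<^sup>2)"
    by (rule Cauchy_Schwarz_ineq_sum)
  also have "\<dots> = real (card (\<phi> ` B) * card {(p, q). p \<in> B \<and> q \<in> B \<and> \<phi> p = \<phi> q})"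
    by (simp add: card_collisions[OF assms])
  finally show ?thesis
    unfolding of_nat_power[symmetric] of_nat_le_iff .
qed

text \<open>The \<open>n\<close>-fold sum set. The class \<open>group_add\<close> does not assume
  commutativity, so additive notation also covers composition of maps, and the order of summands
  matters throughout.\<close>

primrec nsums :: "nat \<Rightarrow> 'g::monoid_add set \<Rightarrow> 'g set" where
  "nsums 0 S = {0}"
| "nsums (Suc n) S = {s + v | s v. s \<in> S \<and> v \<in> nsums n S}"

lemma finite_nsums: "finite S \<Longrightarrow> finite (nsums n S)"
proof (induction n)
  case (Suc n)
  have "nsums (Suc n) S = (\<lambda>(a, b). a + b) ` (S \<times> nsums n S)" by auto
  with Suc show ?case by simp
qed simp

lemma nsums_1: "nsums (Suc 0) S = S" by auto

lemma nsums_add: "u \<in> nsums i S \<Longrightarrow> v \<in> nsums j S \<Longrightarrow> u + v \<in> nsums (i + j) S"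
proof (induction i arbitrary: u)
  case (Suc i)
  then obtain s w where "s \<in> S" "w \<in> nsums i S" "u = s + w" by auto
  with Suc show ?case by (auto simp: add.assoc)
qed simp

lemma nsums_uminus:
  fixes S :: "'g::group_add set"
  assumes "\<And>s. s \<in> S \<Longrightarrow> - s \<in> S"
  shows "u \<in> nsums i S \<Longrightarrow> - u \<in> nsums i S"
proof (induction i arbitrary: u)
  case (Suc i)
  then obtain s w where sw: "s \<in> S" "w \<in> nsums i S" "u = s + w" by auto
  then have "- w + - s \<in> nsums (i + 1) S"
    using Suc.IH assms by (intro nsums_add) (auto simp: nsums_1)
  then show ?case by (simp add: sw minus_add)
qed simp

lemma nsums_mono: "0 \<in> S \<Longrightarrow> i \<le> j \<Longrightarrow> nsums i S \<subseteq> nsums j S"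
proof (rule lift_Suc_mono_le[of "\<lambda>i. nsums i S"])
  fix n assume "0 \<in> S"
  then show "nsums n S \<subseteq> nsums (Suc n) S" by force
qed

text \<open>
  The elements with many representations \<open>- a + b\<close> form a set of small tripling: in
  \<open>a' + (- a + b) + v\<close> the sum can be bracketed as \<open>(a' - a) + (b + v)\<close> in many ways.
\<close>

lemma popular_quotients_structure:
  fixes A :: "'g::group_add set" and \<kappa> :: real and m :: "'g \<Rightarrow> real"
  assumes fin: "finite A" and ne: "A \<noteq> {}"
    and small: "real (card ((\<lambda>(a, b). a - b) ` (A \<times> A))) \<le> \<kappa> * real (card A)"
    and nonneg: "\<And>a. a \<in> A \<Longrightarrow> 0 \<le> m a"
  obtains S where "finite S" "S \<subseteq> {- a + b | a b. a \<in> A \<and> b \<in> A}" "0 \<in> S"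
    "\<And>s. s \<in> S \<Longrightarrow> - s \<in> S"
    "real (card A) \<le> 2 * \<kappa> * real (card S)"
    "\<And>n. real (card (nsums n S)) \<le> (2 * \<kappa>\<^sup>2) ^ n * real (card A)"
    "\<exists>x. sum m A \<le> 4 * \<kappa> ^ 3 * sum m {a \<in> A. - x + a \<in> S}"
proof -
  define AA where "AA = (\<lambda>(a, b). a - b) ` (A \<times> A)"
  have finAA: "finite AA" using fin by (simp add: AA_def)
  define q where "q = real (card A)"
  have q0: "0 < q" using fin ne by (simp add: q_def card_gt_0_iff)
  have "AA \<noteq> {}" using ne by (auto simp: AA_def)
  then have "0 < real (card AA)" using finAA by (simp add: card_gt_0_iff)
  with small have "0 < \<kappa> * q" by (simp add: AA_def q_def)
  with q0 have k0: "0 < \<kappa>" by (simp add: zero_less_mult_iff)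
  define D where "D = (\<lambda>(a, b). - a + b) ` (A \<times> A)"
  have finD: "finite D" using fin by (simp add: D_def)
  define r where "r g = card {p \<in> A \<times> A. - fst p + snd p = g}" for g
  \<comment> \<open>Half of the ratio between the guaranteed second moment
    \<open>q ^ 3 / \<kappa>\<close> of \<open>r\<close> and its first moment \<open>q ^ 2\<close>.
    Quotients below this threshold contribute at most half of the guaranteed energy.\<close>
  define t where "t = q / (2 * \<kappa>)"
  have t0: "0 < t" using q0 k0 by (simp add: t_def)
  define S where "S = {g \<in> D. t \<le> real (r g)}"
  have finS: "finite S" using finD by (simp add: S_def)
  have finr: "finite {p \<in> A \<times> A. - fst p + snd p = g}" for g using fin by auto
  have rle: "real (r g) \<le> q" for g
    unfolding r_def q_def of_nat_le_iff
    by (rule card_inj_on_le[where f = fst, OF _ _ fin]) (auto simp: inj_on_def add_eq_0_iff2 add.assoc)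
  have rneg: "r (- g) = r g" for g
  proof -
    have le: "r h \<le> r (- h)" for h
      unfolding r_def by (rule card_inj_on_le[where f = prod.swap, OF _ _ finr])
        (auto simp: inj_on_def minus_add)
    from le[of g] le[of "- g"] show ?thesis by simp
  qed
  have Ssym: "- s \<in> S" if "s \<in> S" for s
  proof -
    from that obtain a b where "a \<in> A" "b \<in> A" "s = - a + b" by (auto simp: S_def D_def)
    then have "- s \<in> D" by (auto simp: D_def minus_add intro!: rev_image_eqI[of "(b, a)"])
    with that show ?thesis by (simp add: S_def rneg)
  qed
  have r0: "real (r 0) = q"
  proof -
    have "{p \<in> A \<times> A. - fst p + snd p = 0} = (\<lambda>a. (a, a)) ` A"
      by (auto simp: add_eq_0_iff2)
    then show ?thesis by (simp add: r_def q_def card_image inj_on_def)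
  qed
  have k1: "1 \<le> \<kappa>"
  proof -
    from ne obtain b where "b \<in> A" by auto
    have "card A \<le> card AA"
      by (rule card_inj_on_le[where f = "\<lambda>a. a - b", OF _ _ finAA])
        (use \<open>b \<in> A\<close> in \<open>auto simp: inj_on_def AA_def\<close>)
    with small have "1 * q \<le> \<kappa> * q" by (simp add: AA_def q_def)
    from mult_right_le_imp_le[OF this q0] show ?thesis .
  qed
  have S0: "0 \<in> S"
  proof -
    have "t \<le> q" using k1 q0 by (simp add: t_def field_simps)
    moreover have "0 \<in> D" using ne by (force simp: D_def)
    ultimately show ?thesis by (simp add: S_def r0)
  qed
  have energy: "q ^ 3 / \<kappa> \<le> (\<Sum>g\<in>D. (real (r g))\<^sup>2)"
  proof -
    define E where "E = card {(p, p'). p \<in> A \<times> A \<and> p' \<in> A \<times> A \<and> fst p - snd p = fst p' - snd p'}"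
    define E' where "E' = card {(p, p'). p \<in> A \<times> A \<and> p' \<in> A \<times> A \<and> - fst p + snd p = - fst p' + snd p'}"
    \<comment> \<open>Regrouping \<open>c - a = d - b\<close> as \<open>- a + b = - c + d\<close>
      carries the energy from right quotients to left quotients; this takes the place of
      commutativity.\<close>
    have "E \<le> E'" unfolding E_def E'_def
    proof (rule card_inj_on_le[where f = "\<lambda>((c, a), (d, b)). ((a, b), (c, d))"])
      show "inj_on (\<lambda>((c, a), (d, b)). ((a, b), (c, d)))
          {(p, p'). p \<in> A \<times> A \<and> p' \<in> A \<times> A \<and> fst p - snd p = fst p' - snd p'}"
        by (auto simp: inj_on_def)
      have *: "- a + b = - c + d" if "c - a = d - b" for a b c d :: 'g
      proof -
        from that have "- c + (c - a) + b = - c + (d - b) + b" by simp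
        then show ?thesis
          by (simp add: diff_conv_add_uminus add.assoc del: add_uminus_conv_diff)
      qed
      show "(\<lambda>((c, a), (d, b)). ((a, b), (c, d))) `
          {(p, p'). p \<in> A \<times> A \<and> p' \<in> A \<times> A \<and> fst p - snd p = fst p' - snd p'}
          \<subseteq> {(p, p'). p \<in> A \<times> A \<and> p' \<in> A \<times> A \<and> - fst p + snd p = - fst p' + snd p'}"
        by (auto intro: *)
      have "{(p, p'). p \<in> A \<times> A \<and> p' \<in> A \<times> A \<and> - fst p + snd p = - fst p' + snd p'}
          \<subseteq> (A \<times> A) \<times> (A \<times> A)" by auto
      then show "finite {(p, p'). p \<in> A \<times> A \<and> p' \<in> A \<times> A \<and> - fst p + snd p = - fst p' + snd p'}"
        by (rule finite_subset) (use fin in simp)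
    qed
    have E': "real E' = (\<Sum>g\<in>D. (real (r g))\<^sup>2)"
    proof -
      have "D = (\<lambda>p. - fst p + snd p) ` (A \<times> A)" by (simp add: D_def case_prod_beta')
      with card_collisions[of "A \<times> A" "\<lambda>p. - fst p + snd p"] fin show ?thesis
        by (simp add: E'_def r_def)
    qed
    have im: "(\<lambda>p. fst p - snd p) ` (A \<times> A) = AA" by (simp add: AA_def case_prod_beta')
    have "(card (A \<times> A))\<^sup>2 \<le> card AA * E"
      unfolding E_def im[symmetric] by (rule card_square_le_collisions) (use fin in simp)
    then have "real ((card (A \<times> A))\<^sup>2) \<le> real (card AA * E)" by (rule of_nat_mono)
    then have "q ^ 4 \<le> real (card AA) * real E"
      by (simp add: card_cartesian_product q_def power2_eq_square power4_eq_xxxx mult.assoc)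
    also have "\<dots> \<le> (\<kappa> * q) * real E'"
      using small \<open>E \<le> E'\<close> q0 k0 by (intro mult_mono) (auto simp: AA_def q_def)
    finally have "q * q ^ 3 \<le> q * (\<kappa> * real E')" by (simp add: power_numeral_reduce mult_ac)
    from mult_left_le_imp_le[OF this q0] have "q ^ 3 \<le> \<kappa> * real E'" .
    then show ?thesis unfolding E'[symmetric] using k0 by (simp add: field_simps)
  qed
  have sumr: "(\<Sum>g\<in>D. real (r g)) = q\<^sup>2"
  proof -
    have "D = (\<lambda>p. - fst p + snd p) ` (A \<times> A)" by (simp add: D_def case_prod_beta')
    with sum_card_fibres[of "A \<times> A" "\<lambda>p. - fst p + snd p"] fin show ?thesis
      by (simp add: r_def q_def card_cartesian_product power2_eq_square flip: of_nat_sum of_nat_mult)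
  qed
  have cardS: "q \<le> 2 * \<kappa> * real (card S)"
  proof -
    have "(\<Sum>g\<in>D. (real (r g))\<^sup>2) = (\<Sum>g\<in>S. (real (r g))\<^sup>2) + (\<Sum>g\<in>D - S. (real (r g))\<^sup>2)"
    proof -
      have "S \<subseteq> D" by (auto simp: S_def)
      from sum.subset_diff[OF this finD] show ?thesis by (simp only: add.commute)
    qed
    also have "(\<Sum>g\<in>S. (real (r g))\<^sup>2) \<le> (\<Sum>g\<in>S. q\<^sup>2)"
      using rle by (intro sum_mono power_mono) auto
    also have "(\<Sum>g\<in>D - S. (real (r g))\<^sup>2) \<le> (\<Sum>g\<in>D - S. t * real (r g))"
      by (intro sum_mono) (auto simp: S_def power2_eq_square intro!: mult_right_mono)
    also have "\<dots> \<le> (\<Sum>g\<in>D. t * real (r g))"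
      using finD t0 by (intro sum_mono2) auto
    also have "\<dots> = t * q\<^sup>2" by (simp add: sum_distrib_left[symmetric] sumr)
    finally have "q ^ 3 / \<kappa> \<le> real (card S) * q\<^sup>2 + t * q\<^sup>2" using energy by simp
    then have "q ^ 3 / \<kappa> - t * q\<^sup>2 \<le> real (card S) * q\<^sup>2" by simp
    also have "q ^ 3 / \<kappa> - t * q\<^sup>2 = q / (2 * \<kappa>) * q\<^sup>2"
      using k0 by (simp add: t_def field_simps power3_eq_cube power2_eq_square)
    finally have "q / (2 * \<kappa>) \<le> real (card S)" by (rule mult_right_le_imp_le) (use q0 in simp)
    then show ?thesis using k0 by (simp add: field_simps)
  qed
  \<comment> \<open>A copy of \<open>A\<close> is kept on the left of the sum so that each further
    summand from \<open>S\<close> can be absorbed at the cost of one factor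
    \<open>card (A - A) / t\<close>.\<close>
  define AS where "AS n = {a + v | a v. a \<in> A \<and> v \<in> nsums n S}" for n
  have finAS: "finite (AS n)" for n
  proof -
    have "AS n = (\<lambda>(a, b). a + b) ` (A \<times> nsums n S)" by (auto simp: AS_def)
    then show ?thesis using fin finite_nsums[OF finS] by simp
  qed
  have AS: "real (card (AS n)) \<le> (2 * \<kappa>\<^sup>2) ^ n * q" for n
  proof (induction n)
    case 0
    have "AS 0 = A" by (auto simp: AS_def)
    then show ?case by (simp add: q_def)
  next
    case (Suc n)
    have "nat \<lceil>t\<rceil> * card (AS (Suc n)) \<le> card (AA \<times> AS n)"
    proof (rule mult_card_le_of_reps[where \<phi> = "\<lambda>p. fst p + snd p"])
      show fp: "finite (AA \<times> AS n)" using finAA finAS by simp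
      fix g assume "g \<in> AS (Suc n)"
      then obtain a' s v where g: "a' \<in> A" "s \<in> S" "v \<in> nsums n S" "g = a' + (s + v)"
        by (auto simp: AS_def)
      have "nat \<lceil>t\<rceil> \<le> r s" using g(2) by (simp add: S_def)
      also have "r s \<le> card {p \<in> AA \<times> AS n. fst p + snd p = g}"
        unfolding r_def
      proof (rule card_inj_on_le[where f = "\<lambda>p. (a' - fst p, snd p + v)"])
        show "inj_on (\<lambda>p. (a' - fst p, snd p + v)) {p \<in> A \<times> A. - fst p + snd p = s}"
          by (auto simp: inj_on_def)
        have "b + v \<in> AS n" if "b \<in> A" for b using that g(3) by (auto simp: AS_def)
        then show "(\<lambda>p. (a' - fst p, snd p + v)) ` {p \<in> A \<times> A. - fst p + snd p = s}
            \<subseteq> {p \<in> AA \<times> AS n. fst p + snd p = g}"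
          using g by (auto simp: AA_def diff_conv_add_uminus add.assoc simp del: add_uminus_conv_diff)
        show "finite {p \<in> AA \<times> AS n. fst p + snd p = g}" using fp by simp
      qed
      finally show "nat \<lceil>t\<rceil> \<le> card {p \<in> AA \<times> AS n. fst p + snd p = g}" .
    qed
    then have "real (nat \<lceil>t\<rceil> * card (AS (Suc n))) \<le> real (card (AA \<times> AS n))" by (rule of_nat_mono)
    moreover have "t * real (card (AS (Suc n))) \<le> real (nat \<lceil>t\<rceil> * card (AS (Suc n)))"
      unfolding of_nat_mult by (intro mult_right_mono of_nat_ceiling) auto
    ultimately have "t * real (card (AS (Suc n))) \<le> real (card AA) * real (card (AS n))"
      by (simp add: card_cartesian_product)
    also have "\<dots> \<le> (\<kappa> * q) * ((2 * \<kappa>\<^sup>2) ^ n * q)"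
      using small Suc q0 k0 by (intro mult_mono) (auto simp: AA_def q_def)
    also have "\<dots> = t * ((2 * \<kappa>\<^sup>2) ^ Suc n * q)"
      using k0 by (simp add: t_def field_simps power2_eq_square)
    finally show ?case by (rule mult_left_le_imp_le[OF _ t0])
  qed
  have bound: "real (card (nsums n S)) \<le> (2 * \<kappa>\<^sup>2) ^ n * real (card A)" for n
  proof -
    from ne obtain a where "a \<in> A" by auto
    have "card (nsums n S) \<le> card (AS n)"
      by (rule card_inj_on_le[where f = "\<lambda>v. a + v", OF _ _ finAS])
        (use \<open>a \<in> A\<close> in \<open>auto simp: AS_def\<close>)
    with AS[of n] show ?thesis by (simp add: q_def)
  qed
  \<comment> \<open>Averaging over \<open>x \<in> AS 1\<close>: by symmetry of \<open>S\<close> each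
    \<open>a\<close> lies in \<open>x + S\<close> for exactly \<open>card S\<close> values of
    \<open>x\<close>, while \<open>card (AS 1) \<le> 2 * \<kappa>^2 * q \<le> 4 * \<kappa>^3 * card
    S\<close>.\<close>
  have "\<exists>x. sum m A \<le> 4 * \<kappa> ^ 3 * sum m {a \<in> A. - x + a \<in> S}"
  proof (rule ccontr)
    assume "\<not> ?thesis"
    then have less: "4 * \<kappa> ^ 3 * sum m {a \<in> A. - x + a \<in> S} < sum m A" for x
      by (simp add: not_le)
    have neS: "AS 1 \<noteq> {}" using ne S0 by (auto simp: AS_def)
    have "sum m A * real (card S) = (\<Sum>a\<in>A. m a * real (card S))" by (simp add: sum_distrib_right)
    also have "\<dots> = (\<Sum>a\<in>A. \<Sum>x\<in>AS 1. m a * of_bool (- x + a \<in> S))"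
    proof (rule sum.cong[OF refl])
      fix a assume a: "a \<in> A"
      have eq: "{x \<in> AS 1. - x + a \<in> S} = (\<lambda>s. a + s) ` S"
      proof
        show "{x \<in> AS 1. - x + a \<in> S} \<subseteq> (\<lambda>s. a + s) ` S"
        proof
          fix x assume "x \<in> {x \<in> AS 1. - x + a \<in> S}"
          then have "- (- x + a) \<in> S" using Ssym by blast
          then have "- a + x \<in> S" by (simp add: minus_add)
          then show "x \<in> (\<lambda>s. a + s) ` S" by (rule rev_image_eqI) (simp add: add.assoc[symmetric])
        qed
        show "(\<lambda>s. a + s) ` S \<subseteq> {x \<in> AS 1. - x + a \<in> S}"
          using a Ssym by (auto simp: AS_def nsums_1 minus_add add.assoc)
      qed
      have "(\<Sum>x\<in>AS 1. m a * of_bool (- x + a \<in> S)) = m a * real (card {x \<in> AS 1. - x + a \<in> S})"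
        using finAS by (simp add: sum_distrib_left[symmetric] of_bool_def sum.inter_filter[symmetric])
      also have "card {x \<in> AS 1. - x + a \<in> S} = card S" unfolding eq by (simp add: card_image)
      finally show "m a * real (card S) = (\<Sum>x\<in>AS 1. m a * of_bool (- x + a \<in> S))" by simp
    qed
    also have "\<dots> = (\<Sum>x\<in>AS 1. \<Sum>a\<in>A. m a * of_bool (- x + a \<in> S))" by (rule sum.swap)
    also have "\<dots> = (\<Sum>x\<in>AS 1. sum m {a \<in> A. - x + a \<in> S})"
      using fin by (simp add: of_bool_def if_distrib sum.inter_filter cong: if_cong)
    finally have eq: "sum m A * real (card S) = (\<Sum>x\<in>AS 1. sum m {a \<in> A. - x + a \<in> S})" .
    have "4 * \<kappa> ^ 3 * (sum m A * real (card S)) = (\<Sum>x\<in>AS 1. 4 * \<kappa> ^ 3 * sum m {a \<in> A. - x + a \<in> S})"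
      unfolding eq by (simp add: sum_distrib_left)
    also have "\<dots> < (\<Sum>x\<in>AS 1. sum m A)"
      using less neS finAS by (intro sum_strict_mono) auto
    also have "\<dots> = real (card (AS 1)) * sum m A" by simp
    finally have lt: "4 * \<kappa> ^ 3 * real (card S) * sum m A < real (card (AS 1)) * sum m A" by (simp add: mult_ac)
    have "0 \<le> 4 * \<kappa> ^ 3 * sum m {a \<in> A. - x + a \<in> S}" for x
      using nonneg k0 by (intro mult_nonneg_nonneg sum_nonneg) auto
    then have "0 < sum m A" using less by (meson le_less_trans)
    with lt have "4 * \<kappa> ^ 3 * real (card S) < real (card (AS 1))"
      using mult_less_cancel_right_pos by blast
    also have "\<dots> \<le> 2 * \<kappa>\<^sup>2 * q" using AS[of 1] by simp
    also have "\<dots> \<le> 2 * \<kappa>\<^sup>2 * (2 * \<kappa> * real (card S))"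
      using cardS k0 by (intro mult_left_mono) auto
    finally show False by (simp add: power2_eq_square power3_eq_cube)
  qed
  note mass = this
  have SQ: "S \<subseteq> {- a + b | a b. a \<in> A \<and> b \<in> A}" by (auto simp: S_def D_def)
  have cardS': "real (card A) \<le> 2 * \<kappa> * real (card S)" using cardS by (simp add: q_def)
  show thesis by (rule that[OF finS SQ S0 Ssym cardS' bound mass])
qed

section \<open>Random words and a scale of slow growth\<close>

definition diff_supp :: "'g::group_add set \<Rightarrow> 'g set" where
  "diff_supp W = (\<lambda>(x, y). x - y) ` (W \<times> W)"

definition diff_law :: "'g::group_add set \<Rightarrow> ('g \<Rightarrow> real) \<Rightarrow> 'g \<Rightarrow> real" where
  "diff_law W m z = (\<Sum>p\<in>{p \<in> W \<times> W. fst p - snd p = z}. m (fst p) * m (snd p))"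

lemma sum_diff_law:
  assumes "finite W"
  shows "(\<Sum>z\<in>diff_supp W. diff_law W m z * \<phi> z) = (\<Sum>x\<in>W. \<Sum>y\<in>W. m x * m y * \<phi> (x - y))"
proof -
  have im: "diff_supp W = (\<lambda>p. fst p - snd p) ` (W \<times> W)"
    by (simp add: diff_supp_def case_prod_beta')
  have "(\<Sum>x\<in>W. \<Sum>y\<in>W. m x * m y * \<phi> (x - y))
      = (\<Sum>p\<in>W \<times> W. m (fst p) * m (snd p) * \<phi> (fst p - snd p))"
    by (simp add: sum.cartesian_product case_prod_beta)
  also have "\<dots> = (\<Sum>z\<in>diff_supp W. \<Sum>p\<in>{p \<in> W \<times> W. fst p - snd p = z}.
      m (fst p) * m (snd p) * \<phi> (fst p - snd p))"
    unfolding im by (rule sum.image_gen) (use assms in simp)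
  also have "\<dots> = (\<Sum>z\<in>diff_supp W. diff_law W m z * \<phi> z)"
    by (intro sum.cong refl) (simp add: diff_law_def sum_distrib_right)
  finally show ?thesis by simp
qed

text \<open>
  \<open>(wsupp L n, wlaw L n)\<close> is the law of a word of length \<open>2 ^ n\<close> in independent uniform letters
  from \<open>L\<close>, formed by repeatedly taking differences of independent copies.
\<close>

primrec wsupp :: "'g::group_add set \<Rightarrow> nat \<Rightarrow> 'g set" where
  "wsupp L 0 = L"
| "wsupp L (Suc n) = diff_supp (wsupp L n)"

primrec wlaw :: "'g::group_add set \<Rightarrow> nat \<Rightarrow> 'g \<Rightarrow> real" where
  "wlaw L 0 = (\<lambda>_. 1 / real (card L))"
| "wlaw L (Suc n) = diff_law (wsupp L n) (wlaw L n)"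

lemma finite_wsupp: "finite L \<Longrightarrow> finite (wsupp L n)"
  by (induction n) (simp_all add: diff_supp_def)

lemma wlaw_nonneg: "0 \<le> wlaw L n x"
  by (induction n arbitrary: x) (auto simp: diff_law_def intro!: sum_nonneg)

lemma sum_wlaw_Suc:
  assumes "finite L"
  shows "(\<Sum>z\<in>wsupp L (Suc n). wlaw L (Suc n) z * \<phi> z)
    = (\<Sum>x\<in>wsupp L n. \<Sum>y\<in>wsupp L n. wlaw L n x * wlaw L n y * \<phi> (x - y))"
  using sum_diff_law[OF finite_wsupp[OF assms]] by simp

lemma sum_wlaw:
  assumes "finite L" "L \<noteq> {}"
  shows "sum (wlaw L n) (wsupp L n) = 1"
proof (induction n)
  case (Suc n)
  have "sum (wlaw L (Suc n)) (wsupp L (Suc n)) = (\<Sum>z\<in>wsupp L (Suc n). wlaw L (Suc n) z * 1)" by simp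
  also have "\<dots> = (\<Sum>x\<in>wsupp L n. \<Sum>y\<in>wsupp L n. wlaw L n x * wlaw L n y)"
    unfolding sum_wlaw_Suc[OF assms(1)] by simp
  also have "\<dots> = 1" by (simp add: Suc sum_distrib_left[symmetric])
  finally show ?case .
qed (use assms in simp)

definition wprob :: "'g::group_add set \<Rightarrow> nat \<Rightarrow> ('g \<Rightarrow> bool) \<Rightarrow> real" where
  "wprob L n P = (\<Sum>z\<in>wsupp L n. wlaw L n z * of_bool (P z))"

lemma wprob_eq_sum:
  assumes "finite L"
  shows "wprob L n P = sum (wlaw L n) {z \<in> wsupp L n. P z}"
  unfolding wprob_def using finite_wsupp[OF assms]
  by (simp add: of_bool_def if_distrib sum.inter_filter cong: if_cong)

lemma wprob_Suc:
  assumes "finite L"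
  shows "wprob L (Suc n) P = (\<Sum>x\<in>wsupp L n. \<Sum>y\<in>wsupp L n. wlaw L n x * wlaw L n y * of_bool (P (x - y)))"
  unfolding wprob_def by (rule sum_wlaw_Suc[OF assms])

text \<open>Exchanging the independent halves of \<open>x - y\<close> inverts the word, so every law
  from scale \<open>1\<close> on is symmetric.\<close>

lemma wprob_uminus:
  assumes "finite L"
  shows "wprob L (Suc n) (\<lambda>z. P (- z)) = wprob L (Suc n) P"
  unfolding wprob_Suc[OF assms] by (subst sum.swap) (simp add: mult.commute)

text \<open>The leftmost letter of a word always occurs with positive sign; condition on the others.\<close>

lemma wprob_le_letters:
  assumes L: "finite L" "L \<noteq> {}" and c: "\<And>g. real (card {f \<in> L. P (f - g)}) \<le> c"
  shows "wprob L n P \<le> c / real (card L)"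
  using c
proof (induction n arbitrary: P)
  case 0
  have "wprob L 0 P = real (card {f \<in> L. P (f - 0)}) / real (card L)"
    by (simp add: wprob_eq_sum[OF L(1)])
  with 0[of 0] show ?case by (simp add: divide_right_mono)
next
  case (Suc n)
  have "wprob L (Suc n) P = (\<Sum>y\<in>wsupp L n. wlaw L n y * wprob L n (\<lambda>x. P (x - y)))"
    unfolding wprob_Suc[OF L(1)] by (subst sum.swap) (simp add: wprob_def sum_distrib_left mult_ac)
  also have "\<dots> \<le> (\<Sum>y\<in>wsupp L n. wlaw L n y * (c / real (card L)))"
  proof (intro sum_mono mult_left_mono wlaw_nonneg Suc.IH)
    fix y g
    \<comment> \<open>The right half \<open>y\<close> of the word is absorbed into the shift
      \<open>g\<close>; the hypothesis ranges over all shifts for this reason.\<close>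
    have "{f \<in> L. P (f - g - y)} = {f \<in> L. P (f - (y + g))}"
      by (simp add: diff_conv_add_uminus minus_add add.assoc del: add_uminus_conv_diff)
    then show "real (card {f \<in> L. P (f - g - y)}) \<le> c" using Suc.prems by simp
  qed
  also have "\<dots> = c / real (card L)" unfolding sum_distrib_right[symmetric] by (simp add: sum_wlaw[OF L])
  finally show ?case .
qed

text \<open>Otherwise each of the \<open>J\<close> scales multiplies \<open>s\<close> by more than
  \<open>K\<close>, and \<open>1 \<le> s 1\<close> leads to
  \<open>s (Suc J) > K ^ J \<ge> M\<close>.\<close>

lemma slow_growth_exists:
  fixes s :: "nat \<Rightarrow> real"
  assumes "0 \<le> K" "M \<le> K ^ J" "1 \<le> J" "1 \<le> s 1" "s (Suc J) \<le> M"
  shows "\<exists>n\<in>{1..J}. s (Suc n) \<le> K * s n"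
proof (rule ccontr)
  assume "\<not> ?thesis"
  then have less: "K * s n < s (Suc n)" if "1 \<le> n" "n \<le> J" for n using that by force
  have grow: "K ^ n \<le> s (Suc n) \<and> (0 < n \<longrightarrow> K ^ n < s (Suc n))" if "n \<le> J" for n
    using that
  proof (induction n)
    case (Suc n)
    have "K ^ Suc n \<le> K * s (Suc n)" using Suc assms(1) by (auto intro!: mult_left_mono)
    also have "\<dots> < s (Suc (Suc n))" using Suc by (intro less) auto
    finally show ?case by simp
  qed (use assms in simp)
  show False using grow[of J] assms by simp
qed

text \<open>
  Let \<open>s n\<close> be the least size of a set carrying a fixed (tiny) proportion of the words of
  length \<open>2 ^ n\<close>. It cannot grow at every scale, and at a scale where it does not grow the words
  concentrate on a translate of a set of small tripling.
\<close>

lemma words_structure: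
  fixes L :: "'g::group_add set" and \<beta> M K \<kappa> :: real and J :: nat
  assumes L: "finite L" "L \<noteq> {}" and \<beta>: "0 < \<beta>" "\<beta> \<le> 1/4" and J: "1 \<le> J"
    and KM: "0 < K" "M \<le> K ^ J" and \<kappa>: "\<kappa> = K ^ 4"
    and R: "\<And>n. n \<le> Suc J \<Longrightarrow> R n \<subseteq> wsupp L n" "\<And>n. n \<le> Suc J \<Longrightarrow> \<beta> \<le> sum (wlaw L n) (R n)"
      "real (card (R (Suc J))) \<le> M"
  obtains n S A where "1 \<le> n" "n \<le> J" "finite S" "0 \<in> S" "\<And>s. s \<in> S \<Longrightarrow> - s \<in> S"
    "S \<subseteq> {- a + b | a b. a \<in> wsupp L n \<and> b \<in> wsupp L n}"
    "real (card A) \<le> 2 * \<kappa> * real (card S)" "real (card A) \<le> \<kappa> * real (card (R n))"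
    "\<And>j. real (card (nsums j S)) \<le> (2 * \<kappa>\<^sup>2) ^ j * real (card (A :: 'g set))"
    "\<exists>g. \<beta> ^ (4 ^ J) * real (card L) \<le> 16 * \<kappa> ^ 3 * real (card {f \<in> L. f - g \<in> S})"
proof -
  \<comment> \<open>Going down one scale, \<open>popular_differences_step\<close> asks for a
    proportion below \<open>1 / 16\<close> of the square. The fourth power achieves this for
    \<open>\<beta> \<le> 1/4\<close>: half of the exponent gives the square, and the other half is
    at least \<open>2\<close>, which gives \<open>1 / 16\<close>. At scale \<open>Suc J\<close> the
    proportion is \<open>\<beta>\<close> itself.\<close>
  define \<eta> where "\<eta> n = \<beta> ^ (4 ^ (Suc J - n))" for n
  have \<eta>0: "0 < \<eta> n" for n using \<beta> by (simp add: \<eta>_def)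
  have \<eta>\<beta>: "\<eta> n \<le> \<beta>" for n
    using power_decreasing[of 1 "4 ^ (Suc J - n)" \<beta>] \<beta> by (simp add: \<eta>_def)
  have \<eta>step: "\<eta> n \<le> (\<eta> (Suc n))\<^sup>2 / 16" if "n \<le> J" for n
  proof -
    define e where "e = (4::nat) ^ (J - n)"
    have e1: "1 \<le> e" by (simp add: e_def)
    have "\<eta> n = \<beta> ^ (2 * e) * \<beta> ^ (2 * e)"
      using that by (simp add: \<eta>_def e_def Suc_diff_le flip: power_add)
    also have "\<dots> \<le> \<beta> ^ (2 * e) * \<beta> ^ 2"
      using \<beta> e1 by (intro mult_left_mono power_decreasing) auto
    also have "\<dots> \<le> \<beta> ^ (2 * e) * (1/4) ^ 2"
      using \<beta> by (intro mult_left_mono power_mono) auto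
    also have "\<dots> = (\<eta> (Suc n))\<^sup>2 / 16"
      by (simp add: \<eta>_def e_def power2_eq_square mult_2 power_add)
    finally show ?thesis .
  qed
  have \<eta>min: "\<beta> ^ (4 ^ J) \<le> \<eta> n" if "1 \<le> n" for n
    unfolding \<eta>_def
  proof (rule power_decreasing)
    show "4 ^ (Suc J - n) \<le> (4::nat) ^ J" using that by (intro power_increasing) auto
  qed (use \<beta> in auto)
  define big where "big n Z \<longleftrightarrow> Z \<subseteq> wsupp L n \<and> \<eta> n \<le> sum (wlaw L n) Z" for n Z
  define s where "s n = (LEAST c. \<exists>Z. big n Z \<and> card Z = c)" for n
  have bigR: "big n (R n)" if "n \<le> Suc J" for n
    using R(1,2)[OF that] \<eta>\<beta>[of n] by (simp add: big_def)
  have s_le: "s n \<le> card Z" if "big n Z" for n Z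
    unfolding s_def using that by (intro Least_le) auto
  have s_ex: "\<exists>Z. big n Z \<and> card Z = s n" if "n \<le> Suc J" for n
    unfolding s_def by (rule LeastI_ex) (use bigR[OF that] in blast)
  have s1: "1 \<le> s n" if n: "n \<le> Suc J" for n
  proof -
    obtain Z where Z: "big n Z" "card Z = s n" using s_ex[OF n] by auto
    then have "Z \<noteq> {}" using \<eta>0[of n] by (auto simp: big_def)
    moreover have "finite Z" using Z finite_wsupp[OF L(1)] by (auto simp: big_def intro: finite_subset)
    ultimately show ?thesis using Z(2) by (metis One_nat_def Suc_leI card_gt_0_iff)
  qed
  have "real (s (Suc J)) \<le> M" using s_le[OF bigR, of "Suc J"] R(3) by simp
  then obtain n where n: "n \<in> {1..J}" and sK: "real (s (Suc n)) \<le> K * real (s n)"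
    using slow_growth_exists[of K M J "\<lambda>n. real (s n)"] KM J s1[of 1] by auto
  define W where "W = wsupp L n"
  define m where "m = wlaw L n"
  have finW: "finite W" using finite_wsupp[OF L(1)] by (simp add: W_def)
  have mW: "0 \<le> m x" "sum m W = 1" for x
    using wlaw_nonneg sum_wlaw[OF L] by (auto simp: m_def W_def)
  obtain V where V: "big (Suc n) V" "card V = s (Suc n)" using s_ex[of "Suc n"] n by auto
  have finV: "finite V" using V finite_wsupp[OF L(1)] by (auto simp only: big_def intro: finite_subset)
  have minW: "s n \<le> card Z" if "Z \<subseteq> W" "\<eta> n \<le> sum m Z" for Z
    using that by (intro s_le) (simp add: big_def W_def m_def)
  have dens: "\<eta> (Suc n) \<le> (\<Sum>x\<in>W. \<Sum>y\<in>W. m x * m y * of_bool (x - y \<in> V))"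
  proof -
    have "{z \<in> wsupp L (Suc n). z \<in> V} = V" using V(1) by (auto simp only: big_def)
    then have "wprob L (Suc n) (\<lambda>z. z \<in> V) = sum (wlaw L (Suc n)) V"
      by (simp only: wprob_eq_sum[OF L(1)])
    with V(1) have "\<eta> (Suc n) \<le> wprob L (Suc n) (\<lambda>z. z \<in> V)" by (simp only: big_def)
    then show ?thesis unfolding wprob_Suc[OF L(1)] by (simp add: W_def m_def)
  qed
  have \<eta>1: "\<eta> (Suc n) \<le> 1" using \<eta>\<beta>[of "Suc n"] \<beta> by simp
  obtain A where A: "A \<subseteq> W" "\<eta> (Suc n) / 4 \<le> sum m A"
      "s n ^ 3 * card ((\<lambda>(a, b). a - b) ` (A \<times> A)) \<le> card V ^ 4"
    using popular_differences_step[OF finW finV mW minW \<eta>step \<eta>0 \<eta>1 dens] n by auto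
  have finA: "finite A" using A(1) finW finite_subset by blast
  have "\<eta> n \<le> \<eta> (Suc n) / 4"
  proof -
    have "(\<eta> (Suc n))\<^sup>2 \<le> \<eta> (Suc n) * 1"
      unfolding power2_eq_square using \<eta>0[of "Suc n"] \<eta>1 by (intro mult_left_mono) auto
    with \<eta>step[of n] n \<eta>0[of "Suc n"] show ?thesis by simp
  qed
  then have sA: "s n \<le> card A" using A by (intro minW) auto
  have spos: "0 < real (s n)" using s1[of n] n by simp
  have neA: "A \<noteq> {}" using sA spos by auto
  have K4: "real (card ((\<lambda>(a, b). a - b) ` (A \<times> A))) \<le> \<kappa> * real (s n)"
  proof -
    have "real (s n) ^ 3 * real (card ((\<lambda>(a, b). a - b) ` (A \<times> A))) \<le> real (card V) ^ 4"
      using A(3) by (metis of_nat_le_iff of_nat_mult of_nat_power)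
    also have "\<dots> \<le> (K * real (s n)) ^ 4" using sK V(2) by (intro power_mono) auto
    also have "\<dots> = real (s n) ^ 3 * (\<kappa> * real (s n))"
      by (simp add: \<kappa> power_mult_distrib power_numeral_reduce)
    finally show ?thesis by (rule mult_left_le_imp_le) (use spos in simp)
  qed
  have \<kappa>0: "0 < \<kappa>" using KM(1) by (simp add: \<kappa>)
  have "\<kappa> * real (s n) \<le> \<kappa> * real (card A)"
    using sA \<kappa>0 by (intro mult_left_mono) auto
  with K4 have small: "real (card ((\<lambda>(a, b). a - b) ` (A \<times> A))) \<le> \<kappa> * real (card A)"
    by linarith
  obtain S where S: "finite S" "S \<subseteq> {- a + b | a b. a \<in> A \<and> b \<in> A}" "0 \<in> S"
    "\<And>s. s \<in> S \<Longrightarrow> - s \<in> S" "real (card A) \<le> 2 * \<kappa> * real (card S)"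
    "\<And>n. real (card (nsums n S)) \<le> (2 * \<kappa>\<^sup>2) ^ n * real (card A)"
    "\<exists>x. sum m A \<le> 4 * \<kappa> ^ 3 * sum m {a \<in> A. - x + a \<in> S}"
    by (rule popular_quotients_structure[OF finA neA small, of m]) (use mW(1) in auto)
  \<comment> \<open>The trivial embedding of \<open>A\<close> into its difference set suffices: that
    set has at most \<open>\<kappa> * s n\<close> elements, and \<open>R n\<close> is one of the
    sets over which \<open>s n\<close> is the minimum.\<close>
  have AR: "real (card A) \<le> \<kappa> * real (card (R n))"
  proof -
    obtain b where b: "b \<in> A" using neA by auto
    have "card A \<le> card ((\<lambda>(a, b). a - b) ` (A \<times> A))"
      by (rule card_inj_on_le[where f = "\<lambda>a. a - b"]) (use b finA in \<open>auto simp: inj_on_def\<close>)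
    then have "real (card A) \<le> \<kappa> * real (s n)" using K4 by simp
    also have "\<dots> \<le> \<kappa> * real (card (R n))"
      using s_le[OF bigR, of n] n \<kappa>0 by (intro mult_left_mono) auto
    finally show ?thesis .
  qed
  have "\<exists>g. \<beta> ^ (4 ^ J) * real (card L) \<le> 16 * \<kappa> ^ 3 * real (card {f \<in> L. f - g \<in> S})"
  proof (rule ccontr)
    assume "\<not> ?thesis"
    then have neg: "16 * \<kappa> ^ 3 * real (card {f \<in> L. f - g \<in> S}) < \<beta> ^ (4 ^ J) * real (card L)" for g
      by (simp add: not_le)
    define k where "k = real (card L)"
    have k0: "0 < k" using L by (simp add: k_def card_gt_0_iff)
    define c where "c = (MAX g. real (card {f \<in> L. f - g \<in> S}))"
    have fc: "finite (range (\<lambda>g. real (card {f \<in> L. f - g \<in> S})))"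
    proof (rule finite_subset)
      show "range (\<lambda>g. real (card {f \<in> L. f - g \<in> S})) \<subseteq> real ` {..card L}"
        using L(1) by (auto intro!: imageI card_mono)
    qed simp
    have c: "real (card {f \<in> L. f - g \<in> S}) \<le> c" for g
      unfolding c_def using fc by (intro Max_ge) auto
    have "c \<in> range (\<lambda>g. real (card {f \<in> L. f - g \<in> S}))"
      unfolding c_def using fc by (intro Max_in) auto
    then have c_lt: "16 * \<kappa> ^ 3 * c < \<beta> ^ (4 ^ J) * k" using neg by (auto simp: k_def)
    obtain x where x: "sum m A \<le> 4 * \<kappa> ^ 3 * sum m {a \<in> A. - x + a \<in> S}" using S(7) by auto
    obtain n' where n': "n = Suc n'" using n by (cases n) auto
    have "sum m {a \<in> A. - x + a \<in> S} \<le> sum m {a \<in> W. - x + a \<in> S}"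
      using A(1) finW mW by (intro sum_mono2) auto
    also have "\<dots> = wprob L n (\<lambda>a. - x + a \<in> S)" by (simp add: wprob_eq_sum[OF L(1)] W_def m_def)
    \<comment> \<open>In \<open>- x + a\<close> the leftmost letter of \<open>a\<close> stands in
      the middle of the sum. Inverting \<open>a\<close>, which the law permits because
      \<open>n\<close> is positive, moves that letter to the end, and the symmetry of
      \<open>S\<close> then turns the condition into membership of the letter in a coset of
      \<open>S\<close>.\<close>
    also have "\<dots> = wprob L n (\<lambda>a. - x + - a \<in> S)" unfolding n' by (rule wprob_uminus[OF L(1), symmetric])
    also have "\<dots> \<le> c / k" unfolding k_def
    proof (rule wprob_le_letters[OF L])
      fix g
      have "{f \<in> L. - x + - (f - g) \<in> S} = {f \<in> L. f - (- x + g) \<in> S}"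
      proof -
        have "- x + - (f - g) \<in> S \<longleftrightarrow> f - (- x + g) \<in> S" for f
        proof -
          have "- (- x + - (f - g)) = f - (- x + g)"
            by (simp add: diff_conv_add_uminus minus_add add.assoc del: add_uminus_conv_diff)
          then show ?thesis using S(4) by (metis minus_minus)
        qed
        then show ?thesis by auto
      qed
      then show "real (card {f \<in> L. - x + - (f - g) \<in> S}) \<le> c" using c by simp
    qed
    finally have "sum m {a \<in> A. - x + a \<in> S} \<le> c / k" .
    then have "4 * \<kappa> ^ 3 * sum m {a \<in> A. - x + a \<in> S} \<le> 4 * \<kappa> ^ 3 * (c / k)"
      using \<kappa>0 by (intro mult_left_mono) auto
    moreover have "\<beta> ^ (4 ^ J) \<le> 4 * sum m A" using A(2) \<eta>min[of "Suc n"] by simp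
    ultimately have "\<beta> ^ (4 ^ J) \<le> 16 * \<kappa> ^ 3 * (c / k)" using x by simp
    then have "\<beta> ^ (4 ^ J) * k \<le> 16 * \<kappa> ^ 3 * c" using k0 by (simp add: field_simps)
    with c_lt show False by simp
  qed
  moreover have "S \<subseteq> {- a + b | a b. a \<in> wsupp L n \<and> b \<in> wsupp L n}"
    using S(2) A(1) by (fastforce simp: W_def)
  ultimately show thesis
    using that[of n S A] n S AR by simp
qed

section \<open>Bijections and rich words\<close>

text \<open>The permutations of a type are an instance of \<open>group_add\<close>, with composition
  as addition. The affine maps of a field given by a carrier set thus become elements of a type
  class group, to which the results on random words apply.\<close>

typedef 'a bijection = "{f :: 'a \<Rightarrow> 'a. bij f}"
  morphisms app Bijection by (auto intro: exI[of _ id])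

instantiation bijection :: (type) group_add
begin

definition zero_bijection :: "'a bijection" where "0 = Bijection id"
definition plus_bijection :: "'a bijection \<Rightarrow> 'a bijection \<Rightarrow> 'a bijection"
  where "f + g = Bijection (app f \<circ> app g)"
definition uminus_bijection :: "'a bijection \<Rightarrow> 'a bijection"
  where "- f = Bijection (inv_into UNIV (app f))"
definition minus_bijection :: "'a bijection \<Rightarrow> 'a bijection \<Rightarrow> 'a bijection"
  where "f - g = f + - (g :: 'a bijection)"

instance
proof
  fix f g h :: "'a bijection"
  have bij: "bij (app k)" for k :: "'a bijection" using app[of k] by simp
  have plus: "app (f + g) = app f \<circ> app g" for f g :: "'a bijection"
    by (simp add: plus_bijection_def Bijection_inverse bij bij_comp)
  have zero: "app (0 :: 'a bijection) = id"
    by (simp add: zero_bijection_def Bijection_inverse)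
  show "f + g + h = f + (g + h)" by (simp add: app_inject[symmetric] plus comp_assoc)
  show "0 + f = f" "f + 0 = f" by (simp_all add: app_inject[symmetric] plus zero)
  have "app (- f) = inv_into UNIV (app f)"
    by (simp add: uminus_bijection_def Bijection_inverse bij bij_imp_bij_inv)
  then show "- f + f = 0"
    using bij[of f] by (simp add: app_inject[symmetric] plus zero bij_is_inj)
  show "f + - g = f - g" by (simp add: minus_bijection_def)
qed

end

lemma bij_app: "bij (app f)" using app[of f] by simp

lemma app_add [simp]: "app (f + g) x = app f (app g x)"
  by (simp add: plus_bijection_def Bijection_inverse bij_app bij_comp)

lemma app_0 [simp]: "app 0 x = x"
  by (simp add: zero_bijection_def Bijection_inverse)

lemma app_uminus_app [simp]: "app (- f) (app f x) = x" "app f (app (- f) x) = x"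
  using app_add[of "- f" f x] app_add[of f "- f" x] by simp_all

lemma app_eq_iff [simp]: "app f x = app f y \<longleftrightarrow> x = y"
  using bij_app[of f] by (auto simp: bij_def inj_def)

lemma bijection_eqI: "(\<And>x. app f x = app g x) \<Longrightarrow> f = g"
  by (simp add: app_inject[symmetric] fun_eq_iff)

definition rcount :: "'a set \<Rightarrow> 'a bijection \<Rightarrow> nat" where
  "rcount Y f = card {y \<in> Y. app f y \<in> Y}"

lemma rcount_le: "finite Y \<Longrightarrow> rcount Y f \<le> card Y"
  unfolding rcount_def by (intro card_mono) auto

text \<open>If \<open>z\<close>, \<open>app x z\<close> and \<open>app y z\<close> lie in
  \<open>Y\<close>, then \<open>app y z\<close> is a point of \<open>Y\<close> that
  \<open>x - y\<close> maps into \<open>Y\<close>. Hence the expected count for \<open>x - y\<close>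
  is at least the sum over \<open>z \<in> Y\<close> of the squared probability that a word of half
  the length maps \<open>z\<close> into \<open>Y\<close>, and Cauchy-Schwarz shows that the
  proportion is at worst squared.\<close>

lemma expected_rcount_ge:
  fixes L :: "'a bijection set"
  assumes L: "finite L" "L \<noteq> {}" and Y: "finite Y" "Y \<noteq> {}" and \<alpha>: "0 \<le> \<alpha>"
    and rich: "\<And>f. f \<in> L \<Longrightarrow> \<alpha> * real (card Y) \<le> real (rcount Y f)"
  shows "\<alpha> ^ (2 ^ n) * real (card Y) \<le> (\<Sum>z\<in>wsupp L n. wlaw L n z * real (rcount Y z))"
proof (induction n)
  case 0
  have "\<alpha> * real (card Y) = (\<Sum>z\<in>L. 1 / real (card L) * (\<alpha> * real (card Y)))" using L by simp
  also have "\<dots> \<le> (\<Sum>z\<in>L. 1 / real (card L) * real (rcount Y z))"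
    using rich by (intro sum_mono mult_left_mono) auto
  finally show ?case by simp
next
  case (Suc n)
  define W where "W = wsupp L n"
  define m where "m = wlaw L n"
  have m0: "0 \<le> m x" for x by (simp add: m_def wlaw_nonneg)
  define i where "i x z = (of_bool (app x z \<in> Y) :: real)" for x :: "'a bijection" and z
  define N where "N = real (card Y)"
  have N: "0 < N" using Y by (simp add: N_def card_gt_0_iff)
  have rc: "real (rcount Y x) = (\<Sum>z\<in>Y. i x z)" for x
    using Y by (simp add: rcount_def i_def of_bool_def sum.inter_filter[symmetric])
  have rdiff: "(\<Sum>z\<in>Y. i x z * i y z) \<le> real (rcount Y (x - y))" for x y
  proof -
    have "(\<Sum>z\<in>Y. i x z * i y z) = (\<Sum>z\<in>Y. if app x z \<in> Y \<and> app y z \<in> Y then 1 else 0)"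
      by (intro sum.cong) (auto simp: i_def)
    also have "\<dots> = real (card {z \<in> Y. app x z \<in> Y \<and> app y z \<in> Y})"
      using Y by (simp add: sum.inter_filter[symmetric])
    also have "card {z \<in> Y. app x z \<in> Y \<and> app y z \<in> Y} \<le> rcount Y (x - y)"
      unfolding rcount_def
      by (rule card_inj_on_le[where f = "app y"])
        (use Y in \<open>auto simp: inj_on_def diff_conv_add_uminus simp del: add_uminus_conv_diff\<close>)
    finally show ?thesis by simp
  qed
  define u where "u z = (\<Sum>x\<in>W. m x * i x z)" for z
  have "\<alpha> ^ (2 ^ n) * N \<le> (\<Sum>x\<in>W. \<Sum>z\<in>Y. m x * i x z)"
    using Suc by (simp add: W_def m_def rc N_def sum_distrib_left)
  also have "\<dots> = (\<Sum>z\<in>Y. u z)" unfolding u_def by (rule sum.swap)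
  finally have "(\<alpha> ^ (2 ^ n) * N)\<^sup>2 \<le> (\<Sum>z\<in>Y. 1 * u z)\<^sup>2"
    using \<alpha> N by (intro power_mono) auto
  also have "\<dots> \<le> (\<Sum>z\<in>Y. 1\<^sup>2) * (\<Sum>z\<in>Y. (u z)\<^sup>2)" by (rule Cauchy_Schwarz_ineq_sum)
  also have "\<dots> = N * (\<Sum>z\<in>Y. (u z)\<^sup>2)" by (simp add: N_def)
  finally have "N * (\<alpha> ^ (2 ^ Suc n) * N) \<le> N * (\<Sum>z\<in>Y. (u z)\<^sup>2)"
    by (simp add: power2_eq_square power_add mult_2 mult_ac)
  then have "\<alpha> ^ (2 ^ Suc n) * N \<le> (\<Sum>z\<in>Y. (u z)\<^sup>2)" by (rule mult_left_le_imp_le[OF _ N])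
  also have "\<dots> = (\<Sum>z\<in>Y. \<Sum>x\<in>W. \<Sum>y\<in>W. m x * m y * (i x z * i y z))"
    by (simp add: u_def power2_eq_square sum_product mult_ac)
  also have "\<dots> = (\<Sum>x\<in>W. \<Sum>z\<in>Y. \<Sum>y\<in>W. m x * m y * (i x z * i y z))" by (rule sum.swap)
  also have "\<dots> = (\<Sum>x\<in>W. \<Sum>y\<in>W. \<Sum>z\<in>Y. m x * m y * (i x z * i y z))"
    by (intro sum.cong refl sum.swap)
  also have "\<dots> = (\<Sum>x\<in>W. \<Sum>y\<in>W. m x * m y * (\<Sum>z\<in>Y. i x z * i y z))"
    by (simp add: sum_distrib_left)
  also have "\<dots> \<le> (\<Sum>x\<in>W. \<Sum>y\<in>W. m x * m y * real (rcount Y (x - y)))"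
    using m0 rdiff by (intro sum_mono mult_left_mono mult_nonneg_nonneg) auto
  also have "\<dots> = (\<Sum>z\<in>wsupp L (Suc n). wlaw L (Suc n) z * real (rcount Y z))"
    unfolding sum_wlaw_Suc[OF L(1)] by (simp add: W_def m_def)
  finally show ?case by (simp add: N_def)
qed

text \<open>Words below half of the guaranteed expectation contribute at most that half, and no
  count exceeds \<open>card Y\<close>; the other half must come from the mass of the rich
  words.\<close>

lemma rich_words_mass:
  fixes L :: "'a bijection set"
  assumes L: "finite L" "L \<noteq> {}" and Y: "finite Y" "Y \<noteq> {}" and \<alpha>: "0 \<le> \<alpha>"
    and rich: "\<And>f. f \<in> L \<Longrightarrow> \<alpha> * real (card Y) \<le> real (rcount Y f)"
  shows "\<alpha> ^ (2 ^ n) / 2 \<le> sum (wlaw L n) {z \<in> wsupp L n. \<alpha> ^ (2 ^ n) / 2 * real (card Y) \<le> real (rcount Y z)}"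
proof -
  define W where "W = wsupp L n"
  define m where "m = wlaw L n"
  define N where "N = real (card Y)"
  define d where "d = \<alpha> ^ (2 ^ n) / 2"
  define R where "R = {z \<in> W. d * N \<le> real (rcount Y z)}"
  have finW: "finite W" using finite_wsupp[OF L(1)] by (simp add: W_def)
  have m0: "0 \<le> m x" for x by (simp add: m_def wlaw_nonneg)
  have N: "0 < N" using Y by (simp add: N_def card_gt_0_iff)
  have d0: "0 \<le> d" using \<alpha> by (simp add: d_def)
  have "2 * d * N \<le> (\<Sum>z\<in>W. m z * real (rcount Y z))"
    using expected_rcount_ge[OF assms] by (simp add: d_def N_def W_def m_def)
  also have "\<dots> = (\<Sum>z\<in>W - R. m z * real (rcount Y z)) + (\<Sum>z\<in>R. m z * real (rcount Y z))"
    by (rule sum.subset_diff) (auto simp: R_def finW)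
  also have "(\<Sum>z\<in>W - R. m z * real (rcount Y z)) \<le> (\<Sum>z\<in>W - R. m z * (d * N))"
    using m0 by (intro sum_mono mult_left_mono) (auto simp: R_def)
  also have "\<dots> \<le> (\<Sum>z\<in>W. m z * (d * N))"
    using m0 d0 N finW by (intro sum_mono2) auto
  also have "\<dots> = d * N" by (simp add: sum_distrib_right[symmetric] W_def m_def sum_wlaw[OF L])
  also have "(\<Sum>z\<in>R. m z * real (rcount Y z)) \<le> (\<Sum>z\<in>R. m z * N)"
    using m0 rcount_le[OF Y(1)] by (intro sum_mono mult_left_mono) (auto simp: N_def)
  also have "\<dots> = sum m R * N" by (simp add: sum_distrib_right)
  finally have "d * N \<le> sum m R * N" by (simp add: algebra_simps)
  then have "d \<le> sum m R" by (rule mult_right_le_imp_le[OF _ N])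
  then show ?thesis by (simp add: d_def R_def m_def W_def N_def)
qed

section \<open>Affine maps of a field\<close>

context field begin

text \<open>Extended by the identity outside the carrier, so that it permutes the whole
  type.\<close>

definition aff_fun :: "'a \<Rightarrow> 'a \<Rightarrow> 'a \<Rightarrow> 'a" where
  "aff_fun a b x = (if x \<in> carrier R then a \<otimes> x \<oplus> b else x)"

definition affine :: "'a \<Rightarrow> 'a \<Rightarrow> 'a bijection" where
  "affine a b = Bijection (aff_fun a b)"

definition affines :: "'a bijection set" where
  "affines = {affine a b | a b. a \<in> carrier R \<and> a \<noteq> \<zero> \<and> b \<in> carrier R}"

text \<open>Read off from two values, so that it depends on the bijection alone and not on chosen
  coefficients.\<close>

definition slope :: "'a bijection \<Rightarrow> 'a" where
  "slope f = app f \<one> \<ominus> app f \<zero>"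

lemma inverse_props:
  assumes "a \<in> carrier R" "a \<noteq> \<zero>"
  shows "inv a \<in> carrier R" "inv a \<noteq> \<zero>" "inv a \<otimes> a = \<one>" "a \<otimes> inv a = \<one>"
proof -
  have u: "a \<in> Units R" using assms field_Units by auto
  then show "inv a \<in> carrier R" "inv a \<otimes> a = \<one>" "a \<otimes> inv a = \<one>" by auto
  show "inv a \<noteq> \<zero>" using u assms by (metis Units_inv_Units field_Units DiffE insertCI)
qed

lemma aff_fun_inverse:
  assumes a: "a \<in> carrier R" "a \<noteq> \<zero>" and b: "b \<in> carrier R"
  shows "aff_fun (inv a) (\<ominus> (inv a \<otimes> b)) (aff_fun a b x) = x"
    and "aff_fun a b (aff_fun (inv a) (\<ominus> (inv a \<otimes> b)) x) = x"
proof -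
  note i = inverse_props[OF a]
  show "aff_fun (inv a) (\<ominus> (inv a \<otimes> b)) (aff_fun a b x) = x"
  proof (cases "x \<in> carrier R")
    case True
    have "inv a \<otimes> (a \<otimes> x \<oplus> b) \<oplus> \<ominus> (inv a \<otimes> b) = (inv a \<otimes> a) \<otimes> x"
      using True a b i(1) by algebra
    with True a b i show ?thesis by (simp add: aff_fun_def)
  qed (simp add: aff_fun_def)
  show "aff_fun a b (aff_fun (inv a) (\<ominus> (inv a \<otimes> b)) x) = x"
  proof (cases "x \<in> carrier R")
    case True
    have "a \<otimes> (inv a \<otimes> x \<oplus> \<ominus> (inv a \<otimes> b)) \<oplus> b = (a \<otimes> inv a) \<otimes> x \<oplus> (\<ominus> ((a \<otimes> inv a) \<otimes> b) \<oplus> b)"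
      using True a b i(1) by algebra
    also have "\<dots> = x" using True b i by (simp add: l_neg)
    finally show ?thesis using True a b i by (simp add: aff_fun_def)
  qed (simp add: aff_fun_def)
qed

lemma bij_aff_fun:
  assumes "a \<in> carrier R" "a \<noteq> \<zero>" "b \<in> carrier R"
  shows "bij (aff_fun a b)"
  by (rule o_bij[of "aff_fun (inv a) (\<ominus> (inv a \<otimes> b))"])
    (simp_all add: fun_eq_iff aff_fun_inverse[OF assms])

lemma app_affine:
  assumes "a \<in> carrier R" "a \<noteq> \<zero>" "b \<in> carrier R"
  shows "app (affine a b) = aff_fun a b"
  using bij_aff_fun[OF assms] by (simp add: affine_def Bijection_inverse)

lemma affine_add:
  assumes "a \<in> carrier R" "a \<noteq> \<zero>" "b \<in> carrier R" "c \<in> carrier R" "c \<noteq> \<zero>" "d \<in> carrier R"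
  shows "affine a b + affine c d = affine (a \<otimes> c) (a \<otimes> d \<oplus> b)"
proof (rule bijection_eqI)
  fix x
  have ac: "a \<otimes> c \<noteq> \<zero>" "a \<otimes> c \<in> carrier R" using assms integral_iff by auto
  have "a \<otimes> (c \<otimes> x \<oplus> d) \<oplus> b = a \<otimes> c \<otimes> x \<oplus> (a \<otimes> d \<oplus> b)" if "x \<in> carrier R"
    using that assms by (simp add: r_distr m_assoc a_assoc)
  then show "app (affine a b + affine c d) x = app (affine (a \<otimes> c) (a \<otimes> d \<oplus> b)) x"
    using assms ac by (simp add: app_affine aff_fun_def)
qed

lemma affine_uminus:
  assumes "a \<in> carrier R" "a \<noteq> \<zero>" "b \<in> carrier R"
  shows "- affine a b = affine (inv a) (\<ominus> (inv a \<otimes> b))"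
proof -
  have "affine (inv a) (\<ominus> (inv a \<otimes> b)) + affine a b = 0"
    by (rule bijection_eqI) (use assms inverse_props[OF assms(1,2)] in \<open>simp add: app_affine aff_fun_inverse\<close>)
  then show ?thesis by (simp add: eq_neg_iff_add_eq_0 [symmetric])
qed

lemma affine_0: "affine \<one> \<zero> = 0"
  by (rule bijection_eqI) (simp add: app_affine aff_fun_def)

lemma slope_affine:
  assumes "a \<in> carrier R" "a \<noteq> \<zero>" "b \<in> carrier R"
  shows "slope (affine a b) = a"
proof -
  have "(a \<oplus> b) \<ominus> b = a" using assms by algebra
  then show ?thesis using assms by (simp add: slope_def app_affine aff_fun_def)
qed

lemma affinesE:
  assumes "f \<in> affines"
  obtains a b where "a \<in> carrier R" "a \<noteq> \<zero>" "b \<in> carrier R" "f = affine a b" "slope f = a"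
  using assms slope_affine by (auto simp: affines_def)

lemma affinesI: "a \<in> carrier R \<Longrightarrow> a \<noteq> \<zero> \<Longrightarrow> b \<in> carrier R \<Longrightarrow> affine a b \<in> affines"
  by (auto simp: affines_def)

lemma slope_carrier: "f \<in> affines \<Longrightarrow> slope f \<in> carrier R" "f \<in> affines \<Longrightarrow> slope f \<noteq> \<zero>"
  by (auto elim: affinesE)

lemma affines_add:
  assumes "f \<in> affines" "g \<in> affines"
  shows "f + g \<in> affines" "slope (f + g) = slope f \<otimes> slope g"
proof -
  from assms(1) obtain a b where f: "a \<in> carrier R" "a \<noteq> \<zero>" "b \<in> carrier R" "f = affine a b" "slope f = a"
    by (rule affinesE)
  from assms(2) obtain c d where g: "c \<in> carrier R" "c \<noteq> \<zero>" "d \<in> carrier R" "g = affine c d" "slope g = c"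
    by (rule affinesE)
  have ac: "a \<otimes> c \<noteq> \<zero>" "a \<otimes> c \<in> carrier R" using f g integral_iff by auto
  have eq: "f + g = affine (a \<otimes> c) (a \<otimes> d \<oplus> b)" using f g by (simp add: affine_add)
  show "f + g \<in> affines" unfolding eq using f g ac by (intro affinesI) auto
  show "slope (f + g) = slope f \<otimes> slope g" unfolding eq using f g ac by (simp add: slope_affine)
qed

lemma affines_uminus:
  assumes "f \<in> affines"
  shows "- f \<in> affines" "slope (- f) = inv (slope f)"
proof -
  from assms obtain a b where f: "a \<in> carrier R" "a \<noteq> \<zero>" "b \<in> carrier R" "f = affine a b" "slope f = a"
    by (rule affinesE)
  have eq: "- f = affine (inv a) (\<ominus> (inv a \<otimes> b))" using f affine_uminus by simp
  show "- f \<in> affines" unfolding eq using f inverse_props[OF f(1,2)] by (intro affinesI) auto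
  show "slope (- f) = inv (slope f)" unfolding eq using f inverse_props[OF f(1,2)] by (simp add: slope_affine)
qed

lemma affines_diff:
  assumes "f \<in> affines" "g \<in> affines"
  shows "f - g \<in> affines" "slope (f - g) = slope f \<otimes> inv (slope g)"
  using affines_add[OF assms(1) affines_uminus(1)[OF assms(2)]] affines_uminus(2)[OF assms(2)]
  by simp_all

lemma app_affines_carrier:
  assumes "f \<in> affines" "x \<in> carrier R"
  shows "app f x \<in> carrier R"
  using assms(1) by (rule affinesE) (use assms(2) in \<open>simp add: app_affine aff_fun_def\<close>)

definition transl :: "'a \<Rightarrow> 'a bijection" where
  "transl x = affine \<one> x"

lemma transl_props:
  assumes "x \<in> carrier R"
  shows "transl x \<in> affines" "slope (transl x) = \<one>" "app (transl x) \<zero> = x"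
  using assms by (simp_all add: transl_def affinesI slope_affine app_affine aff_fun_def)

lemma inj_transl: "inj_on transl (carrier R)"
  by (rule inj_on_inverseI[of _ "\<lambda>f. app f \<zero>"]) (rule transl_props(3))

lemma transl_add:
  "x \<in> carrier R \<Longrightarrow> y \<in> carrier R \<Longrightarrow> transl x + transl y = transl (x \<oplus> y)"
  by (simp add: transl_def affine_add a_comm)

lemma transl_0: "transl \<zero> = 0"
  by (simp add: transl_def affine_0)

lemma transl_uminus: "x \<in> carrier R \<Longrightarrow> - transl x = transl (\<ominus> x)"
  by (simp add: transl_def affine_uminus)

lemma slope_1_transl:
  assumes "f \<in> affines" "slope f = \<one>"
  obtains x where "x \<in> carrier R" "f = transl x"
  using assms by (auto elim!: affinesE simp: transl_def)

text \<open>Conjugation lets the slopes act on the translations by multiplication. This is how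
  products of field elements arise inside iterated sum sets of affine maps.\<close>

lemma transl_conj:
  assumes "f \<in> affines" "x \<in> carrier R"
  shows "f + transl x - f = transl (slope f \<otimes> x)"
proof -
  from assms(1) obtain a b where f: "a \<in> carrier R" "a \<noteq> \<zero>" "b \<in> carrier R" "f = affine a b" "slope f = a"
    by (rule affinesE)
  have "f + transl x = affine a (a \<otimes> x \<oplus> b)" using f assms(2) by (simp add: transl_def affine_add)
  also have "\<dots> = affine a (b \<oplus> a \<otimes> x)" using f assms(2) by (simp add: a_comm)
  also have "\<dots> = transl (a \<otimes> x) + f" using f assms(2) by (simp add: transl_def affine_add a_comm)
  finally show ?thesis using f by simp
qed

lemma same_slope_transl:
  assumes "f \<in> affines" "g \<in> affines" "slope f = slope g"
  obtains x where "x \<in> carrier R" "f - g = transl x"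
proof (rule slope_1_transl[of "f - g"])
  show "f - g \<in> affines" using affines_diff[OF assms(1,2)] by simp
  show "slope (f - g) = \<one>"
    using affines_diff[OF assms(1,2)] assms(3) inverse_props slope_carrier[OF assms(2)] by simp
qed (use that in auto)

lemma linear_eq_unique:
  assumes c: "c \<in> carrier R" "c \<noteq> \<zero>" and u: "u \<in> carrier R" and d: "d \<in> carrier R"
    and eq: "u \<otimes> c = d"
  shows "u = d \<otimes> inv c"
proof -
  note i = inverse_props[OF c]
  have "d \<otimes> inv c = u \<otimes> (c \<otimes> inv c)" unfolding eq[symmetric] using c u i(1) by (intro m_assoc)
  then show ?thesis using i u by simp
qed

lemma affine_agree_unique:
  assumes "a \<in> carrier R" "b \<in> carrier R" "c \<in> carrier R" "d \<in> carrier R" "a \<noteq> c"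
    and "x \<in> carrier R" "x' \<in> carrier R"
    and "a \<otimes> x \<oplus> b = c \<otimes> x \<oplus> d" "a \<otimes> x' \<oplus> b = c \<otimes> x' \<oplus> d"
  shows "x = x'"
proof -
  have "(a \<ominus> c) \<otimes> (x \<ominus> x') = (a \<otimes> x \<oplus> b) \<ominus> (c \<otimes> x \<oplus> d) \<ominus> ((a \<otimes> x' \<oplus> b) \<ominus> (c \<otimes> x' \<oplus> d))"
    using assms(1-4,6,7) by algebra
  also have "\<dots> = \<zero>" unfolding assms(8,9) using assms(1-4,6,7) by algebra
  finally have "a \<ominus> c = \<zero> \<or> x \<ominus> x' = \<zero>" using assms integral_iff by simp
  then show ?thesis using assms by (simp add: r_right_minus_eq)
qed

lemma affine_agree_exists:
  assumes "a \<in> carrier R" "b \<in> carrier R" "c \<in> carrier R" "d \<in> carrier R" "a \<noteq> c"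
  obtains x where "x \<in> carrier R" "a \<otimes> x \<oplus> b = c \<otimes> x \<oplus> d"
proof -
  have ac: "a \<ominus> c \<in> carrier R" "a \<ominus> c \<noteq> \<zero>" using assms by (auto simp: r_right_minus_eq)
  note i = inverse_props[OF ac]
  define x where "x = inv (a \<ominus> c) \<otimes> (d \<ominus> b)"
  have x: "x \<in> carrier R" using assms i by (simp add: x_def)
  have "(a \<ominus> c) \<otimes> x = (a \<ominus> c) \<otimes> inv (a \<ominus> c) \<otimes> (d \<ominus> b)"
    unfolding x_def using ac(1) i(1) assms by (simp add: m_assoc)
  then have eq: "(a \<ominus> c) \<otimes> x = d \<ominus> b" using i assms by simp
  have "a \<otimes> x \<oplus> b = (a \<ominus> c) \<otimes> x \<oplus> c \<otimes> x \<oplus> b" using assms x by algebra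
  also have "\<dots> = c \<otimes> x \<oplus> d" unfolding eq using assms x by algebra
  finally show thesis using that x by blast
qed

text \<open>Commuting elements with slope different from \<open>1\<close> have the same fixed point.\<close>

lemma quotients_not_commute:
  assumes f: "f0 \<in> affines" "f1 \<in> affines" "f2 \<in> affines"
    and slopes: "slope f1 \<noteq> slope f0"
    and noncon: "\<And>x. x \<in> carrier R \<Longrightarrow> \<not> (app f0 x = app f1 x \<and> app f1 x = app f2 x)"
  shows "(f1 - f0) + (f2 - f0) \<noteq> (f2 - f0) + (f1 - f0)"
proof
  assume comm: "(f1 - f0) + (f2 - f0) = (f2 - f0) + (f1 - f0)"
  define g1 where "g1 = f1 - f0"
  define g2 where "g2 = f2 - f0"
  have "g1 \<in> affines" "g2 \<in> affines" using f affines_diff by (auto simp: g1_def g2_def)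
  from this(1) obtain a b where g1: "a \<in> carrier R" "a \<noteq> \<zero>" "b \<in> carrier R" "g1 = affine a b" "slope g1 = a"
    by (rule affinesE)
  have f1: "f1 = g1 + f0" and f2: "f2 = g2 + f0" by (simp_all add: g1_def g2_def)
  have "a \<noteq> \<one>"
  proof
    assume "a = \<one>"
    then have "slope f1 = slope f0"
      unfolding f1 using affines_add[OF \<open>g1 \<in> affines\<close> f(1)] g1 slope_carrier[OF f(1)] by simp
    with slopes show False by simp
  qed
  then obtain q where q: "q \<in> carrier R" "a \<otimes> q \<oplus> b = \<one> \<otimes> q \<oplus> \<zero>"
    using affine_agree_exists[of a b \<one> \<zero>] g1 by auto
  then have g1q: "app g1 q = q" using g1 by (simp add: app_affine aff_fun_def)
  have "app g1 (app g2 q) = app g2 (app g1 q)" using comm by (metis app_add g1_def g2_def)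
  then have *: "app g1 (app g2 q) = app g2 q" by (simp add: g1q)
  have g2c: "app g2 q \<in> carrier R" using \<open>g2 \<in> affines\<close> q by (intro app_affines_carrier)
  have "app g2 q = q"
  proof (rule affine_agree_unique[of a b \<one> \<zero>])
    show "a \<otimes> app g2 q \<oplus> b = \<one> \<otimes> app g2 q \<oplus> \<zero>"
      using * g1 g2c by (simp add: app_affine aff_fun_def)
  qed (use q g2c g1 \<open>a \<noteq> \<one>\<close> in auto)
  \<comment> \<open>\<open>q\<close> is fixed by both quotients. Pulled back by \<open>f0\<close> it
    becomes a point at which all three maps take the value \<open>q\<close>.\<close>
  moreover define x where "x = app (- f0) q"
  moreover have "x \<in> carrier R"
    unfolding x_def using affines_uminus(1)[OF f(1)] q by (intro app_affines_carrier)
  ultimately have "app f0 x = app f1 x \<and> app f1 x = app f2 x"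
    by (simp add: f1 f2 g1q)
  with noncon \<open>x \<in> carrier R\<close> show False by blast
qed

section \<open>The pivot argument\<close>

lemma all_multiples_or_last_multiple:
  assumes "P (\<zero>)"
  shows "(\<forall>m::nat. P ([m] \<cdot> x)) \<or> (\<exists>m::nat. P ([m] \<cdot> x) \<and> \<not> P ([Suc m] \<cdot> x))"
proof (rule disjCI)
  assume "\<not> (\<exists>m::nat. P ([m] \<cdot> x) \<and> \<not> P ([Suc m] \<cdot> x))"
  then have step: "P ([m] \<cdot> x) \<Longrightarrow> P ([Suc m] \<cdot> x)" for m :: nat by blast
  show "\<forall>m::nat. P ([m] \<cdot> x)"
  proof
    fix m :: nat
    show "P ([m] \<cdot> x)" by (induction m) (use assms in \<open>simp, blast intro: step\<close>)
  qed
qed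

text \<open>
  The pivot argument: the multiples \<open>u\<close> of \<open>x0\<close> for which \<open>(a, x) \<mapsto> x + u a\<close> is not injective
  are quotients \<open>(x2 - x1) / (a1 - a2)\<close>. If all multiples are such, some \<open>u\<close> has few collisions
  on average; otherwise step from the last non-injective \<open>u\<close> to \<open>u + x0\<close>. In both cases clear
  the denominator \<open>a1 - a2\<close>.
\<close>

lemma pivot:
  assumes V: "finite V" "V \<subseteq> carrier R" "V \<noteq> {}" and A: "finite A" "A \<subseteq> carrier R" "2 \<le> card A"
    and x0: "x0 \<in> carrier R"
    and generic: "infinite (range (\<lambda>m::nat. [m] \<cdot> x0)) \<or>
      finite (carrier R) \<and> range (\<lambda>m::nat. [m] \<cdot> x0) = carrier R"
    and Z: "finite Z"
      "\<And>a1 a2 a x1 x2 x. \<lbrakk>a1 \<in> A; a2 \<in> A; a \<in> A; x1 \<in> V; x2 \<in> V; x \<in> V\<rbrakk> \<Longrightarrow>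
        (a1 \<ominus> a2) \<otimes> x \<oplus> a \<otimes> (x2 \<ominus> x1) \<in> Z"
      "\<And>a1 a2 a x1 x2 x. \<lbrakk>a1 \<in> A; a2 \<in> A; a \<in> A; x1 \<in> V; x2 \<in> V; x \<in> V\<rbrakk> \<Longrightarrow>
        (a1 \<ominus> a2) \<otimes> x \<oplus> a \<otimes> (x2 \<ominus> x1) \<oplus> a \<otimes> ((a1 \<ominus> a2) \<otimes> x0) \<in> Z"
  shows "card A * card V \<le> card Z \<or>
    finite (carrier R) \<and> card A * card V * card (carrier R) \<le> card Z * (card (carrier R) + card A * card V)"
proof -
  define \<phi> where "\<phi> u p = snd p \<oplus> u \<otimes> fst p" for u and p :: "'a \<times> 'a"
  have finAV: "finite (A \<times> V)" using A V by simp
  have A_carr: "a \<in> carrier R" if "a \<in> A" for a using that A by blast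
  have V_carr: "x \<in> carrier R" if "x \<in> V" for x using that V by blast
  have coll: "\<exists>a1\<in>A. \<exists>a2\<in>A. \<exists>x1\<in>V. \<exists>x2\<in>V. a1 \<noteq> a2 \<and> u \<otimes> (a1 \<ominus> a2) = x2 \<ominus> x1"
    if u: "u \<in> carrier R" and ninj: "\<not> inj_on (\<phi> u) (A \<times> V)" for u
  proof -
    from ninj obtain a1 x1 a2 x2 where p: "a1 \<in> A" "a2 \<in> A" "x1 \<in> V" "x2 \<in> V"
      "x1 \<oplus> u \<otimes> a1 = x2 \<oplus> u \<otimes> a2" "(a1, x1) \<noteq> (a2, x2)"
      by (auto simp: inj_on_def \<phi>_def)
    have c: "a1 \<in> carrier R" "a2 \<in> carrier R" "x1 \<in> carrier R" "x2 \<in> carrier R"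
      using p A_carr V_carr by auto
    have "a1 \<noteq> a2"
    proof
      assume "a1 = a2"
      then have "x1 = x2" using p(5) c u by simp
      with \<open>a1 = a2\<close> p(6) show False by simp
    qed
    moreover have "u \<otimes> (a1 \<ominus> a2) = (x1 \<oplus> u \<otimes> a1) \<ominus> u \<otimes> a2 \<ominus> x1" using c u by algebra
    then have "u \<otimes> (a1 \<ominus> a2) = x2 \<ominus> x1" unfolding p(5) using c u by algebra
    ultimately show ?thesis using p by blast
  qed
  have mult_carr: "[m] \<cdot> x0 \<in> carrier R" for m :: nat using x0 by simp
  have "\<not> card A \<le> Suc 0" using A(3) by simp
  then obtain a a' where aa': "a \<in> A" "a' \<in> A" "a \<noteq> a'"
    unfolding card_le_Suc0_iff_eq[OF A(1)] by blast
  obtain v where v: "v \<in> V" using V by auto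
  \<comment> \<open>The chain of multiples starts with a non-injective one:
    \<open>\<phi> \<zero>\<close> forgets the first component, and \<open>A\<close> has two
    elements.\<close>
  have "\<not> inj_on (\<phi> \<zero>) (A \<times> V)"
  proof
    assume "inj_on (\<phi> \<zero>) (A \<times> V)"
    from inj_onD[OF this, of "(a, v)" "(a', v)"] aa' v A_carr V_carr show False by (simp add: \<phi>_def)
  qed
  from all_multiples_or_last_multiple[of "\<lambda>u. \<not> inj_on (\<phi> u) (A \<times> V)", OF this, of x0]
  show ?thesis
  proof
    assume "\<exists>m::nat. \<not> inj_on (\<phi> ([m] \<cdot> x0)) (A \<times> V) \<and> \<not> \<not> inj_on (\<phi> ([Suc m] \<cdot> x0)) (A \<times> V)"
    then obtain m :: nat where m: "\<not> inj_on (\<phi> ([m] \<cdot> x0)) (A \<times> V)" "inj_on (\<phi> ([Suc m] \<cdot> x0)) (A \<times> V)"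
      by blast
    define u where "u = [m] \<cdot> x0"
    have u: "u \<in> carrier R" by (simp add: u_def x0)
    have u': "[Suc m] \<cdot> x0 = u \<oplus> x0" using x0 by (simp add: u_def)
    obtain a1 a2 x1 x2 where p: "a1 \<in> A" "a2 \<in> A" "x1 \<in> V" "x2 \<in> V" "a1 \<noteq> a2"
      "u \<otimes> (a1 \<ominus> a2) = x2 \<ominus> x1"
      using coll[OF u] m(1) by (auto simp: u_def)
    have c: "a1 \<in> carrier R" "a2 \<in> carrier R" "x1 \<in> carrier R" "x2 \<in> carrier R"
      using p A_carr V_carr by auto
    have d: "a1 \<ominus> a2 \<in> carrier R" "a1 \<ominus> a2 \<noteq> \<zero>" using c p(5) by (auto simp: r_right_minus_eq)
    \<comment> \<open>Multiplying \<open>\<phi> (u \<oplus> x0)\<close> by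
      \<open>a1 \<ominus> a2\<close> replaces \<open>u \<otimes> (a1 \<ominus> a2)\<close> by
      \<open>x2 \<ominus> x1\<close>. The values no longer mention \<open>u\<close> and so lie in
      \<open>Z\<close>.\<close>
    define \<psi> where "\<psi> p = (a1 \<ominus> a2) \<otimes> snd p \<oplus> fst p \<otimes> (x2 \<ominus> x1) \<oplus> fst p \<otimes> ((a1 \<ominus> a2) \<otimes> x0)"
      for p :: "'a \<times> 'a"
    have \<psi>: "\<psi> p = (a1 \<ominus> a2) \<otimes> \<phi> (u \<oplus> x0) p" if "p \<in> A \<times> V" for p
    proof -
      obtain b x where bx: "p = (b, x)" "b \<in> carrier R" "x \<in> carrier R" using \<open>p \<in> A \<times> V\<close> A_carr V_carr by auto
      have "\<psi> p = (a1 \<ominus> a2) \<otimes> x \<oplus> b \<otimes> (u \<otimes> (a1 \<ominus> a2)) \<oplus> b \<otimes> ((a1 \<ominus> a2) \<otimes> x0)"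
        by (simp add: \<psi>_def bx p(6))
      also have "\<dots> = (a1 \<ominus> a2) \<otimes> (x \<oplus> (u \<oplus> x0) \<otimes> b)"
        using bx d(1) u x0 by algebra
      finally show ?thesis by (simp add: \<phi>_def bx)
    qed
    have "inj_on \<psi> (A \<times> V)"
    proof (rule inj_onI)
      fix p q assume pq: "p \<in> A \<times> V" "q \<in> A \<times> V" "\<psi> p = \<psi> q"
      have \<phi>c: "\<phi> (u \<oplus> x0) p \<in> carrier R" if "p \<in> A \<times> V" for p
        using that u x0 A_carr V_carr by (auto simp: \<phi>_def)
      from pq have "(a1 \<ominus> a2) \<otimes> \<phi> (u \<oplus> x0) p = (a1 \<ominus> a2) \<otimes> \<phi> (u \<oplus> x0) q" by (simp add: \<psi>)
      then have "\<phi> (u \<oplus> x0) p = \<phi> (u \<oplus> x0) q" using d \<phi>c pq(1,2) m_lcancel by auto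
      with m(2) pq(1,2) show "p = q" unfolding u' by (auto dest: inj_onD)
    qed
    moreover have "\<psi> ` (A \<times> V) \<subseteq> Z" using Z(3) p by (auto simp: \<psi>_def)
    ultimately have "card (A \<times> V) \<le> card Z" using Z(1) by (rule card_inj_on_le)
    then show ?thesis by (simp add: card_cartesian_product)
  next
    assume "\<forall>m::nat. \<not> inj_on (\<phi> ([m] \<cdot> x0)) (A \<times> V)"
    then have all: "\<exists>a1\<in>A. \<exists>a2\<in>A. \<exists>x1\<in>V. \<exists>x2\<in>V. a1 \<noteq> a2 \<and> u \<otimes> (a1 \<ominus> a2) = x2 \<ominus> x1"
      if "u \<in> range (\<lambda>m::nat. [m] \<cdot> x0)" for u
      using that coll mult_carr by blast
    have "range (\<lambda>m::nat. [m] \<cdot> x0) \<subseteq>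
        (\<lambda>((a1, a2), (x1, x2)). (x2 \<ominus> x1) \<otimes> inv (a1 \<ominus> a2)) ` ((A \<times> A) \<times> (V \<times> V))"
    proof
      fix u assume u: "u \<in> range (\<lambda>m::nat. [m] \<cdot> x0)"
      then have uc: "u \<in> carrier R" using mult_carr by auto
      from all[OF u] obtain a1 a2 x1 x2 where p: "a1 \<in> A" "a2 \<in> A" "x1 \<in> V" "x2 \<in> V" "a1 \<noteq> a2"
        "u \<otimes> (a1 \<ominus> a2) = x2 \<ominus> x1" by blast
      have c: "a1 \<in> carrier R" "a2 \<in> carrier R" "x1 \<in> carrier R" "x2 \<in> carrier R"
        using p A_carr V_carr by auto
      have "u = (x2 \<ominus> x1) \<otimes> inv (a1 \<ominus> a2)"
        using c p uc by (intro linear_eq_unique) (auto simp: r_right_minus_eq)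
      with p show "u \<in> (\<lambda>((a1, a2), (x1, x2)). (x2 \<ominus> x1) \<otimes> inv (a1 \<ominus> a2)) ` ((A \<times> A) \<times> (V \<times> V))"
        by (intro image_eqI[of _ _ "((a1, a2), (x1, x2))"]) auto
    qed
    \<comment> \<open>Every multiple is one of finitely many quotients, which the infinite
      alternative of \<open>generic\<close> rules out. All field elements are therefore multiples of
      \<open>x0\<close>.\<close>
    then have "finite (range (\<lambda>m::nat. [m] \<cdot> x0))" by (rule finite_subset) (use A V in simp)
    with generic have fin: "finite (carrier R)" and range: "range (\<lambda>m::nat. [m] \<cdot> x0) = carrier R" by auto
    define q where "q = card (carrier R)"
    have q0: "0 < q" using fin by (auto simp: q_def card_gt_0_iff)
    define E where "E u = card {(p, p'). p \<in> A \<times> V \<and> p' \<in> A \<times> V \<and> \<phi> u p = \<phi> u p'}" for u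
    \<comment> \<open>A pair with \<open>p = p'\<close> collides for every \<open>u\<close>, a pair
      of distinct elements for at most one \<open>u\<close>. Some \<open>u\<close> does no worse
      than the average, and Cauchy-Schwarz turns few collisions into a large image.\<close>
    have sumE: "(\<Sum>u\<in>carrier R. E u) \<le> card A * card V * (q + card A * card V)"
    proof -
      have "(\<Sum>u\<in>carrier R. E u) = (\<Sum>u\<in>carrier R. \<Sum>p\<in>A \<times> V. \<Sum>p'\<in>A \<times> V. of_bool (\<phi> u p = \<phi> u p'))"
      proof (rule sum.cong[OF refl])
        fix u
        have "{(p, p'). p \<in> A \<times> V \<and> p' \<in> A \<times> V \<and> \<phi> u p = \<phi> u p'}
            = {r \<in> (A \<times> V) \<times> (A \<times> V). \<phi> u (fst r) = \<phi> u (snd r)}" by auto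
        then have "E u = (\<Sum>r\<in>(A \<times> V) \<times> (A \<times> V). of_bool (\<phi> u (fst r) = \<phi> u (snd r)))"
          unfolding E_def using finAV by (simp add: of_bool_def sum.inter_filter[symmetric])
        then show "E u = (\<Sum>p\<in>A \<times> V. \<Sum>p'\<in>A \<times> V. of_bool (\<phi> u p = \<phi> u p'))"
          by (simp add: sum.cartesian_product case_prod_beta')
      qed
      also have "\<dots> = (\<Sum>p\<in>A \<times> V. \<Sum>p'\<in>A \<times> V. \<Sum>u\<in>carrier R. of_bool (\<phi> u p = \<phi> u p'))"
        by (subst sum.swap) (intro sum.cong refl sum.swap)
      also have "\<dots> \<le> (\<Sum>p\<in>A \<times> V. \<Sum>p'\<in>A \<times> V. (if p = p' then q else 0) + 1)"
      proof (intro sum_mono)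
        fix p p' assume pp: "p \<in> A \<times> V" "p' \<in> A \<times> V"
        show "(\<Sum>u\<in>carrier R. of_bool (\<phi> u p = \<phi> u p')) \<le> (if p = p' then q else 0) + 1"
        proof (cases "p = p'")
          case False
          obtain a1 x1 a2 x2 where p: "p = (a1, x1)" "p' = (a2, x2)" by (cases p, cases p')
          have c: "a1 \<in> carrier R" "a2 \<in> carrier R" "x1 \<in> carrier R" "x2 \<in> carrier R"
            using pp p A_carr V_carr by auto
          have "u = u'" if u: "u \<in> carrier R" "\<phi> u p = \<phi> u p'" and u': "u' \<in> carrier R" "\<phi> u' p = \<phi> u' p'"
            for u u'
          proof (rule affine_agree_unique[of a1 x1 a2 x2])
            show "a1 \<otimes> u \<oplus> x1 = a2 \<otimes> u \<oplus> x2" using u c by (simp add: \<phi>_def p a_comm m_comm)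
            show "a1 \<otimes> u' \<oplus> x1 = a2 \<otimes> u' \<oplus> x2" using u' c by (simp add: \<phi>_def p a_comm m_comm)
            show "a1 \<noteq> a2"
            proof
              assume "a1 = a2"
              with u c have "x1 = x2" by (simp add: \<phi>_def p)
              with \<open>a1 = a2\<close> False p show False by simp
            qed
          qed (use u u' c in auto)
          then have "card {u \<in> carrier R. \<phi> u p = \<phi> u p'} \<le> Suc 0"
            by (subst card_le_Suc0_iff_eq) (use fin in auto)
          with False fin show ?thesis by (simp add: of_bool_def sum.inter_filter[symmetric])
        qed (simp add: q_def)
      qed
      also have "\<dots> = (\<Sum>p\<in>A \<times> V. q + card (A \<times> V))"
        by (intro sum.cong refl, subst sum.distrib) (use finAV in \<open>simp add: sum.delta\<close>)
      also have "\<dots> = card (A \<times> V) * q + card (A \<times> V) * card (A \<times> V)"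
        by (simp add: algebra_simps)
      finally show ?thesis by (simp add: card_cartesian_product algebra_simps)
    qed
    have "\<exists>u\<in>carrier R. q * E u \<le> card A * card V * (q + card A * card V)"
    proof (rule ccontr)
      assume "\<not> ?thesis"
      then have "card A * card V * (q + card A * card V) < q * E u" if "u \<in> carrier R" for u
        using that by (simp add: not_le)
      then have "(\<Sum>u\<in>carrier R. card A * card V * (q + card A * card V)) < (\<Sum>u\<in>carrier R. q * E u)"
        using fin q0 by (intro sum_strict_mono) (auto simp: q_def)
      also have "\<dots> \<le> q * (card A * card V * (q + card A * card V))"
        unfolding sum_distrib_left[symmetric] using sumE by (intro mult_left_mono) auto
      finally show False by (simp add: q_def)
    qed
    then obtain u where u: "u \<in> carrier R" and Eu: "q * E u \<le> card A * card V * (q + card A * card V)" by blast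
    obtain a1 a2 x1 x2 where p: "a1 \<in> A" "a2 \<in> A" "x1 \<in> V" "x2 \<in> V" "a1 \<noteq> a2"
      "u \<otimes> (a1 \<ominus> a2) = x2 \<ominus> x1"
      using all[of u] u range by blast
    have c: "a1 \<in> carrier R" "a2 \<in> carrier R" "x1 \<in> carrier R" "x2 \<in> carrier R"
      using p A_carr V_carr by auto
    have d: "a1 \<ominus> a2 \<in> carrier R" "a1 \<ominus> a2 \<noteq> \<zero>" using c p(5) by (auto simp: r_right_minus_eq)
    have \<phi>c: "\<phi> u p \<in> carrier R" if "p \<in> A \<times> V" for p
      using that u A_carr V_carr by (auto simp: \<phi>_def)
    have "card (\<phi> u ` (A \<times> V)) \<le> card Z"
    proof (rule card_inj_on_le[where f = "\<lambda>y. (a1 \<ominus> a2) \<otimes> y", OF _ _ Z(1)])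
      show "inj_on (\<lambda>y. (a1 \<ominus> a2) \<otimes> y) (\<phi> u ` (A \<times> V))"
        using \<phi>c d by (auto intro!: inj_onI simp: m_lcancel)
      show "(\<lambda>y. (a1 \<ominus> a2) \<otimes> y) ` \<phi> u ` (A \<times> V) \<subseteq> Z"
      proof clarify
        fix b x assume bx: "b \<in> A" "x \<in> V"
        have bxc: "b \<in> carrier R" "x \<in> carrier R" using bx A_carr V_carr by auto
        have "(a1 \<ominus> a2) \<otimes> \<phi> u (b, x) = (a1 \<ominus> a2) \<otimes> x \<oplus> b \<otimes> (u \<otimes> (a1 \<ominus> a2))"
          unfolding \<phi>_def fst_conv snd_conv using bxc d(1) u by algebra
        then show "(a1 \<ominus> a2) \<otimes> \<phi> u (b, x) \<in> Z" using Z(2) p bx by simp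
      qed
    qed
    moreover have "(card (A \<times> V))\<^sup>2 \<le> card (\<phi> u ` (A \<times> V)) * E u"
      unfolding E_def by (rule card_square_le_collisions[OF finAV])
    ultimately have "(card A * card V)\<^sup>2 \<le> card Z * E u"
      by (metis card_cartesian_product le_trans mult_le_mono1)
    then have "q * (card A * card V)\<^sup>2 \<le> card Z * (q * E u)" by simp
    also have "\<dots> \<le> card Z * (card A * card V * (q + card A * card V))" by (rule mult_le_mono2[OF Eu])
    finally have "card A * card V * (card A * card V * q) \<le> card A * card V * (card Z * (q + card A * card V))"
      by (simp add: power2_eq_square mult_ac)
    moreover have "0 < card A * card V" using A V by (simp add: card_gt_0_iff) (use aa' in blast)
    ultimately have "card A * card V * q \<le> card Z * (q + card A * card V)" by (rule mult_left_le_imp_le)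
    with fin show ?thesis by (simp add: q_def)
  qed
qed

section \<open>Growth of sets of affine maps\<close>

text \<open>The slope of \<open>transl x + f\<close> is that of \<open>f\<close>, which determines
  \<open>f\<close> within \<open>B\<close> and then \<open>x\<close>.\<close>

lemma card_mult_slopes_le:
  assumes S: "finite S" "S \<subseteq> affines" and T: "T \<subseteq> carrier R" "\<And>x. x \<in> T \<Longrightarrow> transl x \<in> nsums i S"
    and B: "B \<subseteq> nsums j S" "B \<subseteq> affines" "inj_on slope B"
  shows "card T * card B \<le> card (nsums (i + j) S)"
proof -
  have "card (T \<times> B) \<le> card (nsums (i + j) S)"
  proof (rule card_inj_on_le[where f = "\<lambda>(x, f). transl x + f"])
    show "finite (nsums (i + j) S)" by (rule finite_nsums[OF S(1)])
    show "(\<lambda>(x, f). transl x + f) ` (T \<times> B) \<subseteq> nsums (i + j) S"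
      using T B by (auto intro!: nsums_add)
    show "inj_on (\<lambda>(x, f). transl x + f) (T \<times> B)"
    proof (rule inj_onI, clarify)
      fix x f y g
      assume h: "x \<in> T" "f \<in> B" "y \<in> T" "g \<in> B" "transl x + f = transl y + g"
      have c: "x \<in> carrier R" "y \<in> carrier R" "f \<in> affines" "g \<in> affines" using h T B by auto
      have "slope (transl x + f) = slope f" "slope (transl y + g) = slope g"
        using affines_add(2) transl_props(1,2) c slope_carrier by simp_all
      then have "f = g" using h B(3) by (auto dest: inj_onD)
      with h(5) have "transl x = transl y" by simp
      then show "x = y \<and> f = g" using \<open>f = g\<close> inj_transl c by (auto dest: inj_onD)
    qed
  qed
  then show ?thesis by (simp add: card_cartesian_product)
qed

text \<open>Subtracting a representative of the same slope embeds each fibre of \<open>slope\<close>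
  on \<open>S\<close> into the translations of \<open>nsums 2 S\<close>.\<close>

lemma card_le_slopes_mult:
  assumes S: "finite S" "S \<subseteq> affines" "\<And>s. s \<in> S \<Longrightarrow> - s \<in> S" and T: "finite T"
    "\<And>x. x \<in> carrier R \<Longrightarrow> transl x \<in> nsums 2 S \<Longrightarrow> x \<in> T"
  shows "card S \<le> card (slope ` S) * card T"
proof -
  define r where "r c = (SOME f. f \<in> S \<and> slope f = c)" for c
  have r: "r (slope f) \<in> S \<and> slope (r (slope f)) = slope f" if "f \<in> S" for f
    unfolding r_def by (rule someI[of _ f]) (use that in simp)
  define \<tau> where "\<tau> f = (SOME x. x \<in> carrier R \<and> f - r (slope f) = transl x)" for f
  have \<tau>: "\<tau> f \<in> carrier R \<and> f - r (slope f) = transl (\<tau> f)" if "f \<in> S" for f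
  proof -
    have "f \<in> affines" "r (slope f) \<in> affines" "slope f = slope (r (slope f))"
      using r[OF that] S(2) that by auto
    then obtain x where "x \<in> carrier R" "f - r (slope f) = transl x" by (rule same_slope_transl)
    then have "\<exists>x. x \<in> carrier R \<and> f - r (slope f) = transl x" by blast
    then show ?thesis unfolding \<tau>_def by (rule someI_ex)
  qed
  have "card S \<le> card (slope ` S \<times> T)"
  proof (rule card_inj_on_le[where f = "\<lambda>f. (slope f, \<tau> f)"])
    show "inj_on (\<lambda>f. (slope f, \<tau> f)) S"
    proof (rule inj_onI)
      fix f g assume h: "f \<in> S" "g \<in> S" "(slope f, \<tau> f) = (slope g, \<tau> g)"
      then have "f - r (slope f) = g - r (slope f)" using \<tau>[of f] \<tau>[of g] by simp
      then show "f = g" by (metis diff_add_cancel)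
    qed
    show "(\<lambda>f. (slope f, \<tau> f)) ` S \<subseteq> slope ` S \<times> T"
    proof clarify
      fix f assume f: "f \<in> S"
      have "f + - r (slope f) \<in> nsums (1 + 1) S"
        using f r[OF f] S(3) by (intro nsums_add) (auto simp: nsums_1)
      then have "transl (\<tau> f) \<in> nsums 2 S" using \<tau>[OF f] by (simp add: numeral_2_eq_2)
      then show "slope f \<in> slope ` S \<and> \<tau> f \<in> T" using T(2) \<tau>[OF f] f by blast
    qed
    show "finite (slope ` S \<times> T)" using S(1) T(1) by simp
  qed
  then show ?thesis by (simp add: card_cartesian_product)
qed

text \<open>The size of \<open>S\<close> is at most the number of its slopes times the size of the
  set \<open>V\<close> of translations in \<open>nsums 8 S\<close>. The pivot argument finds in
  \<open>nsums 72 S\<close> a set \<open>Z\<close> of translations that is at least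
  \<open>card I / 2\<close> times as large as \<open>V\<close> or has at least half as many elements
  as the field. Composing \<open>Z\<close> with one map of \<open>S\<close> for each slope, or with
  the differences \<open>f - f0\<close> for \<open>f \<in> I\<close>, stays inside
  \<open>nsums 74 S\<close>.\<close>

lemma affine_structure_bound:
  assumes S: "finite S" "S \<subseteq> affines" "0 \<in> S" "\<And>s. s \<in> S \<Longrightarrow> - s \<in> S"
    and I: "finite I" "I \<subseteq> affines" "3 \<le> card I" "inj_on slope I"
      "\<And>f g. f \<in> I \<Longrightarrow> g \<in> I \<Longrightarrow> f - g \<in> nsums 2 S"
    and noncon: "\<And>f g h x. \<lbrakk>f \<in> I; g \<in> I; h \<in> I; f \<noteq> g; f \<noteq> h; g \<noteq> h; x \<in> carrier R\<rbrakk>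
        \<Longrightarrow> \<not> (app f x = app g x \<and> app g x = app h x)"
    and generic: "\<And>x. x \<in> carrier R \<Longrightarrow> x \<noteq> \<zero> \<Longrightarrow> infinite (range (\<lambda>m::nat. [m] \<cdot> x)) \<or>
      finite (carrier R) \<and> range (\<lambda>m::nat. [m] \<cdot> x) = carrier R"
  shows "card I * card S \<le> 2 * card (nsums 74 S) \<or>
    finite (carrier R) \<and> card I * card (carrier R) \<le> 2 * card (nsums 74 S)"
proof -
  define T where "T j = {x \<in> carrier R. transl x \<in> nsums j S}" for j
  have T_carr: "T j \<subseteq> carrier R" for j by (auto simp: T_def)
  have finT: "finite (T j)" for j
  proof (rule inj_on_finite[of transl])
    show "inj_on transl (T j)" by (rule inj_on_subset[OF inj_transl T_carr])
    show "transl ` T j \<subseteq> nsums j S" by (auto simp: T_def)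
    show "finite (nsums j S)" by (rule finite_nsums[OF S(1)])
  qed
  have T_mono: "T i \<subseteq> T j" if "i \<le> j" for i j
    using nsums_mono[OF S(3) that] by (auto simp: T_def)
  have T_add: "x \<oplus> y \<in> T (i + j)" if "x \<in> T i" "y \<in> T j" for x y i j
  proof -
    have "transl x + transl y \<in> nsums (i + j) S"
      using that by (intro nsums_add) (auto simp: T_def)
    then show ?thesis using that by (auto simp: T_def transl_add)
  qed
  have T_neg: "\<ominus> x \<in> T i" if "x \<in> T i" for x i
    using nsums_uminus[OF S(4), of "transl x" i] that by (auto simp: T_def transl_uminus)
  \<comment> \<open>Conjugation puts two summands on each side of the translation, hence the
    \<open>4\<close>.\<close>
  have T_conj: "slope g \<otimes> x \<in> T (j + 4)" if "g \<in> nsums 2 S" "g \<in> affines" "x \<in> T j" for g x j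
  proof -
    have xc: "x \<in> carrier R" "transl x \<in> nsums j S" using that(3) by (auto simp: T_def)
    have "g + transl x + - g \<in> nsums (2 + j + 2) S"
      using that xc nsums_uminus[OF S(4)] by (intro nsums_add) auto
    moreover have "g + transl x + - g = transl (slope g \<otimes> x)"
      using transl_conj[OF that(2) xc(1)] by simp
    moreover have "2 + j + 2 = j + 4" by simp
    ultimately have "transl (slope g \<otimes> x) \<in> nsums (j + 4) S" by (simp only:)
    then show ?thesis using xc slope_carrier[OF that(2)] by (simp add: T_def)
  qed
  obtain I3 where "I3 \<subseteq> I" "card I3 = 3" using I(3) by (meson obtain_subset_with_card_n)
  then obtain f0 f1 f2 where f: "f0 \<in> I" "f1 \<in> I" "f2 \<in> I" "f0 \<noteq> f1" "f0 \<noteq> f2" "f1 \<noteq> f2"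
    unfolding card_3_iff by blast
  have fa: "f0 \<in> affines" "f1 \<in> affines" "f2 \<in> affines" using f I(2) by auto
  define A where "A = (\<lambda>f. slope (f - f0)) ` I"
  have inv0: "inv (slope f0) \<in> carrier R" "inv (slope f0) \<noteq> \<zero>"
    using inverse_props slope_carrier[OF fa(1)] by auto
  have injA: "inj_on (\<lambda>f. slope (f - f0)) I"
  proof (rule inj_onI)
    fix f g assume h: "f \<in> I" "g \<in> I" "slope (f - f0) = slope (g - f0)"
    have "f \<in> affines" "g \<in> affines" using h I(2) by auto
    with h(3) have "slope f \<otimes> inv (slope f0) = slope g \<otimes> inv (slope f0)"
      by (simp add: affines_diff(2) fa(1))
    then have "slope f = slope g"
      using m_rcancel[OF inv0(2,1)] slope_carrier(1) \<open>f \<in> affines\<close> \<open>g \<in> affines\<close> by simp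
    then show "f = g" using h I(4) by (auto dest: inj_onD)
  qed
  have cardA: "card A = card I" unfolding A_def by (rule card_image[OF injA])
  have A_carr: "A \<subseteq> carrier R" unfolding A_def using affines_diff(1) fa(1) I(2) slope_carrier by blast
  have A_T: "a \<otimes> x \<in> T (j + 4)" if "a \<in> A" "x \<in> T j" for a x j
  proof -
    obtain f where f: "f \<in> I" "a = slope (f - f0)" using \<open>a \<in> A\<close> by (auto simp: A_def)
    then show ?thesis using T_conj[of "f - f0"] that(2) I(2,5) \<open>f0 \<in> I\<close> fa(1) affines_diff(1) by blast
  qed
  define g1 where "g1 = f1 - f0"
  define g2 where "g2 = f2 - f0"
  have g: "g1 \<in> affines" "g2 \<in> affines" "g1 \<in> nsums 2 S" "g2 \<in> nsums 2 S"
    using f fa affines_diff(1) I(5) by (auto simp: g1_def g2_def)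
  have "slope f1 \<noteq> slope f0" using f I(4) by (auto dest: inj_onD)
  then have "g1 + g2 \<noteq> g2 + g1"
    unfolding g1_def g2_def using f noncon by (intro quotients_not_commute fa) auto
  have g12: "g1 + g2 \<in> affines" "g2 + g1 \<in> affines" using g affines_add(1) by auto
  have "slope (g1 + g2) = slope (g2 + g1)" using g affines_add(2) slope_carrier m_comm by simp
  \<comment> \<open>The commutator of \<open>g1\<close> and \<open>g2\<close>: both orders have the
    same slope, so it is a translation, and it is nontrivial because the two do not commute. Four
    occurrences of elements of \<open>nsums 2 S\<close> account for the length
    \<open>8\<close>.\<close>
  then obtain x0 where x0: "x0 \<in> carrier R" "(g1 + g2) - (g2 + g1) = transl x0"
    by (rule same_slope_transl[OF g12])
  have "x0 \<noteq> \<zero>" using x0 \<open>g1 + g2 \<noteq> g2 + g1\<close> by (auto simp: transl_0)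
  have "(g1 + g2) + - (g2 + g1) \<in> nsums ((2 + 2) + (2 + 2)) S"
    using g by (intro nsums_add nsums_uminus[OF S(4)])
  moreover have "(g1 + g2) + - (g2 + g1) = transl x0" using x0(2) by (simp only: diff_conv_add_uminus)
  moreover have "(2 + 2) + (2 + 2) = (8::nat)" by simp
  ultimately have "transl x0 \<in> nsums 8 S" by (simp only:)
  then have x0T: "x0 \<in> T 8" using x0(1) by (simp only: T_def mem_Collect_eq)
  \<comment> \<open>The index \<open>8\<close> is large enough for \<open>x0\<close> and for the
    translations of \<open>nsums 2 S\<close>.\<close>
  define V where "V = T 8"
  have combo: "(a1 \<ominus> a2) \<otimes> x \<in> T (2 * (j + 4))" if "a1 \<in> A" "a2 \<in> A" "x \<in> T j" for a1 a2 x j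
  proof -
    have c: "a1 \<in> carrier R" "a2 \<in> carrier R" "x \<in> carrier R" using that A_carr T_carr by auto
    have "a1 \<otimes> x \<oplus> (\<ominus> (a2 \<otimes> x)) \<in> T ((j + 4) + (j + 4))"
      using that by (intro T_add T_neg A_T)
    moreover have "a1 \<otimes> x \<oplus> (\<ominus> (a2 \<otimes> x)) = (a1 \<ominus> a2) \<otimes> x"
      using c by (simp add: a_minus_def l_distr l_minus)
    ultimately show ?thesis by (simp only: mult_2)
  qed
  \<comment> \<open>Counting lengths: \<open>x2 \<ominus> x1\<close> takes \<open>16\<close>, a
    factor from \<open>A\<close> adds \<open>4\<close>, and
    \<open>(a1 \<ominus> a2) \<otimes> x\<close> takes \<open>2 * (8 + 4)\<close>, in all
    \<open>44\<close>. The additional term of the next fact takes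
    \<open>2 * (8 + 4) + 4 = 28\<close>, which leads to \<open>72\<close>.\<close>
  have Z2: "(a1 \<ominus> a2) \<otimes> x \<oplus> a \<otimes> (x2 \<ominus> x1) \<in> T 44"
    if "a1 \<in> A" "a2 \<in> A" "a \<in> A" "x1 \<in> V" "x2 \<in> V" "x \<in> V" for a1 a2 a x1 x2 x
  proof -
    have "x2 \<ominus> x1 \<in> T (8 + 8)" unfolding a_minus_def using that by (intro T_add T_neg) (auto simp: V_def)
    then have "a \<otimes> (x2 \<ominus> x1) \<in> T (16 + 4)" using that by (intro A_T) auto
    moreover have "(a1 \<ominus> a2) \<otimes> x \<in> T (2 * (8 + 4))" using that by (intro combo) (auto simp: V_def)
    ultimately have "(a1 \<ominus> a2) \<otimes> x \<oplus> a \<otimes> (x2 \<ominus> x1) \<in> T (2 * (8 + 4) + (16 + 4))" by (intro T_add)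
    then show ?thesis by simp
  qed
  have Z3: "(a1 \<ominus> a2) \<otimes> x \<oplus> a \<otimes> (x2 \<ominus> x1) \<oplus> a \<otimes> ((a1 \<ominus> a2) \<otimes> x0) \<in> T 72"
    if "a1 \<in> A" "a2 \<in> A" "a \<in> A" "x1 \<in> V" "x2 \<in> V" "x \<in> V" for a1 a2 a x1 x2 x
  proof -
    have "a \<otimes> ((a1 \<ominus> a2) \<otimes> x0) \<in> T (2 * (8 + 4) + 4)" using that x0T by (intro A_T combo)
    with Z2[OF that] have "(a1 \<ominus> a2) \<otimes> x \<oplus> a \<otimes> (x2 \<ominus> x1) \<oplus> a \<otimes> ((a1 \<ominus> a2) \<otimes> x0) \<in> T (44 + (2 * (8 + 4) + 4))"
      by (intro T_add)
    then show ?thesis by simp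
  qed
  define Z where "Z = T 72"
  have pv: "card A * card V \<le> card Z \<or>
    finite (carrier R) \<and> card A * card V * card (carrier R) \<le> card Z * (card (carrier R) + card A * card V)"
  proof (rule pivot[where ?x0.0 = x0])
    show "finite V" "V \<subseteq> carrier R" "V \<noteq> {}" using finT T_carr x0T by (auto simp: V_def)
    show "finite A" "A \<subseteq> carrier R" "2 \<le> card A" using I A_carr cardA by (auto simp: A_def)
    show "infinite (range (\<lambda>m::nat. [m] \<cdot> x0)) \<or>
      finite (carrier R) \<and> range (\<lambda>m::nat. [m] \<cdot> x0) = carrier R"
      by (rule generic[OF x0(1) \<open>x0 \<noteq> \<zero>\<close>])
    show "finite Z" using finT by (simp add: Z_def)
    show "(a1 \<ominus> a2) \<otimes> x \<oplus> a \<otimes> (x2 \<ominus> x1) \<in> Z"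
      if "a1 \<in> A" "a2 \<in> A" "a \<in> A" "x1 \<in> V" "x2 \<in> V" "x \<in> V" for a1 a2 a x1 x2 x
      using Z2[OF that] T_mono[of 44 72] by (auto simp: Z_def)
    show "(a1 \<ominus> a2) \<otimes> x \<oplus> a \<otimes> (x2 \<ominus> x1) \<oplus> a \<otimes> ((a1 \<ominus> a2) \<otimes> x0) \<in> Z"
      if "a1 \<in> A" "a2 \<in> A" "a \<in> A" "x1 \<in> V" "x2 \<in> V" "x \<in> V" for a1 a2 a x1 x2 x
      using Z3[OF that] by (simp add: Z_def)
  qed (use x0 in simp)
  \<comment> \<open>In the second alternative the larger of \<open>card (carrier R)\<close> and
    \<open>card A * card V\<close> is at least half of their sum and can be cancelled; the smaller
    one is then at most \<open>2 * card Z\<close>.\<close>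
  have cases: "card A * card V \<le> 2 * card Z \<or> finite (carrier R) \<and> card (carrier R) \<le> 2 * card Z"
    using pv
  proof
    assume "finite (carrier R) \<and> card A * card V * card (carrier R) \<le> card Z * (card (carrier R) + card A * card V)"
    then have fin: "finite (carrier R)"
      and le: "card A * card V * card (carrier R) \<le> card Z * (card (carrier R) + card A * card V)" by auto
    have q0: "0 < card (carrier R)" using fin by (auto simp: card_gt_0_iff)
    show ?thesis
    proof (cases "card A * card V \<le> card (carrier R)")
      case True
      then have "card Z * (card (carrier R) + card A * card V) \<le> (2 * card Z) * card (carrier R)"
        by (simp add: algebra_simps)
      with le have "card A * card V * card (carrier R) \<le> (2 * card Z) * card (carrier R)" by linarith
      with q0 show ?thesis by simp
    next
      case False
      then have "card Z * (card (carrier R) + card A * card V) \<le> card Z * (2 * (card A * card V))"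
        by (intro mult_le_mono2) simp
      also have "\<dots> = card A * card V * (2 * card Z)" by (simp only: mult_ac)
      finally have "card A * card V * card (carrier R) \<le> card A * card V * (2 * card Z)"
        using le by (rule le_trans[rotated])
      then have "card (carrier R) \<le> 2 * card Z"
        by (rule mult_left_le_imp_le) (use False in linarith)
      with fin show ?thesis by simp
    qed
  qed simp
  have Zprop: "Z \<subseteq> carrier R" "\<And>x. x \<in> Z \<Longrightarrow> transl x \<in> nsums 72 S" by (auto simp: Z_def T_def)
  have ZA: "card Z * card A \<le> card (nsums 74 S)"
  proof -
    have "card Z * card ((\<lambda>f. f - f0) ` I) \<le> card (nsums (72 + 2) S)"
    proof (rule card_mult_slopes_le[OF S(1,2) Zprop])
      show "(\<lambda>f. f - f0) ` I \<subseteq> nsums 2 S" using I(5) f by auto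
      show "(\<lambda>f. f - f0) ` I \<subseteq> affines" using I(2) fa affines_diff(1) by auto
      show "inj_on slope ((\<lambda>f. f - f0) ` I)" using injA by (auto simp: inj_on_def)
    qed
    moreover have "card ((\<lambda>f. f - f0) ` I) = card I"
      by (rule card_image) (auto intro!: inj_onI)
    ultimately show ?thesis by (simp add: cardA)
  qed
  have ZS: "card Z * card (slope ` S) \<le> card (nsums 74 S)"
  proof -
    define r where "r c = (SOME f. f \<in> S \<and> slope f = c)" for c
    have r: "r c \<in> S \<and> slope (r c) = c" if "c \<in> slope ` S" for c
      unfolding r_def by (rule someI_ex) (use that in auto)
    have "card Z * card (r ` slope ` S) \<le> card (nsums (72 + 1) S)"
    proof (rule card_mult_slopes_le[OF S(1,2) Zprop])
      show "r ` slope ` S \<subseteq> nsums 1 S" using r by (auto simp: nsums_1)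
      show "r ` slope ` S \<subseteq> affines" using r S(2) by auto
      show "inj_on slope (r ` slope ` S)" using r by (auto simp: inj_on_def)
    qed
    moreover have "card (r ` slope ` S) = card (slope ` S)"
      by (rule card_image) (metis inj_onI r)
    moreover have "card (nsums 73 S) \<le> card (nsums 74 S)"
      by (intro card_mono finite_nsums nsums_mono S) simp
    ultimately show ?thesis by simp
  qed
  have SV: "card S \<le> card (slope ` S) * card V"
  proof (rule card_le_slopes_mult[OF S(1,2,4)])
    fix x assume "x \<in> carrier R" "transl x \<in> nsums 2 S"
    then show "x \<in> V" using T_mono[of 2 8] by (auto simp: V_def T_def)
  qed (use finT in \<open>auto simp: V_def\<close>)
  from cases show ?thesis
  proof
    assume *: "card A * card V \<le> 2 * card Z"
    have "card I * card S \<le> card A * (card (slope ` S) * card V)"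
      unfolding cardA by (rule mult_le_mono2[OF SV])
    also have "\<dots> = card A * card V * card (slope ` S)" by simp
    also have "\<dots> \<le> 2 * card Z * card (slope ` S)" by (rule mult_le_mono1[OF *])
    also have "\<dots> \<le> 2 * card (nsums 74 S)" using ZS by simp
    finally show ?thesis by simp
  next
    assume *: "finite (carrier R) \<and> card (carrier R) \<le> 2 * card Z"
    then have "card I * card (carrier R) \<le> card A * (2 * card Z)"
      unfolding cardA by (intro mult_le_mono2) auto
    also have "\<dots> \<le> 2 * card (nsums 74 S)" using ZA by (simp add: mult_ac)
    finally show ?thesis using * by simp
  qed
qed

section \<open>Counting rich affine maps\<close>

text \<open>A second moment argument over all lines \<open>y = a x + b\<close>. Each point of
  \<open>Y \<times> Y\<close> lies on \<open>q\<close> of these \<open>q^2\<close> lines, and two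
  distinct points share at most one, so the incidence counts have mean \<open>N^2 / q\<close> and
  total squared deviation at most \<open>N^2 * q\<close>. The assumed size of the field puts the
  mean below half of \<open>\<delta> * N\<close>, and Chebyshev's inequality bounds the number of
  rich lines.\<close>

lemma rich_affines_le:
  assumes fin: "finite (carrier R)" and Y: "Y \<subseteq> carrier R" "Y \<noteq> {}" and D: "finite D" "D \<subseteq> affines"
    and \<delta>: "0 < \<delta>" "2 * real (card Y) \<le> \<delta> * real (card (carrier R))"
    and rich: "\<And>f. f \<in> D \<Longrightarrow> \<delta> * real (card Y) \<le> real (rcount Y f)"
  shows "real (card D) * \<delta>\<^sup>2 \<le> 4 * real (card (carrier R))"
proof -
  define q where "q = real (card (carrier R))"
  define N where "N = real (card Y)"
  define C where "C = carrier R \<times> carrier R"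
  define c where "c p = (\<Sum>x\<in>Y. \<Sum>y\<in>Y. of_bool (fst p \<otimes> x \<oplus> snd p = y) :: real)" for p
  define \<mu> where "\<mu> = N\<^sup>2 / q"
  have finY: "finite Y" using Y fin finite_subset by blast
  have finC: "finite C" using fin by (simp add: C_def)
  have q0: "0 < q" using fin by (auto simp: q_def card_gt_0_iff)
  have N0: "0 < N" using finY Y by (simp add: N_def card_gt_0_iff)
  have cardC: "real (card C) = q\<^sup>2" by (simp add: C_def q_def card_cartesian_product power2_eq_square)
  have Yc: "x \<in> carrier R" if "x \<in> Y" for x using that Y by auto
  have line_count: "card {p \<in> C. fst p \<otimes> x \<oplus> snd p = y} = card (carrier R)" if "x \<in> Y" "y \<in> Y" for x y
  proof -
    have "bij_betw fst {p \<in> C. fst p \<otimes> x \<oplus> snd p = y} (carrier R)"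
    proof (rule bij_betwI[where g = "\<lambda>a. (a, y \<ominus> a \<otimes> x)"])
      show "(\<lambda>a. (a, y \<ominus> a \<otimes> x)) \<in> carrier R \<rightarrow> {p \<in> C. fst p \<otimes> x \<oplus> snd p = y}"
      proof
        fix a assume a: "a \<in> carrier R"
        have "a \<otimes> x \<oplus> (y \<ominus> a \<otimes> x) = y" using a Yc[OF that(1)] Yc[OF that(2)] by algebra
        then show "(a, y \<ominus> a \<otimes> x) \<in> {p \<in> C. fst p \<otimes> x \<oplus> snd p = y}"
          using a Yc[OF that(1)] Yc[OF that(2)] by (simp add: C_def)
      qed
      fix p assume "p \<in> {p \<in> C. fst p \<otimes> x \<oplus> snd p = y}"
      then obtain a b where p: "p = (a, b)" "a \<in> carrier R" "b \<in> carrier R" "a \<otimes> x \<oplus> b = y"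
        by (auto simp: C_def)
      have "(a \<otimes> x \<oplus> b) \<ominus> a \<otimes> x = b" using p(2,3) Yc[OF that(1)] by algebra
      then show "(fst p, y \<ominus> fst p \<otimes> x) = p" using p by simp
    qed (auto simp: C_def)
    then show ?thesis by (rule bij_betw_same_card)
  qed
  have sum_c: "(\<Sum>p\<in>C. c p) = N\<^sup>2 * q"
  proof -
    have "(\<Sum>p\<in>C. c p) = (\<Sum>x\<in>Y. \<Sum>p\<in>C. \<Sum>y\<in>Y. of_bool (fst p \<otimes> x \<oplus> snd p = y))"
      unfolding c_def by (rule sum.swap)
    also have "\<dots> = (\<Sum>x\<in>Y. \<Sum>y\<in>Y. \<Sum>p\<in>C. of_bool (fst p \<otimes> x \<oplus> snd p = y))"
      by (intro sum.cong refl sum.swap)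
    also have "\<dots> = (\<Sum>x\<in>Y. \<Sum>y\<in>Y. q)"
      using finC line_count by (intro sum.cong refl) (simp add: q_def of_bool_def sum.inter_filter[symmetric])
    finally show ?thesis by (simp add: N_def power2_eq_square)
  qed
  define pt where "pt = Y \<times> Y"
  define i where "i p r = (of_bool (fst p \<otimes> fst r \<oplus> snd p = snd r) :: real)" for p r :: "'a \<times> 'a"
  have c_pt: "c p = (\<Sum>r\<in>pt. i p r)" for p
    by (simp add: c_def pt_def i_def sum.cartesian_product case_prod_beta')
  have finpt: "finite pt" and cardpt: "real (card pt) = N\<^sup>2"
    using finY by (auto simp: pt_def N_def card_cartesian_product power2_eq_square)
  have sum_c2: "(\<Sum>p\<in>C. (c p)\<^sup>2) \<le> N\<^sup>2 * q + N ^ 4"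
  proof -
    have "(\<Sum>p\<in>C. (c p)\<^sup>2) = (\<Sum>p\<in>C. \<Sum>r\<in>pt. \<Sum>r'\<in>pt. i p r * i p r')"
      by (simp add: c_pt power2_eq_square sum_product)
    also have "\<dots> = (\<Sum>r\<in>pt. \<Sum>p\<in>C. \<Sum>r'\<in>pt. i p r * i p r')" by (rule sum.swap)
    also have "\<dots> = (\<Sum>r\<in>pt. \<Sum>r'\<in>pt. \<Sum>p\<in>C. i p r * i p r')"
      by (intro sum.cong refl sum.swap)
    also have "\<dots> \<le> (\<Sum>r\<in>pt. \<Sum>r'\<in>pt. (if r = r' then q else 0) + 1)"
    proof (intro sum_mono)
      fix r r' assume rr: "r \<in> pt" "r' \<in> pt"
      obtain x y x' y' where r: "r = (x, y)" "r' = (x', y')" by (cases r, cases r')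
      have Yr: "x \<in> Y" "y \<in> Y" "x' \<in> Y" "y' \<in> Y" using rr r by (auto simp: pt_def)
      note cr = Yr[THEN Yc]
      have eq: "(\<Sum>p\<in>C. i p r * i p r') = real (card {p \<in> C. fst p \<otimes> x \<oplus> snd p = y \<and> fst p \<otimes> x' \<oplus> snd p = y'})"
      proof -
        have "(\<Sum>p\<in>C. i p r * i p r') = (\<Sum>p\<in>C. if fst p \<otimes> x \<oplus> snd p = y \<and> fst p \<otimes> x' \<oplus> snd p = y' then 1 else 0)"
          by (intro sum.cong) (auto simp: i_def r)
        then show ?thesis using finC by (simp add: sum.inter_filter[symmetric])
      qed
      show "(\<Sum>p\<in>C. i p r * i p r') \<le> (if r = r' then q else 0) + 1"
      proof (cases "r = r'")
        case True
        then show ?thesis unfolding eq using line_count[OF Yr(1,2)] r by (simp add: q_def)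
      next
        case False
        have "p = p'" if p: "p \<in> C" "fst p \<otimes> x \<oplus> snd p = y" "fst p \<otimes> x' \<oplus> snd p = y'"
          and p': "p' \<in> C" "fst p' \<otimes> x \<oplus> snd p' = y" "fst p' \<otimes> x' \<oplus> snd p' = y'" for p p'
        proof -
          obtain a b a' b' where ab: "p = (a, b)" "p' = (a', b')" by (cases p, cases p')
          have cc: "a \<in> carrier R" "b \<in> carrier R" "a' \<in> carrier R" "b' \<in> carrier R"
            using p p' ab by (auto simp: C_def)
          have "x \<noteq> x'" using False r p ab by auto
          have "a = a'"
          proof (rule ccontr)
            assume "a \<noteq> a'"
            from affine_agree_unique[OF cc this cr(1,3)] p p' ab have "x = x'" by simp
            with \<open>x \<noteq> x'\<close> show False ..
          qed
          moreover from this have "b = b'"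
            using p(2) p'(2) ab cc cr add.l_cancel[of "a' \<otimes> x" b b'] by simp
          ultimately show "p = p'" using ab by simp
        qed
        then have "card {p \<in> C. fst p \<otimes> x \<oplus> snd p = y \<and> fst p \<otimes> x' \<oplus> snd p = y'} \<le> Suc 0"
          by (subst card_le_Suc0_iff_eq) (use finC in auto)
        with False show ?thesis unfolding eq by simp
      qed
    qed
    also have "\<dots> = (\<Sum>r\<in>pt. q + real (card pt))"
      by (intro sum.cong refl, subst sum.distrib) (use finpt in \<open>simp add: sum.delta\<close>)
    also have "\<dots> = N\<^sup>2 * q + N ^ 4"
      by (simp add: cardpt power_numeral_reduce algebra_simps)
    finally show ?thesis .
  qed
  have var: "(\<Sum>p\<in>C. (c p - \<mu>)\<^sup>2) \<le> N\<^sup>2 * q"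
  proof -
    have "(\<Sum>p\<in>C. (c p - \<mu>)\<^sup>2) = (\<Sum>p\<in>C. (c p)\<^sup>2 - 2 * \<mu> * c p + \<mu>\<^sup>2)"
      by (intro sum.cong refl) (simp add: power2_eq_square algebra_simps)
    also have "\<dots> = (\<Sum>p\<in>C. (c p)\<^sup>2) - 2 * \<mu> * (N\<^sup>2 * q) + q\<^sup>2 * \<mu>\<^sup>2"
      by (simp add: sum.distrib sum_subtractf sum_distrib_left[symmetric] sum_c cardC)
    also have "2 * \<mu> * (N\<^sup>2 * q) = 2 * N ^ 4" using q0 by (simp add: \<mu>_def power_numeral_reduce)
    also have "q\<^sup>2 * \<mu>\<^sup>2 = N ^ 4" using q0 by (simp add: \<mu>_def power_numeral_reduce)
    finally show ?thesis using sum_c2 by simp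
  qed
  define P where "P = {p \<in> C. \<delta> * N \<le> c p}"
  have "card D \<le> card P"
  proof (rule card_inj_on_le[where f = "\<lambda>f. (slope f, app f \<zero>)"])
    have ab: "\<exists>a b. a \<in> carrier R \<and> b \<in> carrier R \<and> a \<noteq> \<zero> \<and> f = affine a b \<and> slope f = a \<and> app f \<zero> = b"
      if "f \<in> D" for f
    proof -
      have "f \<in> affines" using that D(2) by auto
      then obtain a b where f: "a \<in> carrier R" "a \<noteq> \<zero>" "b \<in> carrier R" "f = affine a b" "slope f = a"
        by (rule affinesE)
      moreover from f have "app f \<zero> = b" by (simp add: app_affine aff_fun_def)
      ultimately show ?thesis by blast
    qed
    show "inj_on (\<lambda>f. (slope f, app f \<zero>)) D"
      by (rule inj_onI) (metis ab prod.inject)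
    show "(\<lambda>f. (slope f, app f \<zero>)) ` D \<subseteq> P"
    proof clarify
      fix f assume f: "f \<in> D"
      from ab[OF f] obtain a b where f': "a \<in> carrier R" "b \<in> carrier R" "a \<noteq> \<zero>" "f = affine a b"
        "slope f = a" "app f \<zero> = b" by blast
      have "c (a, b) = (\<Sum>x\<in>Y. of_bool (app f x \<in> Y))"
        unfolding c_def
      proof (intro sum.cong refl)
        fix x assume "x \<in> Y"
        then have "app f x = a \<otimes> x \<oplus> b" using f' Yc by (simp add: app_affine aff_fun_def)
        then show "(\<Sum>y\<in>Y. of_bool (fst (a, b) \<otimes> x \<oplus> snd (a, b) = y) :: real) = of_bool (app f x \<in> Y)"
          using finY by (simp add: of_bool_def)
      qed
      also have "\<dots> = real (rcount Y f)"
        using finY by (simp add: rcount_def of_bool_def sum.inter_filter[symmetric])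
      finally show "(slope f, app f \<zero>) \<in> P"
        using rich[OF f] f' by (simp add: P_def C_def N_def)
    qed
    show "finite P" using finC by (simp add: P_def)
  qed
  then have "real (card D) * (\<delta> * N / 2)\<^sup>2 \<le> real (card P) * (\<delta> * N / 2)\<^sup>2"
    by (intro mult_right_mono) auto
  also have "\<dots> = (\<Sum>p\<in>P. (\<delta> * N / 2)\<^sup>2)" by simp
  also have "\<dots> \<le> (\<Sum>p\<in>P. (c p - \<mu>)\<^sup>2)"
  proof (intro sum_mono power_mono)
    fix p assume "p \<in> P"
    moreover have "\<mu> \<le> \<delta> * N / 2"
    proof -
      have "N * (2 * N) \<le> N * (\<delta> * q)" using \<delta>(2) N0 by (intro mult_left_mono) (auto simp: N_def q_def)
      then show ?thesis using q0 by (simp add: \<mu>_def field_simps power2_eq_square)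
    qed
    ultimately show "\<delta> * N / 2 \<le> c p - \<mu>" by (simp add: P_def)
  qed (use \<delta> N0 in simp)
  also have "\<dots> \<le> (\<Sum>p\<in>C. (c p - \<mu>)\<^sup>2)"
    using finC by (intro sum_mono2) (auto simp: P_def)
  also have "\<dots> \<le> N\<^sup>2 * q" by (rule var)
  finally have "N\<^sup>2 * (real (card D) * \<delta>\<^sup>2) \<le> N\<^sup>2 * (4 * q)"
    by (simp add: power2_eq_square field_simps)
  then have "real (card D) * \<delta>\<^sup>2 \<le> 4 * q" by (rule mult_left_le_imp_le) (use N0 in simp)
  then show ?thesis by (simp add: q_def)
qed

text \<open>An affine map is determined by two points of \<open>Y\<close> and their two images in
  \<open>Y\<close>, hence the exponent.\<close>

lemma rich_affines_le_card4:
  assumes Y: "finite Y" "Y \<subseteq> carrier R" and D: "D \<subseteq> affines"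
    and rich: "\<And>f. f \<in> D \<Longrightarrow> 2 \<le> rcount Y f"
  shows "card D \<le> card Y ^ 4"
proof -
  have ex: "\<exists>x x'. x \<in> Y \<and> x' \<in> Y \<and> x \<noteq> x' \<and> app f x \<in> Y \<and> app f x' \<in> Y" if "f \<in> D" for f
  proof -
    have "\<not> card {y \<in> Y. app f y \<in> Y} \<le> Suc 0" using rich[OF that] by (simp add: rcount_def)
    then show ?thesis using Y by (subst (asm) card_le_Suc0_iff_eq) auto
  qed
  define e where "e f = (SOME p. fst p \<in> Y \<and> snd p \<in> Y \<and> fst p \<noteq> snd p \<and> app f (fst p) \<in> Y \<and> app f (snd p) \<in> Y)" for f
  have e: "fst (e f) \<in> Y \<and> snd (e f) \<in> Y \<and> fst (e f) \<noteq> snd (e f) \<and> app f (fst (e f)) \<in> Y \<and> app f (snd (e f)) \<in> Y"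
    if "f \<in> D" for f
    unfolding e_def by (rule someI_ex) (use ex[OF that] in auto)
  have "card D \<le> card ((Y \<times> Y) \<times> (Y \<times> Y))"
  proof (rule card_inj_on_le[where f = "\<lambda>f. (e f, (app f (fst (e f)), app f (snd (e f))))"])
    show "inj_on (\<lambda>f. (e f, (app f (fst (e f)), app f (snd (e f))))) D"
    proof (rule inj_onI)
      fix f g assume h: "f \<in> D" "g \<in> D"
        "(e f, (app f (fst (e f)), app f (snd (e f)))) = (e g, (app g (fst (e g)), app g (snd (e g))))"
      obtain x x' where xx: "e f = (x, x')" by (cases "e f")
      have eg: "e g = (x, x')" using h(3) xx by simp
      have x: "x \<in> carrier R" "x' \<in> carrier R" "x \<noteq> x'" "app f x = app g x" "app f x' = app g x'"
        using h(3) e[OF h(1)] Y(2) by (auto simp: xx eg)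
      from h D have "f \<in> affines" "g \<in> affines" by auto
      from \<open>f \<in> affines\<close> obtain a b where f: "a \<in> carrier R" "a \<noteq> \<zero>" "b \<in> carrier R" "f = affine a b"
        by (rule affinesE)
      from \<open>g \<in> affines\<close> obtain c d where g: "c \<in> carrier R" "c \<noteq> \<zero>" "d \<in> carrier R" "g = affine c d"
        by (rule affinesE)
      have eq: "a \<otimes> x \<oplus> b = c \<otimes> x \<oplus> d" "a \<otimes> x' \<oplus> b = c \<otimes> x' \<oplus> d"
        using x f g by (simp_all add: app_affine aff_fun_def)
      have "a = c"
      proof (rule ccontr)
        assume "a \<noteq> c"
        from affine_agree_unique[OF f(1,3) g(1,3) this x(1,2) eq] x(3) show False by simp
      qed
      moreover from this have "b = d" using eq(1) f g x add.l_cancel[of "c \<otimes> x" b d] by simp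
      ultimately show "f = g" using f g by simp
    qed
    show "(\<lambda>f. (e f, (app f (fst (e f)), app f (snd (e f))))) ` D \<subseteq> (Y \<times> Y) \<times> (Y \<times> Y)"
      using e by (simp add: image_subset_iff mem_Times_iff)
    show "finite ((Y \<times> Y) \<times> (Y \<times> Y))" using Y by simp
  qed
  then show ?thesis by (simp add: card_cartesian_product power4_eq_xxxx mult.assoc)
qed

lemma wsupp_affines:
  assumes "L \<subseteq> affines"
  shows "wsupp L n \<subseteq> affines"
proof (induction n)
  case (Suc n)
  show ?case
  proof
    fix f assume "f \<in> wsupp L (Suc n)"
    then obtain a b where "a \<in> wsupp L n" "b \<in> wsupp L n" "f = a - b" by (auto simp: diff_supp_def)
    with Suc show "f \<in> affines" by (auto intro: affines_diff(1))
  qed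
qed (use assms in simp)

text \<open>The family is cut down to its members \<open>I\<close> in one coset of \<open>S\<close>.
  If \<open>affine_structure_bound\<close> compares with \<open>card S\<close>, the bound for
  iterated sums of \<open>S\<close> limits \<open>card I\<close>. If it compares with the field,
  \<open>card A\<close> is bounded by the number of rich words, and the size of the field cancels
  against the count of \<open>rich_affines_le\<close>. The parameter \<open>\<delta>\<close> is half
  of the richness expected of the longest words, of length \<open>2 ^ Suc J\<close>.\<close>

lemma rich_family_bound:
  fixes \<alpha> \<delta> \<beta> \<kappa> :: real and J :: nat
  assumes L: "finite L" "L \<noteq> {}" "L \<subseteq> affines" "inj_on slope L"
    and noncon: "\<And>f g h x. \<lbrakk>f \<in> L; g \<in> L; h \<in> L; f \<noteq> g; f \<noteq> h; g \<noteq> h; x \<in> carrier R\<rbrakk>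
        \<Longrightarrow> \<not> (app f x = app g x \<and> app g x = app h x)"
    and generic: "\<And>x. x \<in> carrier R \<Longrightarrow> x \<noteq> \<zero> \<Longrightarrow> infinite (range (\<lambda>m::nat. [m] \<cdot> x)) \<or>
      finite (carrier R) \<and> range (\<lambda>m::nat. [m] \<cdot> x) = carrier R"
    and Y: "finite Y" "Y \<subseteq> carrier R" "Y \<noteq> {}" and \<alpha>: "0 < \<alpha>" "\<alpha> \<le> 1" and J: "1 \<le> J"
    and rich: "\<And>f. f \<in> L \<Longrightarrow> \<alpha> * real (card Y) \<le> real (rcount Y f)"
    and \<delta>: "\<delta> = \<alpha> ^ (2 ^ Suc J) / 2" "2 \<le> \<delta> * real (card Y)"
      "infinite (carrier R) \<or> 2 * real (card Y) \<le> \<delta> * real (card (carrier R))"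
    and \<kappa>: "\<kappa> = real (card Y) powr (16 / real J)"
  shows "(\<delta> / 2) ^ (4 ^ J) * \<delta>\<^sup>2 * real (card L) \<le> 2 ^ 81 * \<kappa> ^ 152"
proof -
  define N where "N = real (card Y)"
  have N1: "1 \<le> N" using Y by (simp add: N_def Suc_le_eq card_gt_0_iff)
  define d where "d n = \<alpha> ^ (2 ^ n) / 2" for n :: nat
  define D where "D n = {z \<in> wsupp L n. d n * N \<le> real (rcount Y z)}" for n
  \<comment> \<open>Chosen so that \<open>K ^ J = N ^ 4\<close>, the bound for the number of rich
    words at the last scale.\<close>
  define K where "K = N powr (4 / real J)"
  have K1: "1 \<le> K" using N1 J by (simp add: K_def ge_one_powr_ge_zero)
  have KJ: "K ^ J = N ^ 4"
  proof -
    have "K ^ J = K powr real J" using powr_realpow[of K J] K1 by simp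
    also have "\<dots> = N powr 4" using J by (simp add: K_def powr_powr)
    also have "\<dots> = N ^ 4" using N1 by (simp add: powr_numeral)
    finally show ?thesis .
  qed
  have \<kappa>K: "\<kappa> = K ^ 4"
  proof -
    have "K ^ 4 = K powr 4" using K1 by (simp add: powr_numeral)
    also have "\<dots> = N powr (16 / real J)" by (simp add: K_def powr_powr)
    finally show ?thesis by (simp add: \<kappa> N_def)
  qed
  have \<kappa>1: "1 \<le> \<kappa>" using K1 by (simp add: \<kappa>K one_le_power)
  have \<delta>0: "0 < \<delta>" "\<delta> \<le> 1/2" using \<alpha> by (simp_all add: \<delta>(1) power_le_one)
  have \<delta>d: "\<delta> \<le> d n" if "n \<le> Suc J" for n
  proof -
    have "(2::nat) ^ n \<le> 2 ^ Suc J" using that by (intro power_increasing) auto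
    then have "\<alpha> ^ (2 ^ Suc J) \<le> \<alpha> ^ (2 ^ n)" by (rule power_decreasing) (use \<alpha> in auto)
    then show ?thesis by (simp add: \<delta>(1) d_def)
  qed
  have D_rich: "\<delta> * N \<le> real (rcount Y f)" if "f \<in> D n" "n \<le> Suc J" for f n
  proof -
    have "\<delta> * N \<le> d n * N" using \<delta>d[OF that(2)] N1 by (intro mult_right_mono) auto
    with that(1) show ?thesis by (simp add: D_def)
  qed
  have D_aff: "D n \<subseteq> affines" for n using wsupp_affines[OF L(3)] by (auto simp: D_def)
  have D_fin: "finite (D n)" for n using finite_wsupp[OF L(1)] by (simp add: D_def)
  \<comment> \<open>The additional half serves the condition \<open>\<beta> \<le> 1/4\<close> of
    \<open>words_structure\<close>, as \<open>\<delta>\<close> itself is only bounded by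
    \<open>1/2\<close>.\<close>
  have D_mass: "\<delta> / 2 \<le> sum (wlaw L n) (D n)" if "n \<le> Suc J" for n
  proof -
    have "d n \<le> sum (wlaw L n) (D n)"
      using rich_words_mass[OF L(1,2) Y(1,3) _ rich, of n] \<alpha> by (simp add: d_def D_def N_def)
    with \<delta>d[OF that] \<delta>0 show ?thesis by simp
  qed
  have D_card: "real (card (D (Suc J))) \<le> K ^ J"
  proof -
    have "card (D (Suc J)) \<le> card Y ^ 4"
    proof (rule rich_affines_le_card4[OF Y(1,2) D_aff])
      fix f assume "f \<in> D (Suc J)"
      then have "2 \<le> real (rcount Y f)" using D_rich[of f "Suc J"] \<delta>(2) by (simp add: N_def)
      then show "2 \<le> rcount Y f" by simp
    qed
    then have "real (card (D (Suc J))) \<le> real (card Y ^ 4)" by (rule of_nat_mono)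
    then show ?thesis by (simp add: KJ N_def)
  qed
  have K0: "0 < K" using K1 by simp
  have half: "0 < \<delta> / 2" "\<delta> / 2 \<le> 1 / 4" using \<delta>0 by auto
  have D_sub: "D n \<subseteq> wsupp L n" for n by (auto simp: D_def)
  obtain n S A where n: "1 \<le> n" "n \<le> J" and S: "finite S" "0 \<in> S" "\<And>s. s \<in> S \<Longrightarrow> - s \<in> S"
    "S \<subseteq> {- a + b | a b. a \<in> wsupp L n \<and> b \<in> wsupp L n}"
    and A: "real (card A) \<le> 2 * \<kappa> * real (card S)" "real (card A) \<le> \<kappa> * real (card (D n))"
    and sums: "\<And>j. real (card (nsums j S)) \<le> (2 * \<kappa>\<^sup>2) ^ j * real (card (A :: 'a bijection set))"
    and ex: "\<exists>g. (\<delta> / 2) ^ (4 ^ J) * real (card L) \<le> 16 * \<kappa> ^ 3 * real (card {f \<in> L. f - g \<in> S})"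
    using words_structure[OF L(1,2) half J K0 order.refl \<kappa>K D_sub D_mass D_card] by blast
  obtain g where g: "(\<delta> / 2) ^ (4 ^ J) * real (card L) \<le> 16 * \<kappa> ^ 3 * real (card {f \<in> L. f - g \<in> S})"
    using ex by blast
  define I where "I = {f \<in> L. f - g \<in> S}"
  \<comment> \<open>The growth factor for \<open>nsums 74 S\<close>. The exponents of the final
    bound come from \<open>8 * \<kappa> * B = 2 ^ 77 * \<kappa> ^ 149\<close> and the factor
    \<open>16 * \<kappa> ^ 3\<close> paid for passing from the family to one coset.\<close>
  define B where "B = (2 * \<kappa>\<^sup>2) ^ 74"
  have B: "8 * \<kappa> * B = 2 ^ 77 * \<kappa> ^ 149"
    by (simp add: B_def power_mult_distrib power_mult[symmetric] power_Suc[symmetric] del: power_Suc)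
  have B1: "1 \<le> B" unfolding B_def
  proof (rule one_le_power)
    have "1 \<le> \<kappa>\<^sup>2" using \<kappa>1 by (rule one_le_power)
    then show "1 \<le> 2 * \<kappa>\<^sup>2" by simp
  qed
  have sums74: "real (card (nsums 74 S)) \<le> B * real (card A)" using sums[of 74] unfolding B_def .
  have "real (card I) * \<delta>\<^sup>2 \<le> 8 * \<kappa> * B"
  proof (cases "card I < 3")
    \<comment> \<open>Three members are needed for a commutator; with fewer, the claim is
      trivial.\<close>
    case True
    have "real (card I) * \<delta>\<^sup>2 \<le> 3 * 1"
      using True \<delta>0 by (intro mult_mono power_le_one) auto
    also have "\<dots> \<le> 8 * \<kappa> * B" using \<kappa>1 B1 mult_mono[of 1 \<kappa> 1 B] by simp
    finally show ?thesis .
  next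
    case False
    have S_aff: "S \<subseteq> affines"
    proof
      fix s assume "s \<in> S"
      then obtain a b where "a \<in> affines" "b \<in> affines" "s = - a + b"
        using S(4) wsupp_affines[OF L(3), of n] by blast
      then show "s \<in> affines" using affines_add(1) affines_uminus(1) by blast
    qed
    have I: "finite I" "I \<subseteq> affines" "inj_on slope I"
      using L by (auto simp: I_def inj_on_def)
    have I2: "f - h \<in> nsums 2 S" if "f \<in> I" "h \<in> I" for f h
    proof -
      have "f - g \<in> nsums 1 S" "- (h - g) \<in> nsums 1 S"
        using that S(3) by (simp_all only: I_def One_nat_def nsums_1 mem_Collect_eq)
      then have "(f - g) + - (h - g) \<in> nsums (1 + 1) S" by (rule nsums_add)
      moreover have "(f - g) + - (h - g) = f - h"
        by (simp add: diff_conv_add_uminus group_add_class.minus_add add.assoc del: add_uminus_conv_diff)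
      moreover have "1 + 1 = (2::nat)" by simp
      ultimately show ?thesis by (simp only:)
    qed
    have "card I * card S \<le> 2 * card (nsums 74 S) \<or>
        finite (carrier R) \<and> card I * card (carrier R) \<le> 2 * card (nsums 74 S)"
      by (rule affine_structure_bound[OF S(1) S_aff S(2,3) I(1,2) _ I(3) I2 _ generic])
        (use False noncon in \<open>auto simp: I_def\<close>)
    then show ?thesis
    proof
      assume "card I * card S \<le> 2 * card (nsums 74 S)"
      then have "real (card I * card S) \<le> real (2 * card (nsums 74 S))" by (rule of_nat_mono)
      also have "\<dots> \<le> 2 * (B * real (card A))" using sums74 by simp
      also have "\<dots> \<le> 2 * (B * (2 * \<kappa> * real (card S)))"
        using A(1) B1 by (intro mult_left_mono) auto
      finally have "real (card I) * real (card S) \<le> 4 * \<kappa> * B * real (card S)" by (simp add: mult_ac)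
      moreover have "0 < real (card S)" using S by (auto simp: card_gt_0_iff)
      ultimately have "real (card I) \<le> 4 * \<kappa> * B" by (rule mult_right_le_imp_le)
      moreover have "real (card I) * \<delta>\<^sup>2 \<le> real (card I) * 1"
        using \<delta>0 by (intro mult_left_mono power_le_one) auto
      moreover have "0 \<le> \<kappa> * B" using \<kappa>1 B1 by simp
      ultimately show ?thesis by simp
    next
      assume fin: "finite (carrier R) \<and> card I * card (carrier R) \<le> 2 * card (nsums 74 S)"
      define q where "q = real (card (carrier R))"
      have q0: "0 < q" using fin by (auto simp: q_def card_gt_0_iff)
      have "real (card I * card (carrier R)) \<le> real (2 * card (nsums 74 S))"
        using fin by (intro of_nat_mono) simp
      also have "\<dots> \<le> 2 * (B * real (card A))" using sums74 by simp
      also have "\<dots> \<le> 2 * (B * (\<kappa> * real (card (D n))))"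
        using A(2) B1 by (intro mult_left_mono) auto
      finally have "real (card I) * q \<le> 2 * \<kappa> * B * real (card (D n))" by (simp add: q_def mult_ac)
      then have "real (card I) * q * \<delta>\<^sup>2 \<le> 2 * \<kappa> * B * real (card (D n)) * \<delta>\<^sup>2"
        by (rule mult_right_mono) simp
      also have "\<dots> = 2 * \<kappa> * B * (real (card (D n)) * \<delta>\<^sup>2)" by simp
      also have "\<dots> \<le> 2 * \<kappa> * B * (4 * q)"
      proof (rule mult_left_mono)
        show "real (card (D n)) * \<delta>\<^sup>2 \<le> 4 * q" unfolding q_def
        proof (rule rich_affines_le[where Y = Y])
          show "2 * real (card Y) \<le> \<delta> * real (card (carrier R))" using \<delta>(3) fin by blast
          fix f assume "f \<in> D n"
          then show "\<delta> * real (card Y) \<le> real (rcount Y f)" using D_rich[of f n] n by (simp add: N_def)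
        qed (use fin Y D_fin D_aff \<delta>0 in auto)
      qed (use \<kappa>1 B1 in simp)
      finally have "real (card I) * \<delta>\<^sup>2 * q \<le> 8 * \<kappa> * B * q" by (simp add: mult_ac)
      then show ?thesis by (rule mult_right_le_imp_le[OF _ q0])
    qed
  qed
  then have "real (card I) * \<delta>\<^sup>2 \<le> 2 ^ 77 * \<kappa> ^ 149" unfolding B .
  then have "16 * \<kappa> ^ 3 * (real (card I) * \<delta>\<^sup>2) \<le> 16 * \<kappa> ^ 3 * (2 ^ 77 * \<kappa> ^ 149)"
    using \<kappa>1 by (intro mult_left_mono) auto
  moreover have "(\<delta> / 2) ^ (4 ^ J) * real (card L) * \<delta>\<^sup>2 \<le> 16 * \<kappa> ^ 3 * real (card I) * \<delta>\<^sup>2"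
    using g by (intro mult_right_mono) (auto simp: I_def)
  moreover have "16 * \<kappa> ^ 3 * (2 ^ 77 * \<kappa> ^ 149) = 2 ^ 81 * \<kappa> ^ 152"
    by (simp add: power_add[symmetric])
  ultimately show ?thesis by (simp add: mult_ac)
qed

end

section \<open>Smooth numbers\<close>

text \<open>Applied to the central binomial coefficient, this makes every positive common multiple
  of \<open>1, ..., 2 * n + 1\<close> at least \<open>4 ^ n\<close>, which yields primes without
  estimates from analytic number theory.\<close>

lemma binomial_dvd_common_multiple:
  fixes M :: nat
  assumes "\<And>j. 1 \<le> j \<Longrightarrow> j \<le> n + 1 \<Longrightarrow> j dvd M" "m \<le> n"
  shows "(n + 1) * (n choose m) dvd M"
  using assms
proof (induction m arbitrary: n)
  case 0
  then show ?case by simp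
next
  case (Suc m)
  then obtain n' where n: "n = Suc n'" by (cases n) auto
  have mn: "m \<le> n'" "m \<le> n" using Suc.prems n by auto
  have "(n' + 1) * (n' choose m) dvd M" using Suc.prems n mn by (intro Suc.IH) auto
  then obtain a where a: "M = (n' + 1) * (n' choose m) * a" by auto
  have "(n + 1) * (n choose m) dvd M" using Suc.prems n mn by (intro Suc.IH) auto
  then obtain b where b: "M = (n + 1) * (n choose m) * b" by auto
  text \<open>Leibniz' harmonic triangle: the reciprocals of \<open>(n + 1) * (n choose m)\<close> satisfy a Pascal-type recursion.\<close>
  define x where "x = real (n' choose m)"
  define y where "y = real (n choose m)"
  define z where "z = real (n choose Suc m)"
  have pos: "0 < x" "0 < y" "0 < z" 
    using Suc.prems(2) mn by (simp_all add: x_def y_def z_def zero_less_binomial_iff)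
  have r1: "real (Suc m) * z = real n * x"
  proof -
    have "Suc m * (n choose Suc m) = n * (n' choose m)" unfolding n by (rule Suc_times_binomial)
    then show ?thesis unfolding z_def x_def of_nat_mult[symmetric] by (simp only:)
  qed
  have r2: "real (n - m) * y = real n * x"
  proof -
    have "(n - m) * (n choose m) = n * (n' choose m)" using binomial_absorb_comp[of n m] by (simp add: n)
    then show ?thesis unfolding y_def x_def of_nat_mult[symmetric] by (simp only:)
  qed
  have nm: "real (n - m) = real n - real m" using mn by simp
  have inv: "1 / ((real n + 1) * z) = 1 / (real n * x) - 1 / ((real n + 1) * y)"
  proof -
    have n0: "0 < real n" "0 < real (n - m)" using n mn by auto
    have z: "z = real n * x / real (Suc m)" using r1 by (simp add: field_simps)
    have y: "y = real n * x / real (n - m)" using r2 n0 by (simp add: field_simps)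
    have "1 / ((real n + 1) * z) = real (Suc m) / ((real n + 1) * (real n * x))"
      unfolding z by simp
    also have "\<dots> = ((real n + 1) - real (n - m)) / ((real n + 1) * (real n * x))" by (simp add: nm)
    also have "\<dots> = 1 / (real n * x) - real (n - m) / ((real n + 1) * (real n * x))"
      unfolding diff_divide_distrib using n0 pos by simp
    also have "real (n - m) / ((real n + 1) * (real n * x)) = 1 / ((real n + 1) * y)"
      unfolding y by simp
    finally show ?thesis .
  qed
  have Ma: "real M = real n * x * real a" by (simp add: a x_def n algebra_simps)
  have Mb: "real M = (real n + 1) * y * real b" by (simp add: b y_def algebra_simps)
  have "real M / ((real n + 1) * z) = real M / (real n * x) - real M / ((real n + 1) * y)"
    using arg_cong[OF inv, of "\<lambda>t. real M * t"] by (simp add: right_diff_distrib)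
  also have "\<dots> = real a - real b"
    using pos n by (subst Ma, subst Mb) simp
  finally have "real M / ((real n + 1) * z) = real a - real b" .
  moreover have "(real n + 1) * z \<noteq> 0" using pos by simp
  ultimately have "real M = (real a - real b) * ((real n + 1) * z)"
    by (metis nonzero_divide_eq_eq)
  then have "real_of_int (int M) = real_of_int ((int a - int b) * (int (n + 1) * int (n choose Suc m)))"
    by (simp add: z_def)
  then have "int M = (int a - int b) * (int (n + 1) * int (n choose Suc m))"
    by (simp only: of_int_eq_iff)
  then have "int ((n + 1) * (n choose Suc m)) dvd int M" by (simp only: of_nat_mult dvd_triv_right)
  then show ?case by (simp only: int_dvd_int_iff)
qed

definition prime_set :: "nat \<Rightarrow> nat set" where
  "prime_set x = {p. Factorial_Ring.prime p \<and> p \<le> x}"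

lemma finite_prime_set: "finite (prime_set x)"
  by (rule finite_subset[of _ "{..x}"]) (auto simp: prime_set_def)

text \<open>The multiple is the product of the largest prime powers not exceeding \<open>x\<close>,
  with one factor of size at most \<open>x\<close> for each prime.\<close>

lemma common_multiple_le_power_card_primes:
  assumes "1 \<le> x"
  obtains M where "0 < M" "M \<le> x ^ card (prime_set x)" "\<And>j. 1 \<le> j \<Longrightarrow> j \<le> x \<Longrightarrow> j dvd M"
proof -
  define e where "e p = (GREATEST k. p ^ k \<le> x)" for p
  have e: "p ^ e p \<le> x \<and> (\<forall>k. p ^ k \<le> x \<longrightarrow> k \<le> e p)" if "p \<in> prime_set x" for p
  proof -
    have p2: "2 \<le> p" using that prime_ge_2_nat by (auto simp: prime_set_def)
    have bd: "k \<le> x" if "p ^ k \<le> x" for k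
    proof -
      have "k < 2 ^ k" by (rule less_exp)
      also have "\<dots> \<le> p ^ k" using p2 by (rule power_mono) simp
      finally show ?thesis using that by simp
    qed
    have "p ^ e p \<le> x" unfolding e_def
      by (rule GreatestI_nat[of "\<lambda>k. p ^ k \<le> x" 0 x]) (use assms bd in auto)
    moreover have "k \<le> e p" if "p ^ k \<le> x" for k
      unfolding e_def by (rule Greatest_le_nat[of "\<lambda>k. p ^ k \<le> x" k x]) (use that bd in auto)
    ultimately show ?thesis by blast
  qed
  define M where "M = (\<Prod>p\<in>prime_set x. p ^ e p)"
  have pr: "Factorial_Ring.prime p" if "p \<in> prime_set x" for p using that by (simp add: prime_set_def)
  have "0 < M" unfolding M_def using pr prime_gt_0_nat by (intro prod_pos) auto
  moreover have "M \<le> x ^ card (prime_set x)"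
    unfolding M_def using e assms by (intro prod_le_power) auto
  moreover have "j dvd M" if j: "1 \<le> j" "j \<le> x" for j
  proof (rule multiplicity_le_imp_dvd)
    fix p :: nat assume p: "Factorial_Ring.prime p"
    show "multiplicity p j \<le> multiplicity p M"
    proof (cases "p \<in> prime_set x")
      case True
      have "p ^ multiplicity p j dvd j" by (rule multiplicity_dvd)
      then have "p ^ multiplicity p j \<le> x" using j by (meson dvd_imp_le le_trans less_le_trans zero_less_one)
      then have "multiplicity p j \<le> e p" using e[OF True] by blast
      moreover have "p ^ e p dvd M"
        unfolding M_def by (rule dvd_prodI[OF finite_prime_set True])
      then have "e p \<le> multiplicity p M"
        using \<open>0 < M\<close> p by (intro multiplicity_geI) auto
      ultimately show ?thesis by simp
    next
      case False
      then have "\<not> p dvd j" using p j by (auto simp: prime_set_def dest: dvd_imp_le)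
      then show ?thesis by (simp add: not_dvd_imp_multiplicity_0)
    qed
  qed (use j \<open>0 < M\<close> in auto)
  ultimately show thesis by (rule that)
qed

text \<open>With fewer than \<open>d\<close> primes up to \<open>2 * n + 1\<close>, the numbers up
  to there would have a common multiple of size at most \<open>(2 * n + 1) ^ d\<close>, against the
  lower bound \<open>4 ^ n\<close>. A quadratic \<open>n\<close> makes the contradiction elementary
  and keeps the logarithms of the primes of order \<open>ln d\<close>.\<close>

lemma many_small_primes:
  assumes d: "1 \<le> d"
  obtains P where "finite P" "card P = d" "\<And>p. p \<in> P \<Longrightarrow> Factorial_Ring.prime p \<and> p \<le> 9 * d\<^sup>2"
proof -
  define n where "n = 4 * d\<^sup>2"
  have d2: "1 \<le> d\<^sup>2" using d by simp
  have n0: "0 < n" using d by (simp add: n_def)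
  have nle: "2 * n + 1 \<le> 9 * d\<^sup>2" using d2 by (simp add: n_def)
  have "d \<le> card (prime_set (2 * n + 1))"
  proof (rule ccontr)
    assume "\<not> ?thesis"
    then have less: "card (prime_set (2 * n + 1)) \<le> d" by simp
    obtain M where M: "0 < M" "M \<le> (2 * n + 1) ^ card (prime_set (2 * n + 1))"
      "\<And>j. 1 \<le> j \<Longrightarrow> j \<le> 2 * n + 1 \<Longrightarrow> j dvd M"
      using common_multiple_le_power_card_primes[of "2 * n + 1"] by auto
    have "(2 * n + 1) * ((2 * n) choose n) dvd M"
      by (rule binomial_dvd_common_multiple) (use M(3) in auto)
    then have "(2 * n + 1) * ((2 * n) choose n) \<le> M" using M(1) by (rule dvd_imp_le)
    also have "M \<le> (2 * n + 1) ^ d"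
      using M(2) less by (meson le_add2 le_trans power_increasing)
    finally have "real ((2 * n + 1) * ((2 * n) choose n)) \<le> real ((2 * n + 1) ^ d)" by (rule of_nat_mono)
    moreover have "4 ^ n \<le> real ((2 * n + 1) * ((2 * n) choose n))"
    proof -
      have "4 ^ n \<le> 2 * real n * real ((2 * n) choose n)"
        using central_binomial_lower_bound[OF n0] n0 by (simp add: field_simps)
      also have "\<dots> \<le> real ((2 * n + 1) * ((2 * n) choose n))"
        unfolding of_nat_mult by (intro mult_right_mono) auto
      finally show ?thesis .
    qed
    ultimately have "real (4 ^ n) \<le> real ((2 * n + 1) ^ d)" by simp
    then have "4 ^ n \<le> (2 * n + 1) ^ d" by (simp only: of_nat_le_iff)
    also have "\<dots> \<le> (9 * d\<^sup>2) ^ d" by (rule power_mono[OF nle]) simp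
    also have "\<dots> = (3 * d) ^ (2 * d)" by (simp add: power_mult power_mult_distrib)
    also have "\<dots> < (4 ^ d) ^ (2 * d)"
    proof (rule power_strict_mono)
      have "3 * m < 4 ^ m" for m :: nat
      proof (induction m)
        case (Suc m)
        have "(1::nat) \<le> 4 ^ m" by simp
        with Suc show ?case by simp
      qed simp
      then show "3 * d < 4 ^ d" .
    qed (use d in auto)
    also have "\<dots> \<le> 4 ^ n"
      unfolding power_mult[symmetric] by (intro power_increasing) (auto simp: n_def power2_eq_square)
    finally show False by simp
  qed
  then obtain P where P: "P \<subseteq> prime_set (2 * n + 1)" "card P = d" by (meson obtain_subset_with_card_n)
  show thesis
  proof (rule that[of P])
    show "finite P" using P(1) finite_prime_set finite_subset by blast
    show "Factorial_Ring.prime p \<and> p \<le> 9 * d\<^sup>2" if "p \<in> P" for p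
      using that P(1) nle by (auto simp: prime_set_def)
  qed (rule P(2))
qed

text \<open>Numbers are coded by their exponent vectors on \<open>d\<close> primes, with
  \<open>Box k\<close> allowing exponents below \<open>k\<close>. \<open>A\<close> is
  \<open>Box 2\<close>, the squarefree products; \<open>D\<close> is \<open>Box T\<close>; and
  \<open>Q\<close> has all exponents equal to \<open>T - 1\<close>, so that every element of
  \<open>D\<close> divides it. Multiplication by \<open>a \<in> A\<close> raises each exponent by at
  most one and so maps \<open>Box (T - 1)\<close> into \<open>Box T\<close>.\<close>

lemma smooth_numbers:
  assumes d: "1 \<le> d" and T: "2 \<le> T"
  obtains A D :: "nat set" and Q :: nat where
    "finite A" "card A = 2 ^ d" "\<And>a. a \<in> A \<Longrightarrow> 0 < a \<and> a \<le> (9 * d\<^sup>2) ^ d"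
    "finite D" "card D = T ^ d" "\<And>u. u \<in> D \<Longrightarrow> 0 < u \<and> u dvd Q"
    "0 < Q" "Q \<le> ((9 * d\<^sup>2) ^ d) ^ (T - 1)"
    "\<And>a. a \<in> A \<Longrightarrow> (T - 1) ^ d \<le> card {u \<in> D. a * u \<in> D}"
proof -
  obtain P where P: "finite P" "card P = d" "\<And>p. p \<in> P \<Longrightarrow> Factorial_Ring.prime p \<and> p \<le> 9 * d\<^sup>2"
    using many_small_primes[OF d] by blast
  define pp where "pp t = (\<Prod>p\<in>P. p ^ t p)" for t :: "nat \<Rightarrow> nat"
  define Box where "Box k = pp ` (P \<rightarrow>\<^sub>E {..<k})" for k
  have pp_pos: "0 < pp t" for t
    unfolding pp_def using P(3) prime_gt_0_nat by (intro prod_pos) auto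
  have mult: "multiplicity p (pp t) = t p" if "p \<in> P" for p t
    unfolding pp_def using P that by (subst multiplicity_prod_prime_powers) auto
  have BoxI: "pp t \<in> Box k" if "\<And>p. p \<in> P \<Longrightarrow> t p < k" for t k
  proof (unfold Box_def, rule image_eqI[of _ _ "restrict t P"])
    show "pp t = pp (restrict t P)" unfolding pp_def by (intro prod.cong) auto
  qed (use that in auto)
  have BoxE: "\<exists>t. u = pp t \<and> (\<forall>p\<in>P. t p < k)" if "u \<in> Box k" for u k
    using that by (auto simp: Box_def PiE_iff)
  have card_Box: "card (Box k) = k ^ d" for k
  proof -
    have "inj_on pp (P \<rightarrow>\<^sub>E {..<k})"
    proof (rule inj_onI)
      fix s t assume st: "s \<in> P \<rightarrow>\<^sub>E {..<k}" "t \<in> P \<rightarrow>\<^sub>E {..<k}" "pp s = pp t"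
      show "s = t"
      proof (rule PiE_ext[OF st(1,2)])
        fix p assume "p \<in> P"
        then show "s p = t p" using mult[of p s] mult[of p t] st(3) by simp
      qed
    qed
    then show ?thesis unfolding Box_def using P by (simp add: card_image card_funcsetE)
  qed
  have fin_Box: "finite (Box k)" for k
    unfolding Box_def using P(1) by (intro finite_imageI finite_PiE) auto
  have pp_le: "pp t \<le> ((9 * d\<^sup>2) ^ d) ^ k" if "\<And>p. p \<in> P \<Longrightarrow> t p \<le> k" for t k
  proof -
    have "pp t \<le> (\<Prod>p\<in>P. (9 * d\<^sup>2) ^ k)"
      unfolding pp_def
    proof (intro prod_mono conjI)
      fix p assume p: "p \<in> P"
      have "p ^ t p \<le> p ^ k"
        using P(3)[OF p] that[OF p] prime_ge_1_nat by (intro power_increasing) auto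
      also have "\<dots> \<le> (9 * d\<^sup>2) ^ k" using P(3)[OF p] by (intro power_mono) auto
      finally show "p ^ t p \<le> (9 * d\<^sup>2) ^ k" .
    qed simp
    also have "\<dots> = ((9 * d\<^sup>2) ^ d) ^ k" by (metis P(2) prod_constant power_mult mult.commute)
    finally show ?thesis .
  qed
  define Q where "Q = pp (\<lambda>_. T - 1)"
  have shift: "(T - 1) ^ d \<le> card {u \<in> Box T. a * u \<in> Box T}" if a: "a \<in> Box 2" for a
  proof -
    obtain s where s: "a = pp s" "\<forall>p\<in>P. s p < 2" using BoxE[OF a] by blast
    have "Box (T - 1) \<subseteq> {u \<in> Box T. a * u \<in> Box T}"
    proof
      fix u assume "u \<in> Box (T - 1)"
      then obtain t where t: "u = pp t" "\<forall>p\<in>P. t p < T - 1" using BoxE by blast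
      have "a * u = pp (\<lambda>p. s p + t p)" by (simp add: s t pp_def prod.distrib power_add)
      moreover have "pp (\<lambda>p. s p + t p) \<in> Box T"
      proof (rule BoxI)
        fix p assume "p \<in> P"
        then have "s p < 2" "t p < T - 1" using s t by auto
        then show "s p + t p < T" by simp
      qed
      moreover have "u \<in> Box T" unfolding t(1) by (rule BoxI) (use t(2) in fastforce)
      ultimately show "u \<in> {u \<in> Box T. a * u \<in> Box T}" by simp
    qed
    then have "card (Box (T - 1)) \<le> card {u \<in> Box T. a * u \<in> Box T}"
      using fin_Box by (intro card_mono) auto
    then show ?thesis by (simp add: card_Box)
  qed
  show thesis
  proof (rule that[of "Box 2" "Box T" Q])
    show "0 < a \<and> a \<le> (9 * d\<^sup>2) ^ d" if "a \<in> Box 2" for a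
    proof -
      obtain s where s: "a = pp s" "\<forall>p\<in>P. s p < 2" using BoxE[OF \<open>a \<in> Box 2\<close>] by blast
      have "pp s \<le> ((9 * d\<^sup>2) ^ d) ^ 1" by (rule pp_le) (use s(2) in fastforce)
      with s pp_pos show ?thesis by simp
    qed
    show "0 < u \<and> u dvd Q" if "u \<in> Box T" for u
    proof -
      obtain t where t: "u = pp t" "\<forall>p\<in>P. t p < T" using BoxE[OF \<open>u \<in> Box T\<close>] by blast
      have "pp t dvd Q" unfolding Q_def pp_def
        by (intro prod_dvd_prod le_imp_power_dvd) (use t(2) in fastforce)
      with t pp_pos show ?thesis by simp
    qed
    show "Q \<le> ((9 * d\<^sup>2) ^ d) ^ (T - 1)" unfolding Q_def by (rule pp_le) simp
  qed (use fin_Box card_Box shift pp_pos in \<open>auto simp: Q_def\<close>)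
qed

section \<open>Sets almost invariant under affine maps\<close>

context field begin

lemma card_agree_le_1:
  assumes "c \<in> carrier R" "e \<in> carrier R" "c' \<in> carrier R" "e' \<in> carrier R" "(c, e) \<noteq> (c', e')"
  shows "finite {x \<in> carrier R. c \<otimes> x \<oplus> e = c' \<otimes> x \<oplus> e'}"
    "card {x \<in> carrier R. c \<otimes> x \<oplus> e = c' \<otimes> x \<oplus> e'} \<le> 1"
proof -
  have eq: "x = x'" if "x \<in> {x \<in> carrier R. c \<otimes> x \<oplus> e = c' \<otimes> x \<oplus> e'}"
    "x' \<in> {x \<in> carrier R. c \<otimes> x \<oplus> e = c' \<otimes> x \<oplus> e'}" for x x'
  proof (rule affine_agree_unique[OF assms(1-4)])
    show "c \<noteq> c'"
    proof
      assume "c = c'"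
      then have "e = e'" using that assms add.l_cancel[of "c' \<otimes> x" e e'] by simp
      with \<open>c = c'\<close> assms(5) show False by simp
    qed
  qed (use that in auto)
  show fin: "finite {x \<in> carrier R. c \<otimes> x \<oplus> e = c' \<otimes> x \<oplus> e'}"
  proof (cases "{x \<in> carrier R. c \<otimes> x \<oplus> e = c' \<otimes> x \<oplus> e'} = {}")
    case False
    then obtain x where "x \<in> {x \<in> carrier R. c \<otimes> x \<oplus> e = c' \<otimes> x \<oplus> e'}" by blast
    then have "{x \<in> carrier R. c \<otimes> x \<oplus> e = c' \<otimes> x \<oplus> e'} \<subseteq> {x}" using eq by blast
    then show ?thesis by (rule finite_subset) simp
  qed (simp only: finite.emptyI)
  show "card {x \<in> carrier R. c \<otimes> x \<oplus> e = c' \<otimes> x \<oplus> e'} \<le> 1"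
    unfolding One_nat_def card_le_Suc0_iff_eq[OF fin] using eq by blast
qed

text \<open>
  A set almost invariant under given affine maps: a union of orbits \<open>\<Phi> x\<close> of an almost
  invariant set \<open>\<Phi>\<close> of maps, each new orbit having a positive proportion of new points.
\<close>

lemma almost_invariant_set:
  fixes \<alpha> \<epsilon> :: real and N :: nat
  assumes \<alpha>: "0 < \<alpha>" "\<alpha> < 1" and N: "infinite (carrier R) \<or> N \<le> card (carrier R)"
    and \<Phi>: "finite \<Phi>" "\<Phi> \<noteq> {}" "\<Phi> \<subseteq> (carrier R - {\<zero>}) \<times> carrier R"
      "8 * (real (card \<Phi>))\<^sup>2 \<le> (1 - \<alpha>) * real N"
    and \<Lambda>: "\<Lambda> \<subseteq> (carrier R - {\<zero>}) \<times> carrier R"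
      "\<And>a b. (a, b) \<in> \<Lambda> \<Longrightarrow> real (card {(c, e) \<in> \<Phi>. (a \<otimes> c, a \<otimes> e \<oplus> b) \<notin> \<Phi>}) \<le> \<epsilon> * real (card \<Phi>)"
    and \<epsilon>: "\<epsilon> \<le> (1 - \<alpha>)\<^sup>2 / 8"
  obtains Y where "Y \<subseteq> carrier R" "finite Y" "card Y = N"
    "\<And>a b. (a, b) \<in> \<Lambda> \<Longrightarrow> \<alpha> * real N \<le> real (card {y \<in> Y. a \<otimes> y \<oplus> b \<in> Y})"
proof -
  \<comment> \<open>The proportion of points of \<open>Y\<close> that each map is allowed to move
    out of \<open>Y\<close>.\<close>
  define \<eta> where "\<eta> = 1 - \<alpha>"
  have \<eta>: "0 < \<eta>" "\<eta> < 1" using \<alpha> by (simp_all add: \<eta>_def)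
  define F where "F = real (card \<Phi>)"
  have F1: "1 \<le> F" using \<Phi>(1,2) by (simp add: F_def Suc_le_eq card_gt_0_iff)
  have F2: "8 * F\<^sup>2 \<le> \<eta> * real N" using \<Phi>(4) by (simp add: F_def \<eta>_def)
  have FF: "F \<le> F\<^sup>2" using F1 by (simp add: power2_eq_square mult_left_mono[of 1 F F])
  define bad where "bad Y p = {y \<in> Y. fst p \<otimes> y \<oplus> snd p \<notin> Y}" for Y and p :: "'a \<times> 'a"
  have enough: "\<exists>Y. Y \<subseteq> carrier R \<and> finite Y \<and> card Y = N \<and> (\<forall>p\<in>\<Lambda>. real (card (bad Y p)) \<le> \<eta> * real N)"
  \<comment> \<open>A field barely larger than \<open>N\<close> is treated separately: there every
    \<open>Y\<close> with \<open>N\<close> elements works, since the bad points inject into the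
    small complement. Otherwise the complement leaves room for the averaging argument.\<close>
  proof (cases "finite (carrier R) \<and> real (card (carrier R)) < real N * (1 + \<eta>)")
    case True
    then obtain Y where Y: "Y \<subseteq> carrier R" "card Y = N" using N by (meson obtain_subset_with_card_n)
    have finY: "finite Y" using Y True finite_subset by blast
    have "real (card (bad Y p)) \<le> \<eta> * real N" if "p \<in> \<Lambda>" for p
    proof -
      obtain a b where p: "p = (a, b)" "a \<in> carrier R" "a \<noteq> \<zero>" "b \<in> carrier R" using \<open>p \<in> \<Lambda>\<close> \<Lambda>(1) by (cases p) auto
      have "card (bad Y p) \<le> card (carrier R - Y)"
      proof (rule card_inj_on_le[where f = "\<lambda>y. a \<otimes> y \<oplus> b"])
        show "inj_on (\<lambda>y. a \<otimes> y \<oplus> b) (bad Y p)"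
        proof (rule inj_onI)
          fix y y' assume h: "y \<in> bad Y p" "y' \<in> bad Y p" "a \<otimes> y \<oplus> b = a \<otimes> y' \<oplus> b"
          then have "y \<in> carrier R" "y' \<in> carrier R" using Y by (auto simp: bad_def)
          with h(3) p show "y = y'" using m_lcancel by simp
        qed
        show "(\<lambda>y. a \<otimes> y \<oplus> b) ` bad Y p \<subseteq> carrier R - Y" using p Y by (auto simp: bad_def)
      qed (use True in simp)
      also have "card (carrier R - Y) = card (carrier R) - N"
        using Y finY by (simp add: card_Diff_subset)
      finally have "real (card (bad Y p)) \<le> real (card (carrier R)) - real N"
        using card_mono[of "carrier R" Y] Y True by (simp add: of_nat_diff)
      with True show ?thesis by (simp add: algebra_simps)
    qed
    with Y finY show ?thesis by blast
  next
    case False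
    then have big: "infinite (carrier R) \<or> real N * (1 + \<eta>) \<le> real (card (carrier R))" by auto
    \<comment> \<open>The witness \<open>m\<close> counts the orbits used. Each brings at least
      \<open>\<eta> / 4 * F\<close> new points, which bounds \<open>m\<close>, and at most
      \<open>\<epsilon> * F\<close> bad points for each map.\<close>
    define ok where "ok Y \<longleftrightarrow> Y \<subseteq> carrier R \<and> finite Y \<and> card Y \<le> N \<and> (\<exists>m::nat.
        \<eta> / 4 * (real m * F) \<le> real (card Y) \<and> (\<forall>p\<in>\<Lambda>. real (card (bad Y p)) \<le> real m * (\<epsilon> * F)))" for Y
    have ok0: "ok {}" unfolding ok_def by (auto simp: bad_def intro!: exI[of _ 0])
    obtain Y where Y: "ok Y" "\<And>Z. ok Z \<Longrightarrow> card Z \<le> card Y"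
    proof -
      have "\<exists>Y. ok Y \<and> (\<forall>Z. ok Z \<longrightarrow> card Z \<le> card Y)"
        by (rule ex_has_greatest_nat[of ok "{}" card "Suc N"]) (use ok0 in \<open>auto simp: ok_def less_Suc_eq_le\<close>)
      then show thesis using that by blast
    qed
    then obtain m :: nat where Yp: "Y \<subseteq> carrier R" "finite Y" "card Y \<le> N"
      "\<eta> / 4 * (real m * F) \<le> real (card Y)" "\<And>p. p \<in> \<Lambda> \<Longrightarrow> real (card (bad Y p)) \<le> real m * (\<epsilon> * F)"
      by (auto simp: ok_def)
    define ev where "ev x p = fst p \<otimes> x \<oplus> snd p" for x and p :: "'a \<times> 'a"
    have full: "N < card Y + card \<Phi>"
    proof (rule ccontr)
      assume "\<not> ?thesis"
      then have room: "card Y + card \<Phi> \<le> N" by simp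
      \<comment> \<open>Base points whose orbit is not parametrised injectively by
        \<open>\<Phi>\<close>. Two distinct maps agree at most once, so there are at most
        \<open>F^2\<close> such points.\<close>
      define C where "C = (\<Union>r\<in>{r \<in> \<Phi> \<times> \<Phi>. fst r \<noteq> snd r}. {x \<in> carrier R. ev x (fst r) = ev x (snd r)})"
      have fib: "finite {x \<in> carrier R. ev x p = ev x p'} \<and> card {x \<in> carrier R. ev x p = ev x p'} \<le> 1"
        if "p \<in> \<Phi>" "p' \<in> \<Phi>" "p \<noteq> p'" for p p'
      proof -
        obtain c e c' e' where pp: "p = (c, e)" "p' = (c', e')" by (cases p, cases p')
        have "c \<in> carrier R" "e \<in> carrier R" "c' \<in> carrier R" "e' \<in> carrier R"
          using pp that \<Phi>(3) by auto
        from card_agree_le_1[OF this] that(3) show ?thesis by (simp add: ev_def pp)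
      qed
      have finC: "finite C" unfolding C_def using \<Phi>(1) fib by (intro finite_UN_I) auto
      have cardC: "real (card C) \<le> F\<^sup>2"
      proof -
        have "card C \<le> (\<Sum>r\<in>{r \<in> \<Phi> \<times> \<Phi>. fst r \<noteq> snd r}. card {x \<in> carrier R. ev x (fst r) = ev x (snd r)})"
          unfolding C_def using \<Phi>(1) by (intro card_UN_le) auto
        also have "\<dots> \<le> (\<Sum>r\<in>{r \<in> \<Phi> \<times> \<Phi>. fst r \<noteq> snd r}. 1)"
          using fib by (intro sum_mono) auto
        also have "\<dots> = card {r \<in> \<Phi> \<times> \<Phi>. fst r \<noteq> snd r}" by simp
        also have "\<dots> \<le> card (\<Phi> \<times> \<Phi>)" using \<Phi>(1) by (intro card_mono) auto
        finally have "card C \<le> card \<Phi> * card \<Phi>" by (simp add: card_cartesian_product)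
        then have "real (card C) \<le> real (card \<Phi> * card \<Phi>)" by (rule of_nat_mono)
        then show ?thesis by (simp add: F_def power2_eq_square)
      qed
      have hit: "finite {x \<in> carrier R. ev x p = y} \<and> card {x \<in> carrier R. ev x p = y} \<le> 1"
        if "p \<in> \<Phi>" "y \<in> carrier R" for p y
      proof -
        obtain c e where p: "p = (c, e)" "c \<in> carrier R" "c \<noteq> \<zero>" "e \<in> carrier R" using \<open>p \<in> \<Phi>\<close> \<Phi>(3) by (cases p) auto
        have "{x \<in> carrier R. ev x p = y} = {x \<in> carrier R. c \<otimes> x \<oplus> e = \<zero> \<otimes> x \<oplus> y}"
          using that by (auto simp: ev_def p)
        with card_agree_le_1[of c e \<zero> y] p that show ?thesis by simp
      qed
      \<comment> \<open>Over an infinite field an orbit can avoid \<open>Y\<close> altogether. Over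
        a finite one, each map takes each value of \<open>Y\<close> at most once, so the overlaps of
        all orbits with \<open>Y\<close> add up to at most \<open>card Y * F\<close>; as there are
        at least \<open>N * (1 + \<eta>)\<close> base points, of which few lie in \<open>C\<close>,
        some overlap is a proportion below \<open>1 - \<eta> / 4\<close>.\<close>
      have "\<exists>x\<in>carrier R - C. real (card {p \<in> \<Phi>. ev x p \<in> Y}) \<le> (1 - \<eta> / 4) * F"
        using big
      proof
        assume inf: "infinite (carrier R)"
        define C' where "C' = (\<Union>p\<in>\<Phi>. \<Union>y\<in>Y. {x \<in> carrier R. ev x p = y})"
        have "finite C'" unfolding C'_def using \<Phi>(1) Yp hit by (intro finite_UN_I) auto
        with finC inf have "\<not> carrier R \<subseteq> C \<union> C'" by (meson finite_UnI finite_subset)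
        then obtain x where x: "x \<in> carrier R" "x \<notin> C" "x \<notin> C'" by blast
        then have "{p \<in> \<Phi>. ev x p \<in> Y} = {}" by (auto simp: C'_def)
        then have "real (card {p \<in> \<Phi>. ev x p \<in> Y}) = 0" by (simp only: card.empty of_nat_0)
        moreover have "0 \<le> (1 - \<eta> / 4) * F" using \<eta> F1 by simp
        ultimately have "real (card {p \<in> \<Phi>. ev x p \<in> Y}) \<le> (1 - \<eta> / 4) * F" by linarith
        with x show ?thesis by blast
      next
        assume le: "real N * (1 + \<eta>) \<le> real (card (carrier R))"
        define q where "q = real (card (carrier R))"
        have N0: "0 < real N" using F2 F1 FF by (cases "N = 0") auto
        then have "0 < real N * (1 + \<eta>)" using \<eta> by (intro mult_pos_pos) auto
        then have q0: "0 < q" using le by (simp add: q_def)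
        then have fin: "finite (carrier R)" unfolding q_def by (simp add: card_gt_0_iff)
        show ?thesis
        proof (rule ccontr)
          assume "\<not> ?thesis"
          then have many: "(1 - \<eta> / 4) * F \<le> real (card {p \<in> \<Phi>. ev x p \<in> Y})" if "x \<in> carrier R - C" for x
            using that by force
          have "(q - F\<^sup>2) * ((1 - \<eta> / 4) * F) \<le> real (card (carrier R - C)) * ((1 - \<eta> / 4) * F)"
          proof (rule mult_right_mono)
            have "card (carrier R - C) = card (carrier R) - card C"
              using finC by (intro card_Diff_subset) (auto simp: C_def)
            moreover have "card C \<le> card (carrier R)" using fin by (intro card_mono) (auto simp: C_def)
            ultimately show "q - F\<^sup>2 \<le> real (card (carrier R - C))" using cardC by (simp add: q_def of_nat_diff)
          qed (use \<eta> F1 in simp)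
          also have "\<dots> \<le> (\<Sum>x\<in>carrier R - C. real (card {p \<in> \<Phi>. ev x p \<in> Y}))"
            using sum_mono[of "carrier R - C" "\<lambda>_. (1 - \<eta> / 4) * F"] many by simp
          also have "\<dots> \<le> (\<Sum>x\<in>carrier R. real (card {p \<in> \<Phi>. ev x p \<in> Y}))"
            using fin by (intro sum_mono2) auto
          also have "\<dots> = (\<Sum>x\<in>carrier R. \<Sum>p\<in>\<Phi>. \<Sum>y\<in>Y. of_bool (ev x p = y))"
          proof (rule sum.cong[OF refl])
            fix x
            have "(\<Sum>p\<in>\<Phi>. \<Sum>y\<in>Y. of_bool (ev x p = y)) = (\<Sum>p\<in>\<Phi>. if ev x p \<in> Y then 1 else (0::real))"
              using Yp(2) by (intro sum.cong refl) (simp add: of_bool_def)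
            also have "\<dots> = real (card {p \<in> \<Phi>. ev x p \<in> Y})"
              using \<Phi>(1) by (simp add: sum.inter_filter[symmetric])
            finally show "real (card {p \<in> \<Phi>. ev x p \<in> Y}) = (\<Sum>p\<in>\<Phi>. \<Sum>y\<in>Y. of_bool (ev x p = y))" by simp
          qed
          also have "\<dots> = (\<Sum>p\<in>\<Phi>. \<Sum>x\<in>carrier R. \<Sum>y\<in>Y. of_bool (ev x p = y))" by (rule sum.swap)
          also have "\<dots> = (\<Sum>p\<in>\<Phi>. \<Sum>y\<in>Y. \<Sum>x\<in>carrier R. of_bool (ev x p = y))"
            by (intro sum.cong refl sum.swap)
          also have "\<dots> \<le> (\<Sum>p\<in>\<Phi>. \<Sum>y\<in>Y. 1)"
          proof (intro sum_mono)
            fix p y assume "p \<in> \<Phi>" "y \<in> Y"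
            then have "card {x \<in> carrier R. ev x p = y} \<le> 1" using hit Yp(1) by blast
            then show "(\<Sum>x\<in>carrier R. of_bool (ev x p = y) :: real) \<le> 1"
              using fin by (simp add: of_bool_def sum.inter_filter[symmetric])
          qed
          also have "\<dots> = real (card Y) * F" by (simp add: F_def)
          also have "\<dots> \<le> (real N - 1) * F"
          proof (rule mult_right_mono)
            have "real (card Y + card \<Phi>) \<le> real N" using room by (rule of_nat_mono)
            then show "real (card Y) \<le> real N - 1" using F1 by (simp add: F_def)
          qed (use F1 in simp)
          finally have "((q - F\<^sup>2) * (1 - \<eta> / 4)) * F \<le> (real N - 1) * F" by (simp add: mult_ac)
          then have "(q - F\<^sup>2) * (1 - \<eta> / 4) \<le> real N - 1"
            by (rule mult_right_le_imp_le) (use F1 in simp)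
          moreover have "(real N * (1 + \<eta>) - \<eta> * real N / 8) * (1 - \<eta> / 4) \<le> (q - F\<^sup>2) * (1 - \<eta> / 4)"
            using le F2 \<eta> by (intro mult_right_mono) (auto simp: q_def)
          moreover have "real N \<le> (real N * (1 + \<eta>) - \<eta> * real N / 8) * (1 - \<eta> / 4)"
          proof -
            define k where "k = \<eta> / 8"
            have \<eta>k: "\<eta> = 8 * k" by (simp add: k_def)
            have "(real N * (1 + \<eta>) - \<eta> * real N / 8) * (1 - \<eta> / 4) = real N + real N * (k * (5 - 14 * k))"
              unfolding \<eta>k by (simp add: algebra_simps)
            moreover have "0 \<le> real N * (k * (5 - 14 * k))"
              using \<eta> by (intro mult_nonneg_nonneg) (auto simp: k_def)
            ultimately show ?thesis by linarith
          qed
          ultimately show False by linarith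
        qed
      qed
      then obtain x where x: "x \<in> carrier R" "x \<notin> C" and hits: "real (card {p \<in> \<Phi>. ev x p \<in> Y}) \<le> (1 - \<eta> / 4) * F"
        by blast
      have injx: "inj_on (ev x) \<Phi>"
      proof (rule inj_onI, rule ccontr)
        fix p p' assume "p \<in> \<Phi>" "p' \<in> \<Phi>" "ev x p = ev x p'" "p \<noteq> p'"
        then have "x \<in> C" unfolding C_def using x(1) by (intro UN_I[of "(p, p')"]) auto
        with x(2) show False ..
      qed
      have ev_carr: "ev x p \<in> carrier R" if "p \<in> \<Phi>" for p using that \<Phi>(3) x by (auto simp: ev_def)
      define Y' where "Y' = Y \<union> ev x ` \<Phi>"
      have Y'_split: "Y' = Y \<union> ev x ` {p \<in> \<Phi>. ev x p \<notin> Y}" by (auto simp: Y'_def)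
      have cardY': "card Y' = card Y + card {p \<in> \<Phi>. ev x p \<notin> Y}"
      proof -
        have "card (ev x ` {p \<in> \<Phi>. ev x p \<notin> Y}) = card {p \<in> \<Phi>. ev x p \<notin> Y}"
          by (rule card_image) (rule inj_on_subset[OF injx], auto)
        then show ?thesis unfolding Y'_split
          using Yp(2) \<Phi>(1) by (subst card_Un_disjoint) auto
      qed
      have "card {p \<in> \<Phi>. ev x p \<in> Y} + card {p \<in> \<Phi>. ev x p \<notin> Y} = card \<Phi>"
      proof -
        have "{p \<in> \<Phi>. ev x p \<in> Y} \<union> {p \<in> \<Phi>. ev x p \<notin> Y} = \<Phi>" by auto
        then show ?thesis using \<Phi>(1) card_Un_disjoint[of "{p \<in> \<Phi>. ev x p \<in> Y}" "{p \<in> \<Phi>. ev x p \<notin> Y}"]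
          by (metis (no_types, lifting) disjoint_iff finite_Un mem_Collect_eq)
      qed
      then have "real (card {p \<in> \<Phi>. ev x p \<in> Y}) + real (card {p \<in> \<Phi>. ev x p \<notin> Y}) = F"
        by (simp add: F_def flip: of_nat_add)
      with hits have new: "\<eta> / 4 * F \<le> real (card {p \<in> \<Phi>. ev x p \<notin> Y})" by (simp add: algebra_simps)
      have "ok Y'" unfolding ok_def
      proof (intro conjI exI[of _ "Suc m"] ballI)
        show "Y' \<subseteq> carrier R" "finite Y'" using Yp ev_carr \<Phi>(1) by (auto simp: Y'_def)
        have "card {p \<in> \<Phi>. ev x p \<notin> Y} \<le> card \<Phi>" using \<Phi>(1) by (intro card_mono) auto
        with cardY' room show "card Y' \<le> N" by simp
        show "\<eta> / 4 * (real (Suc m) * F) \<le> real (card Y')"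
          using Yp(4) new unfolding cardY' by (simp add: algebra_simps)
        fix r assume r: "r \<in> \<Lambda>"
        obtain a b where ab: "r = (a, b)" "a \<in> carrier R" "b \<in> carrier R" using r \<Lambda>(1) by (cases r) auto
        define B where "B = {(c, e) \<in> \<Phi>. (a \<otimes> c, a \<otimes> e \<oplus> b) \<notin> \<Phi>}"
        have finB: "finite B" by (rule finite_subset[OF _ \<Phi>(1)]) (auto simp: B_def)
        have "bad Y' r \<subseteq> bad Y r \<union> ev x ` B"
        proof
          fix y assume y: "y \<in> bad Y' r"
          then have y': "y \<in> Y'" "a \<otimes> y \<oplus> b \<notin> Y'" by (auto simp: bad_def ab)
          show "y \<in> bad Y r \<union> ev x ` B"
          proof (cases "y \<in> Y")
            case True
            with y' show ?thesis by (auto simp: bad_def ab Y'_def)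
          next
            case False
            then obtain c e where ce: "(c, e) \<in> \<Phi>" "y = ev x (c, e)" using y' by (auto simp: Y'_def)
            have cc: "c \<in> carrier R" "e \<in> carrier R" using ce \<Phi>(3) by auto
            have "a \<otimes> y \<oplus> b = ev x (a \<otimes> c, a \<otimes> e \<oplus> b)"
              using cc ab x by (simp add: ce ev_def r_distr m_assoc a_assoc)
            then have "(a \<otimes> c, a \<otimes> e \<oplus> b) \<notin> \<Phi>" using y' by (auto simp: Y'_def)
            with ce show ?thesis by (auto simp: B_def)
          qed
        qed
        moreover have "finite (bad Y r)" using Yp(2) by (simp add: bad_def)
        ultimately have "card (bad Y' r) \<le> card (bad Y r) + card (ev x ` B)"
          using finB by (meson card_Un_le card_mono finite_UnI finite_imageI le_trans)
        also have "\<dots> \<le> card (bad Y r) + card B" using finB by (simp add: card_image_le)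
        finally have "real (card (bad Y' r)) \<le> real (card (bad Y r)) + real (card B)"
          by (simp flip: of_nat_add)
        moreover have "real (card B) \<le> \<epsilon> * F" using \<Lambda>(2)[of a b] r ab by (simp add: B_def F_def)
        ultimately show "real (card (bad Y' r)) \<le> real (Suc m) * (\<epsilon> * F)"
          using Yp(5)[OF r] by (simp add: algebra_simps)
      qed
      then have "card Y' \<le> card Y" by (rule Y(2))
      then have "real (card {p \<in> \<Phi>. ev x p \<notin> Y}) \<le> 0" using cardY' by simp
      moreover have "0 < \<eta> / 4 * F" using \<eta> F1 by simp
      ultimately show False using new by simp
    qed
    \<comment> \<open>Fewer than \<open>card \<Phi>\<close> points are missing. Arbitrary ones may
      be added, since \<open>F\<close> is small against \<open>\<eta> * N\<close>.\<close>
    obtain E where E: "E \<subseteq> carrier R - Y" "card E = N - card Y" and finE: "finite E"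
    proof (cases "finite (carrier R)")
      case True
      then have "N - card Y \<le> card (carrier R - Y)"
        using N Yp by (simp add: card_Diff_subset)
      then obtain E where "E \<subseteq> carrier R - Y" "card E = N - card Y" by (meson obtain_subset_with_card_n)
      then show thesis using that True by (meson finite_Diff finite_subset)
    next
      case False
      then have "infinite (carrier R - Y)" using Yp(2) by simp
      then obtain E where "finite E" "card E = N - card Y" "E \<subseteq> carrier R - Y"
        using infinite_arbitrarily_large by blast
      then show thesis using that by blast
    qed
    define Y' where "Y' = Y \<union> E"
    have cardY': "card Y' = N"
      unfolding Y'_def using Yp E finE by (subst card_Un_disjoint) auto
    have "real (card (bad Y' p)) \<le> \<eta> * real N" if p: "p \<in> \<Lambda>" for p
    proof -
      have "bad Y' p \<subseteq> bad Y p \<union> E" by (auto simp: bad_def Y'_def)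
      then have "card (bad Y' p) \<le> card (bad Y p \<union> E)"
        using Yp(2) finE by (intro card_mono) (auto simp: bad_def)
      also have "\<dots> \<le> card (bad Y p) + card E" by (rule card_Un_le)
      also have "\<dots> \<le> card (bad Y p) + card \<Phi>" using E(2) full Yp(3) by simp
      finally have "real (card (bad Y' p)) \<le> real (card (bad Y p)) + F"
        by (simp add: F_def flip: of_nat_add)
      also have "\<dots> \<le> real m * (\<epsilon> * F) + F" using Yp(5)[OF p] by simp
      \<comment> \<open>The bound on \<open>m\<close> turns \<open>\<eta>^2 / 8\<close> into a loss
        of at most \<open>\<eta> * N / 2\<close>; the remaining \<open>F\<close> is at most
        \<open>\<eta> * N / 8\<close>.\<close>
      also have "real m * (\<epsilon> * F) \<le> real m * (\<eta>\<^sup>2 / 8 * F)"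
        using \<epsilon> F1 by (intro mult_left_mono mult_right_mono) (auto simp: \<eta>_def)
      also have "\<dots> = \<eta> / 2 * (\<eta> / 4 * (real m * F))" by (simp add: power2_eq_square)
      also have "\<dots> \<le> \<eta> / 2 * real N" using Yp(3,4) \<eta> by (intro mult_left_mono) auto
      finally show ?thesis using F2 FF F1 by simp
    qed
    moreover have "Y' \<subseteq> carrier R" "finite Y'" using Yp E finE by (auto simp: Y'_def)
    ultimately show ?thesis using cardY' by blast
  qed
  then obtain Y where Y: "Y \<subseteq> carrier R" "finite Y" "card Y = N"
    "\<And>p. p \<in> \<Lambda> \<Longrightarrow> real (card (bad Y p)) \<le> \<eta> * real N" by blast
  show thesis
  proof (rule that[OF Y(1-3)])
    fix a b assume ab: "(a, b) \<in> \<Lambda>"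
    have "{y \<in> Y. a \<otimes> y \<oplus> b \<in> Y} = Y - bad Y (a, b)" by (auto simp: bad_def)
    moreover have "card (Y - bad Y (a, b)) = card Y - card (bad Y (a, b))"
      using Y(2) by (intro card_Diff_subset) (auto simp: bad_def)
    moreover have "card (bad Y (a, b)) \<le> card Y" using Y(2) by (intro card_mono) (auto simp: bad_def)
    ultimately have "real (card {y \<in> Y. a \<otimes> y \<oplus> b \<in> Y}) = real N - real (card (bad Y (a, b)))"
      using Y(3) by (simp add: of_nat_diff)
    with Y(4)[OF ab] show "\<alpha> * real N \<le> real (card {y \<in> Y. a \<otimes> y \<oplus> b \<in> Y})"
      by (simp add: \<eta>_def algebra_simps)
  qed
qed

end

section \<open>Rich lines\<close>

lemma RLGP_ge:
  assumes "Y \<subseteq> carrier F" "finite Y" "card Y = N" "0 < N" "0 < \<alpha>"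
    and "infinite (carrier F) \<or> N \<le> card (carrier F)" and "L \<in> rich_gp_families F Y \<alpha>"
  shows "card L \<le> RLGP F N \<alpha>"
proof -
  have ne: "Y \<noteq> {}" using assms by auto
  have "card L \<le> RLGP_set F Y \<alpha>"
    unfolding RLGP_set_def
    by (intro Max_ge RLGP_set_Max(1) imageI) (use assms ne in auto)
  also have "\<dots> \<le> RLGP F N \<alpha>"
    unfolding RLGP_def
    by (intro Max_ge RLGP_Max(1) imageI) (use assms in auto)
  finally show ?thesis .
qed

lemma RLGP_attained:
  assumes "0 < N" "0 < \<alpha>" "infinite (carrier F) \<or> N \<le> card (carrier F)"
  obtains Y L where "Y \<subseteq> carrier F" "finite Y" "card Y = N" "L \<in> rich_gp_families F Y \<alpha>"
    "card L = RLGP F N \<alpha>" "RLGP F N \<alpha> \<le> 2 * N\<^sup>2"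
proof -
  have "RLGP F N \<alpha> \<in> (\<lambda>Y. RLGP_set F Y \<alpha>) ` {Y. Y \<subseteq> carrier F \<and> finite Y \<and> card Y = N}"
    unfolding RLGP_def by (rule Max_in[OF RLGP_Max]) (use assms in auto)
  then obtain Y where Y: "Y \<subseteq> carrier F" "finite Y" "card Y = N" "RLGP F N \<alpha> = RLGP_set F Y \<alpha>" by auto
  then have ne: "Y \<noteq> {}" using assms by auto
  have "RLGP_set F Y \<alpha> \<in> card ` rich_gp_families F Y \<alpha>"
    unfolding RLGP_set_def by (rule Max_in[OF RLGP_set_Max(1,2)]) (use Y ne assms in auto)
  then obtain L where "L \<in> rich_gp_families F Y \<alpha>" "card L = RLGP F N \<alpha>" using Y(4) by auto
  with Y that RLGP_set_Max(3)[OF Y(2) ne assms(2), of F] show thesis by simp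
qed

context field begin

definition line :: "'a \<Rightarrow> 'a \<Rightarrow> ('a \<times> 'a) set" where
  "line c e = {(x, y). x \<in> carrier R \<and> y \<in> carrier R \<and> y = c \<otimes> x \<oplus> e}"

lemma line_in_affine_lines:
  assumes "c \<in> carrier R" "e \<in> carrier R"
  shows "line c e \<in> affine_lines R"
proof -
  have eq: "y = c \<otimes> x \<oplus> e \<longleftrightarrow> \<ominus> c \<otimes> x \<oplus> \<one> \<otimes> y = e" if "x \<in> carrier R" "y \<in> carrier R" for x y
  proof
    assume y: "y = c \<otimes> x \<oplus> e"
    show "\<ominus> c \<otimes> x \<oplus> \<one> \<otimes> y = e" unfolding y using that assms by algebra
  next
    assume e: "\<ominus> c \<otimes> x \<oplus> \<one> \<otimes> y = e"
    have "y = c \<otimes> x \<oplus> (\<ominus> c \<otimes> x \<oplus> \<one> \<otimes> y)" using that assms by algebra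
    then show "y = c \<otimes> x \<oplus> e" unfolding e .
  qed
  then have "line c e = {(x, y). x \<in> carrier R \<and> y \<in> carrier R \<and> \<ominus> c \<otimes> x \<oplus> \<one> \<otimes> y = e}"
    unfolding line_def using eq by (intro Collect_cong) (simp only: split_beta, blast)
  then show ?thesis
    unfolding affine_lines_def using assms by (intro CollectI exI[of _ "\<ominus> c"] exI[of _ \<one>] exI[of _ e]) auto
qed

lemma card_line_inter:
  assumes "Y \<subseteq> carrier R"
  shows "card (line c e \<inter> Y \<times> Y) = card {y \<in> Y. c \<otimes> y \<oplus> e \<in> Y}"
proof -
  have "line c e \<inter> Y \<times> Y = (\<lambda>y. (y, c \<otimes> y \<oplus> e)) ` {y \<in> Y. c \<otimes> y \<oplus> e \<in> Y}"
    using assms by (auto simp: line_def)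
  then show ?thesis by (simp add: card_image inj_on_def)
qed

text \<open>The vertical and the horizontal line through one point of \<open>Y \<times> Y\<close>
  always qualify. The resulting positive lower bound for the logarithm lets constants absorb the
  small values of \<open>N\<close>.\<close>

lemma two_le_RLGP:
  assumes N: "0 < N" "infinite (carrier R) \<or> N \<le> card (carrier R)" and \<alpha>: "0 < \<alpha>" "\<alpha> < 1"
  shows "2 \<le> RLGP R N \<alpha>"
proof -
  obtain Y where Y: "Y \<subseteq> carrier R" "card Y = N" by (rule subset_of_card[OF N(2)])
  have finY: "finite Y" using Y(2) N(1) by (metis card.infinite less_irrefl)
  obtain y0 where y0: "y0 \<in> Y" using Y N by fastforce
  have y0c: "y0 \<in> carrier R" using y0 Y by auto
  define l where "l = {(x, y). x \<in> carrier R \<and> y \<in> carrier R \<and> \<one> \<otimes> x \<oplus> \<zero> \<otimes> y = y0}"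
  define m where "m = {(x, y). x \<in> carrier R \<and> y \<in> carrier R \<and> \<zero> \<otimes> x \<oplus> \<one> \<otimes> y = y0}"
  have l: "l = {y0} \<times> carrier R" and m: "m = carrier R \<times> {y0}"
    using y0c by (auto simp: l_def m_def)
  have "l \<in> affine_lines R" unfolding affine_lines_def l_def using y0c
    by (intro CollectI exI[of _ \<one>] exI[of _ \<zero>] exI[of _ y0]) auto
  moreover have "m \<in> affine_lines R" unfolding affine_lines_def m_def using y0c
    by (intro CollectI exI[of _ \<zero>] exI[of _ \<one>] exI[of _ y0]) auto
  moreover have "rich Y \<alpha> l" "rich Y \<alpha> m"
  proof -
    have "l \<inter> Y \<times> Y = {y0} \<times> Y" "m \<inter> Y \<times> Y = Y \<times> {y0}" using y0 Y by (auto simp: l m)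
    then have "card (l \<inter> Y \<times> Y) = card Y" "card (m \<inter> Y \<times> Y) = card Y"
      by (simp_all add: card_cartesian_product)
    then show "rich Y \<alpha> l" "rich Y \<alpha> m" using \<alpha> by (simp_all add: rich_def mult_left_le_one_le)
  qed
  moreover have "general_position {l, m}"
  proof -
    have "(y0, y0) \<in> l \<inter> m" using y0c by (simp add: l m)
    then show ?thesis unfolding general_position_def by blast
  qed
  ultimately have fam: "{l, m} \<in> rich_gp_families R Y \<alpha>" by (simp add: rich_gp_families_def)
  have "l \<noteq> m"
  proof
    assume "l = m"
    moreover have "(y0, \<zero>) \<in> l" "(y0, \<one>) \<in> l" using y0c by (auto simp: l)
    ultimately have "\<zero> = \<one>" by (auto simp: m)
    then show False by simp
  qed
  with RLGP_ge[OF Y(1) finY Y(2) N(1) \<alpha>(1) N(2) fam] show ?thesis by simp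
qed

end

section \<open>The naturals in a field and the lower bound\<close>

text \<open>One setting for both fields: \<open>\<iota>\<close> is the canonical map from the
  naturals, which modulo \<open>p\<close> is injective only below \<open>p\<close>. The construction
  must therefore keep all naturals that are recovered from their images below
  \<open>N\<close>.\<close>

locale field_nat = field R for R (structure) +
  fixes \<iota> :: "nat \<Rightarrow> 'a" and N :: nat
  assumes \<iota>_closed [simp]: "\<iota> n \<in> carrier R"
    and \<iota>_0: "\<iota> 0 = \<zero>" and \<iota>_add: "\<iota> (m + n) = \<iota> m \<oplus> \<iota> n" and \<iota>_mult: "\<iota> (m * n) = \<iota> m \<otimes> \<iota> n"
    and \<iota>_inj: "inj_on \<iota> {..<N}"
    and N_le: "infinite (carrier R) \<or> N \<le> card (carrier R)"
begin

lemma \<iota>_nonzero: "0 < n \<Longrightarrow> n < N \<Longrightarrow> \<iota> n \<noteq> \<zero>"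
  using inj_onD[OF \<iota>_inj, of n 0] \<iota>_0 by auto

text \<open>The lines of \<open>a\<close> and \<open>b\<close> meet where
  \<open>x = - (a + b) * Q\<close>. With \<open>a\<close> fixed, this abscissa determines
  \<open>b\<close>, so no point lies on three lines. The products \<open>a * a * Q\<close> may
  exceed \<open>N\<close>, because only \<open>\<iota> a\<close> and \<open>\<iota> Q\<close> have
  to be recognised.\<close>

lemma general_position_lines:
  assumes A: "A \<subseteq> {..<N}" and Q: "0 < Q" "Q < N"
  shows "general_position ((\<lambda>a. line (\<iota> a) (\<iota> (a * a * Q))) ` A)"
proof -
  define ln where "ln a = line (\<iota> a) (\<iota> (a * a * Q))" for a
  have inj: "a = b" if "a \<in> A" "b \<in> A" "\<iota> a = \<iota> b" for a b
    using inj_onD[OF \<iota>_inj that(3)] that A by auto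
  have meet: "ln a \<inter> ln b \<noteq> {}" if ab: "a \<in> A" "b \<in> A" "a \<noteq> b" for a b
  proof -
    have "\<iota> a \<noteq> \<iota> b" using inj ab by blast
    then obtain x where "x \<in> carrier R" "\<iota> a \<otimes> x \<oplus> \<iota> (a * a * Q) = \<iota> b \<otimes> x \<oplus> \<iota> (b * b * Q)"
      using affine_agree_exists[of "\<iota> a" "\<iota> (a * a * Q)" "\<iota> b" "\<iota> (b * b * Q)"] by auto
    then have "(x, \<iota> a \<otimes> x \<oplus> \<iota> (a * a * Q)) \<in> ln a \<inter> ln b" by (simp add: ln_def line_def)
    then show ?thesis by blast
  qed
  have root: "x \<oplus> (\<iota> a \<oplus> \<iota> b) \<otimes> \<iota> Q = \<zero>"
    if ab: "a \<in> A" "b \<in> A" "a \<noteq> b" and xy: "(x, y) \<in> ln a" "(x, y) \<in> ln b" for a b x y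
  proof -
    have x: "x \<in> carrier R" using xy by (simp add: ln_def line_def)
    have eq: "\<iota> a \<otimes> x \<oplus> \<iota> a \<otimes> \<iota> a \<otimes> \<iota> Q = \<iota> b \<otimes> x \<oplus> \<iota> b \<otimes> \<iota> b \<otimes> \<iota> Q"
      using xy by (simp add: ln_def line_def \<iota>_mult)
    have c: "\<iota> a \<in> carrier R" "\<iota> b \<in> carrier R" "\<iota> Q \<in> carrier R" by simp_all
    have "(\<iota> a \<ominus> \<iota> b) \<otimes> (x \<oplus> (\<iota> a \<oplus> \<iota> b) \<otimes> \<iota> Q)
        = (\<iota> a \<otimes> x \<oplus> \<iota> a \<otimes> \<iota> a \<otimes> \<iota> Q) \<ominus> (\<iota> b \<otimes> x \<oplus> \<iota> b \<otimes> \<iota> b \<otimes> \<iota> Q)"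
      using x c by algebra
    also have "\<dots> = \<zero>" unfolding eq using x by simp
    finally have "\<iota> a \<ominus> \<iota> b = \<zero> \<or> x \<oplus> (\<iota> a \<oplus> \<iota> b) \<otimes> \<iota> Q = \<zero>" using x integral_iff by simp
    moreover have "\<iota> a \<ominus> \<iota> b \<noteq> \<zero>" using inj[OF ab(1,2)] ab(3) by (auto simp: r_right_minus_eq)
    ultimately show ?thesis by blast
  qed
  have triple: "ln a \<inter> ln b \<inter> ln c = {}"
    if abc: "a \<in> A" "b \<in> A" "c \<in> A" "a \<noteq> b" "a \<noteq> c" "b \<noteq> c" for a b c
  proof (rule ccontr)
    assume "ln a \<inter> ln b \<inter> ln c \<noteq> {}"
    then obtain x y where xy: "(x, y) \<in> ln a" "(x, y) \<in> ln b" "(x, y) \<in> ln c" by auto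
    have x: "x \<in> carrier R" using xy by (simp add: ln_def line_def)
    have "x \<oplus> (\<iota> a \<oplus> \<iota> b) \<otimes> \<iota> Q = x \<oplus> (\<iota> a \<oplus> \<iota> c) \<otimes> \<iota> Q"
      using root[of a b x y] root[of a c x y] abc xy by simp
    then have "(\<iota> a \<oplus> \<iota> b) \<otimes> \<iota> Q = (\<iota> a \<oplus> \<iota> c) \<otimes> \<iota> Q"
      using x add.l_cancel[of x "(\<iota> a \<oplus> \<iota> b) \<otimes> \<iota> Q" "(\<iota> a \<oplus> \<iota> c) \<otimes> \<iota> Q"] by simp
    then have "\<iota> a \<oplus> \<iota> b = \<iota> a \<oplus> \<iota> c"
      using m_rcancel[OF \<iota>_nonzero[OF Q] \<iota>_closed, of "\<iota> a \<oplus> \<iota> b" "\<iota> a \<oplus> \<iota> c"] by simp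
    then have "\<iota> b = \<iota> c" using add.l_cancel[of "\<iota> a" "\<iota> b" "\<iota> c"] by simp
    with inj abc show False by blast
  qed
  show ?thesis
    unfolding general_position_def ln_def[symmetric]
  proof (intro conjI ballI impI)
    fix l m assume "l \<in> ln ` A" "m \<in> ln ` A" "l \<noteq> m"
    then obtain a b where ab: "a \<in> A" "b \<in> A" "l = ln a" "m = ln b" "ln a \<noteq> ln b" by blast
    then have "a \<noteq> b" by blast
    with ab meet show "l \<inter> m \<noteq> {}" by simp
  next
    fix l m n assume "l \<in> ln ` A" "m \<in> ln ` A" "n \<in> ln ` A" and ne: "l \<noteq> m \<and> l \<noteq> n \<and> m \<noteq> n"
    then obtain a b c where abc: "a \<in> A" "b \<in> A" "c \<in> A" "l = ln a" "m = ln b" "n = ln c" by blast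
    with ne have "a \<noteq> b" "a \<noteq> c" "b \<noteq> c" by auto
    with abc triple show "l \<inter> m \<inter> n = {}" by simp
  qed
qed

text \<open>Composing \<open>y = a x + a^2 Q\<close> with \<open>x \<mapsto> u (x + n)\<close> gives
  \<open>x \<mapsto> a u (x + n + a k)\<close>, where \<open>Q = u k\<close>; this is the reason for
  the constant term. The composition leaves \<open>\<Phi>\<close> only if \<open>a * u\<close>
  leaves \<open>D\<close> or \<open>n + a * k\<close> leaves the interval. Taking
  \<open>T = M * d\<close> exponents per prime makes the former happen for a proportion at most
  \<open>1 / M\<close>, and an interval of length \<open>M * H\<close>, where \<open>H\<close>
  bounds all shifts \<open>a * k\<close>, does the same for the latter. The total
  \<open>2 / M\<close> is what \<open>almost_invariant_set\<close> tolerates.\<close>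

lemma RLGP_ge_power_2:
  fixes \<alpha> :: real and d M :: nat
  defines "H \<equiv> ((9 * d\<^sup>2) ^ d) ^ (M * d)"
  assumes \<alpha>: "0 < \<alpha>" "\<alpha> < 1" and d: "1 \<le> d" and M: "2 \<le> M" "16 \<le> (1 - \<alpha>)\<^sup>2 * real M"
    and small: "8 * (real ((M * d) ^ d * (M * H)))\<^sup>2 \<le> (1 - \<alpha>) * real N"
  shows "2 ^ d \<le> RLGP R N \<alpha>"
proof -
  define T where "T = M * d"
  have T2: "2 \<le> T" using M(1) d mult_le_mono[of 2 M 1 d] by (simp add: T_def)
  obtain A D Q where A: "finite A" "card A = 2 ^ d" "\<And>a. a \<in> A \<Longrightarrow> 0 < a \<and> a \<le> (9 * d\<^sup>2) ^ d"
    and D: "finite D" "card D = T ^ d" "\<And>u. u \<in> D \<Longrightarrow> 0 < u \<and> u dvd Q"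
    and Q: "0 < Q" "Q \<le> ((9 * d\<^sup>2) ^ d) ^ (T - 1)"
    and shift: "\<And>a. a \<in> A \<Longrightarrow> (T - 1) ^ d \<le> card {u \<in> D. a * u \<in> D}"
    using smooth_numbers[OF d T2] by blast
  define B where "B = (9 * d\<^sup>2) ^ d"
  have B1: "1 \<le> B" using d by (simp add: B_def)
  \<comment> \<open>The bound for \<open>a\<close> times the bound for \<open>Q\<close>.\<close>
  have H: "H = B * B ^ (T - 1)"
  proof -
    have "Suc (T - 1) = M * d" using T2 by (simp add: T_def)
    then show ?thesis by (simp add: H_def B_def flip: power_Suc)
  qed
  have QB: "Q \<le> B ^ (T - 1)" using Q(2) by (simp add: B_def)
  have aQ: "a * Q \<le> H" if "a \<in> A" for a
    unfolding H using A(3)[OF that] QB by (intro mult_le_mono) (auto simp: B_def)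
  have BH: "B \<le> H" "Q \<le> H" "1 \<le> H"
  proof -
    have "1 \<le> B ^ (T - 1)" using B1 by simp
    then show "B \<le> H" unfolding H using mult_le_mono2[of 1 "B ^ (T - 1)" B] by simp
    then show "1 \<le> H" using B1 by simp
    show "Q \<le> H" unfolding H using QB B1 mult_le_mono[of 1 B Q "B ^ (T - 1)"] by simp
  qed
  define K where "K = M * H"
  define F where "F = T ^ d * K"
  have K0: "0 < K" using M(1) BH(3) by (simp add: K_def)
  have HK: "H \<le> K" using M(1) mult_le_mono1[of 1 M H] by (simp add: K_def)
  have small': "8 * (real F)\<^sup>2 \<le> (1 - \<alpha>) * real N" using small by (simp add: F_def K_def T_def)
  have KF: "K \<le> F" using T2 mult_le_mono1[of 1 "T ^ d" K] by (simp add: F_def)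
  have FN: "F < N"
  proof -
    have F1: "1 \<le> real F" using K0 KF by simp
    then have "real F < 8 * (real F)\<^sup>2" by (simp add: power2_eq_square)
    also have "\<dots> \<le> (1 - \<alpha>) * real N" by (rule small')
    also have "\<dots> \<le> 1 * real N" using \<alpha> by (intro mult_right_mono) auto
    finally show ?thesis by simp
  qed
  have KN: "K < N" "Q < N" using KF FN BH HK by auto
  have AN: "a < N" if "a \<in> A" for a using A(3)[OF that] BH HK KN by (auto simp: B_def)
  have DN: "u < N" if "u \<in> D" for u
    using D(3)[OF that] Q(1) KN dvd_imp_le[of u Q] by fastforce
  \<comment> \<open>The pair consists of the slope and the constant term of the map
    \<open>x \<mapsto> u (x + n)\<close>.\<close>
  define \<Phi> where "\<Phi> = (\<lambda>(u, n). (\<iota> u, \<iota> (u * n))) ` (D \<times> {..<K})"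
  have inj\<Phi>: "inj_on (\<lambda>(u, n). (\<iota> u, \<iota> (u * n))) (D \<times> {..<K})"
  proof (rule inj_onI, clarify)
    fix u n u' n' assume h: "u \<in> D" "u' \<in> D" "n < K" "n' < K" "\<iota> u = \<iota> u'" "\<iota> (u * n) = \<iota> (u' * n')"
    have u: "u = u'" using inj_onD[OF \<iota>_inj h(5)] h DN by simp
    have "\<iota> u \<otimes> \<iota> n = \<iota> u \<otimes> \<iota> n'" using h(6) u by (simp add: \<iota>_mult)
    then have "\<iota> n = \<iota> n'"
      using m_lcancel[of "\<iota> u" "\<iota> n" "\<iota> n'"] \<iota>_nonzero[of u] D(3) DN h by simp
    then have "n = n'" using inj_onD[OF \<iota>_inj, of n n'] h KN by simp
    with u show "u = u' \<and> n = n'" by simp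
  qed
  have card\<Phi>: "card \<Phi> = F"
    unfolding \<Phi>_def card_image[OF inj\<Phi>] by (simp add: F_def D(2) card_cartesian_product)
  have fin\<Phi>: "finite \<Phi>" using D(1) by (simp add: \<Phi>_def)
  define \<Lambda> where "\<Lambda> = (\<lambda>a. (\<iota> a, \<iota> (a * a * Q))) ` A"
  have inv: "real (card {(c, e) \<in> \<Phi>. (\<iota> a \<otimes> c, \<iota> a \<otimes> e \<oplus> \<iota> (a * a * Q)) \<notin> \<Phi>}) \<le> 2 / real M * real (card \<Phi>)"
    if a: "a \<in> A" for a
  proof -
    \<comment> \<open>The possible exceptions: \<open>u\<close> leaves \<open>D\<close>, or
      \<open>n\<close> lies in the last stretch of length \<open>H\<close>.\<close>
    define W where "W = {u \<in> D. a * u \<notin> D} \<times> {..<K} \<union> D \<times> {K - H..<K}"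
    have "{(c, e) \<in> \<Phi>. (\<iota> a \<otimes> c, \<iota> a \<otimes> e \<oplus> \<iota> (a * a * Q)) \<notin> \<Phi>} \<subseteq> (\<lambda>(u, n). (\<iota> u, \<iota> (u * n))) ` W"
    proof clarify
      fix c e assume ce: "(c, e) \<in> \<Phi>" "(\<iota> a \<otimes> c, \<iota> a \<otimes> e \<oplus> \<iota> (a * a * Q)) \<notin> \<Phi>"
      then obtain u n where un: "u \<in> D" "n < K" "c = \<iota> u" "e = \<iota> (u * n)" by (auto simp: \<Phi>_def)
      obtain k where k: "Q = u * k" using D(3)[OF un(1)] by auto
      have uk: "k \<le> Q" using D(3)[OF un(1)] k by simp
      have "\<not> (a * u \<in> D \<and> n + a * k < K)"
      proof
        assume h: "a * u \<in> D \<and> n + a * k < K"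
        have "a * (u * n) + a * a * Q = a * u * (n + a * k)" by (simp add: k algebra_simps)
        then have "(\<iota> a \<otimes> c, \<iota> a \<otimes> e \<oplus> \<iota> (a * a * Q)) = (\<iota> (a * u), \<iota> (a * u * (n + a * k)))"
          by (simp add: un \<iota>_mult[symmetric] \<iota>_add[symmetric])
        also have "\<dots> \<in> \<Phi>" unfolding \<Phi>_def using h by (intro image_eqI[of _ _ "(a * u, n + a * k)"]) auto
        finally show False using ce(2) by simp
      qed
      moreover have "a * k \<le> H" using aQ[OF a] uk by (meson le_trans mult_le_mono2)
      ultimately have "(u, n) \<in> W" using un by (auto simp: W_def)
      then show "(c, e) \<in> (\<lambda>(u, n). (\<iota> u, \<iota> (u * n))) ` W"
        using un by (intro image_eqI[of _ _ "(u, n)"]) auto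
    qed
    moreover have finW: "finite W" using D(1) by (simp add: W_def)
    ultimately have "card {(c, e) \<in> \<Phi>. (\<iota> a \<otimes> c, \<iota> a \<otimes> e \<oplus> \<iota> (a * a * Q)) \<notin> \<Phi>} \<le> card W"
      by (meson card_image_le card_mono finite_imageI le_trans)
    also have "\<dots> \<le> card ({u \<in> D. a * u \<notin> D} \<times> {..<K}) + card (D \<times> {K - H..<K})"
      unfolding W_def by (rule card_Un_le)
    also have "\<dots> = card {u \<in> D. a * u \<notin> D} * K + T ^ d * H"
      using HK by (simp add: card_cartesian_product D(2))
    finally have "real (card {(c, e) \<in> \<Phi>. (\<iota> a \<otimes> c, \<iota> a \<otimes> e \<oplus> \<iota> (a * a * Q)) \<notin> \<Phi>})
        \<le> real (card {u \<in> D. a * u \<notin> D}) * real K + real (T ^ d) * real H"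
      by (simp only: of_nat_add of_nat_mult of_nat_le_iff flip: of_nat_mult of_nat_add)
    also have "real (card {u \<in> D. a * u \<notin> D}) \<le> real (T ^ d) / real M"
    proof -
      have "{u \<in> D. a * u \<in> D} \<union> {u \<in> D. a * u \<notin> D} = D" by auto
      then have "card {u \<in> D. a * u \<in> D} + card {u \<in> D. a * u \<notin> D} = T ^ d"
        using D(1) card_Un_disjoint[of "{u \<in> D. a * u \<in> D}" "{u \<in> D. a * u \<notin> D}"]
        unfolding D(2)[symmetric] by (metis (no_types, lifting) disjoint_iff finite_Un mem_Collect_eq)
      then have "real (card {u \<in> D. a * u \<notin> D}) \<le> real (T ^ d) - real ((T - 1) ^ d)"
        using shift[OF a] by linarith
      \<comment> \<open>Bernoulli's inequality bounds \<open>1 - (1 - 1 / T) ^ d\<close> by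
        \<open>d / T = 1 / M\<close>.\<close>
      also have "real ((T - 1) ^ d) = real T ^ d * (1 + (- 1 / real T)) ^ d"
        using T2 by (simp add: power_mult_distrib[symmetric] of_nat_diff algebra_simps)
      also have "real (T ^ d) - real T ^ d * (1 + (- 1 / real T)) ^ d \<le> real (T ^ d) - real T ^ d * (1 + real d * (- 1 / real T))"
        using T2 by (intro diff_left_mono mult_left_mono Bernoulli_inequality) auto
      also have "\<dots> = real T ^ d * (real d / real T)" by (simp add: right_diff_distrib)
      also have "real d / real T = 1 / real M" using d M(1) by (simp add: T_def)
      also have "real T ^ d * (1 / real M) = real (T ^ d) / real M" by simp
      finally show ?thesis .
    qed
    also have "real (T ^ d) / real M * real K + real (T ^ d) * real H = 2 / real M * real (card \<Phi>)"
      using M(1) unfolding card\<Phi> by (simp add: F_def K_def field_simps)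
    finally show ?thesis by (simp add: mult_right_mono)
  qed
  obtain Y where Y: "Y \<subseteq> carrier R" "finite Y" "card Y = N"
    "\<And>a b. (a, b) \<in> \<Lambda> \<Longrightarrow> \<alpha> * real N \<le> real (card {y \<in> Y. a \<otimes> y \<oplus> b \<in> Y})"
  proof (rule almost_invariant_set[OF \<alpha> N_le fin\<Phi>, of \<Lambda> "2 / real M"])
    show "\<Phi> \<noteq> {}" using card\<Phi> KF K0 by auto
    show "\<Phi> \<subseteq> (carrier R - {\<zero>}) \<times> carrier R"
      using D(3) DN \<iota>_nonzero by (auto simp: \<Phi>_def)
    show "8 * (real (card \<Phi>))\<^sup>2 \<le> (1 - \<alpha>) * real N" using small' by (simp add: card\<Phi>)
    show "\<Lambda> \<subseteq> (carrier R - {\<zero>}) \<times> carrier R"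
      using A(3) AN \<iota>_nonzero by (auto simp: \<Lambda>_def)
    show "real (card {(c, e) \<in> \<Phi>. (a \<otimes> c, a \<otimes> e \<oplus> b) \<notin> \<Phi>}) \<le> 2 / real M * real (card \<Phi>)" if "(a, b) \<in> \<Lambda>" for a b
      using that inv by (auto simp: \<Lambda>_def)
    show "2 / real M \<le> (1 - \<alpha>)\<^sup>2 / 8" using M by (simp add: field_simps)
  qed blast
  define L where "L = (\<lambda>a. line (\<iota> a) (\<iota> (a * a * Q))) ` A"
  have "card L = card A" unfolding L_def
  proof (rule card_image, rule inj_onI)
    fix a b assume ab: "a \<in> A" "b \<in> A" "line (\<iota> a) (\<iota> (a * a * Q)) = line (\<iota> b) (\<iota> (b * b * Q))"
    have "(\<zero>, \<iota> (a * a * Q)) \<in> line (\<iota> a) (\<iota> (a * a * Q))"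
      "(\<one>, \<iota> a \<oplus> \<iota> (a * a * Q)) \<in> line (\<iota> a) (\<iota> (a * a * Q))" by (simp_all add: line_def)
    then have "\<iota> (a * a * Q) = \<iota> (b * b * Q)" "\<iota> a \<oplus> \<iota> (a * a * Q) = \<iota> b \<oplus> \<iota> (b * b * Q)"
      unfolding ab(3) by (simp_all add: line_def)
    then have "\<iota> a = \<iota> b" by simp
    then show "a = b" using inj_onD[OF \<iota>_inj] ab AN by simp
  qed
  moreover have "L \<in> rich_gp_families R Y \<alpha>"
    unfolding rich_gp_families_def
  proof (intro CollectI conjI ballI)
    show "L \<subseteq> affine_lines R" using line_in_affine_lines by (auto simp: L_def)
    show "finite L" using A(1) by (simp add: L_def)
    show "general_position L" unfolding L_def
      by (rule general_position_lines) (use AN Q KN in auto)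
    fix l assume "l \<in> L"
    then obtain a where a: "a \<in> A" "l = line (\<iota> a) (\<iota> (a * a * Q))" by (auto simp: L_def)
    then have "(\<iota> a, \<iota> (a * a * Q)) \<in> \<Lambda>" by (auto simp: \<Lambda>_def)
    from Y(4)[OF this] show "rich Y \<alpha> l"
      unfolding rich_def a(2) card_line_inter[OF Y(1)] Y(3) by simp
  qed
  ultimately show ?thesis
    using RLGP_ge[OF Y(1-3) _ \<alpha>(1) N_le, of L] FN by (simp add: A(2))
qed

end

section \<open>Lines as graphs of affine maps and the upper bound\<close>

context field begin

definition graph :: "'a bijection \<Rightarrow> ('a \<times> 'a) set" where
  "graph f = {(x, y). x \<in> carrier R \<and> y = app f x}"

lemma graph_affine:
  assumes "c \<in> carrier R" "c \<noteq> \<zero>" "e \<in> carrier R"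
  shows "graph (affine c e) = line c e"
  using assms by (auto simp: graph_def line_def app_affine aff_fun_def)

lemma inj_on_graph: "inj_on graph affines"
proof (rule inj_onI)
  fix f g assume fg: "f \<in> affines" "g \<in> affines" "graph f = graph g"
  show "f = g"
  proof (rule bijection_eqI)
    fix x
    show "app f x = app g x"
    proof (cases "x \<in> carrier R")
      case True
      then have "(x, app f x) \<in> graph f" by (simp add: graph_def)
      then show ?thesis unfolding fg(3) by (simp add: graph_def)
    next
      case False
      from fg(1) obtain a b where "a \<in> carrier R" "a \<noteq> \<zero>" "b \<in> carrier R" "f = affine a b"
        by (rule affinesE)
      moreover from fg(2) obtain c d where "c \<in> carrier R" "c \<noteq> \<zero>" "d \<in> carrier R" "g = affine c d"
        by (rule affinesE)
      ultimately show ?thesis using False by (simp add: app_affine aff_fun_def)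
    qed
  qed
qed

lemma card_graph_inter:
  assumes "Y \<subseteq> carrier R"
  shows "card (graph f \<inter> Y \<times> Y) = rcount Y f"
proof -
  have "graph f \<inter> Y \<times> Y = (\<lambda>y. (y, app f y)) ` {y \<in> Y. app f y \<in> Y}"
    using assms by (auto simp: graph_def)
  then show ?thesis by (simp add: rcount_def card_image inj_on_def)
qed

lemma affine_lines_cases:
  assumes "l \<in> affine_lines R"
  shows "(\<exists>f\<in>affines. l = graph f) \<or> (\<exists>x0\<in>carrier R. l = {x0} \<times> carrier R) \<or>
    (\<exists>y0\<in>carrier R. l = carrier R \<times> {y0})"
proof -
  obtain a b c where abc: "a \<in> carrier R" "b \<in> carrier R" "c \<in> carrier R" "a \<noteq> \<zero> \<or> b \<noteq> \<zero>"
    and l: "l = {(x, y). x \<in> carrier R \<and> y \<in> carrier R \<and> a \<otimes> x \<oplus> b \<otimes> y = c}"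
    using assms unfolding affine_lines_def by blast
  have solve: "a' \<otimes> x = c' \<longleftrightarrow> x = inv a' \<otimes> c'"
    if "a' \<in> carrier R" "a' \<noteq> \<zero>" "x \<in> carrier R" "c' \<in> carrier R" for a' x c'
  proof -
    note i = inverse_props[OF that(1,2)]
    show ?thesis
    proof
      assume "a' \<otimes> x = c'"
      then have "inv a' \<otimes> c' = (inv a' \<otimes> a') \<otimes> x" using i(1) that by (auto simp: m_assoc)
      then show "x = inv a' \<otimes> c'" using i that by simp
    next
      assume x: "x = inv a' \<otimes> c'"
      have "a' \<otimes> (inv a' \<otimes> c') = (a' \<otimes> inv a') \<otimes> c'" using i(1) that by (simp add: m_assoc)
      then show "a' \<otimes> x = c'" unfolding x using i that by simp
    qed
  qed
  consider "b = \<zero>" "a \<noteq> \<zero>" | "a = \<zero>" "b \<noteq> \<zero>" | "a \<noteq> \<zero>" "b \<noteq> \<zero>" using abc(4) by blast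
  then show ?thesis
  proof cases
    case 1
    note i = inverse_props[OF abc(1) 1(2)]
    have "a \<otimes> x \<oplus> b \<otimes> y = c \<longleftrightarrow> x = inv a \<otimes> c" if "x \<in> carrier R" "y \<in> carrier R" for x y
      using solve[OF abc(1) 1(2) that(1) abc(3)] 1(1) that abc(1) by simp
    moreover have "inv a \<otimes> c \<in> carrier R" using i(1) abc(3) by simp
    ultimately have "l = {inv a \<otimes> c} \<times> carrier R" unfolding l by blast
    then show ?thesis using i(1) abc(3) by blast
  next
    case 2
    note i = inverse_props[OF abc(2) 2(2)]
    have "a \<otimes> x \<oplus> b \<otimes> y = c \<longleftrightarrow> y = inv b \<otimes> c" if "x \<in> carrier R" "y \<in> carrier R" for x y
      using solve[OF abc(2) 2(2) that(2) abc(3)] 2(1) that abc(2) by simp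
    moreover have "inv b \<otimes> c \<in> carrier R" using i(1) abc(3) by simp
    ultimately have "l = carrier R \<times> {inv b \<otimes> c}" unfolding l by blast
    then show ?thesis using i(1) abc(3) by blast
  next
    case 3
    note i = inverse_props[OF abc(2) 3(2)]
    define s where "s = \<ominus> (inv b \<otimes> a)"
    define e where "e = inv b \<otimes> c"
    have s: "s \<in> carrier R" "s \<noteq> \<zero>" "e \<in> carrier R"
      using abc i 3 integral_iff by (auto simp: s_def e_def)
    have "a \<otimes> x \<oplus> b \<otimes> y = c \<longleftrightarrow> y = s \<otimes> x \<oplus> e" if xy: "x \<in> carrier R" "y \<in> carrier R" for x y
    proof -
      have "a \<otimes> x \<oplus> b \<otimes> y = c \<longleftrightarrow> b \<otimes> y = c \<ominus> a \<otimes> x"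
      proof
        assume "a \<otimes> x \<oplus> b \<otimes> y = c"
        then have "c \<ominus> a \<otimes> x = (a \<otimes> x \<oplus> b \<otimes> y) \<ominus> a \<otimes> x" by simp
        also have "\<dots> = b \<otimes> y" using abc xy by algebra
        finally show "b \<otimes> y = c \<ominus> a \<otimes> x" by simp
      next
        assume h: "b \<otimes> y = c \<ominus> a \<otimes> x"
        show "a \<otimes> x \<oplus> b \<otimes> y = c" unfolding h using abc xy by algebra
      qed
      also have "\<dots> \<longleftrightarrow> y = inv b \<otimes> (c \<ominus> a \<otimes> x)"
        using abc xy 3 by (intro solve) auto
      also have "inv b \<otimes> (c \<ominus> a \<otimes> x) = s \<otimes> x \<oplus> e"
        unfolding s_def e_def using abc xy i(1) by algebra
      finally show ?thesis .
    qed
    then have "l = line s e" unfolding l line_def using s by auto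
    then have "l = graph (affine s e)" using graph_affine s by simp
    then show ?thesis using affinesI[OF s] by blast
  qed
qed

text \<open>The subtracted \<open>2\<close> allows for one vertical and one horizontal line; a
  second of either kind would be parallel to the first. The other lines are graphs. Two graphs of
  equal slope that meet coincide, so \<open>slope\<close> is injective, and the absence of triple
  points says that no three maps share a value at one point.\<close>

lemma RLGP_upper:
  fixes \<alpha> \<delta> \<kappa> :: real and J N :: nat
  assumes N: "0 < N" "infinite (carrier R) \<or> N \<le> card (carrier R)" and \<alpha>: "0 < \<alpha>" "\<alpha> < 1"
    and generic: "\<And>x. x \<in> carrier R \<Longrightarrow> x \<noteq> \<zero> \<Longrightarrow> infinite (range (\<lambda>m::nat. [m] \<cdot> x)) \<or>
      finite (carrier R) \<and> range (\<lambda>m::nat. [m] \<cdot> x) = carrier R"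
    and J: "1 \<le> J" and \<delta>: "\<delta> = \<alpha> ^ (2 ^ Suc J) / 2" "2 \<le> \<delta> * real N"
      "infinite (carrier R) \<or> 2 * real N \<le> \<delta> * real (card (carrier R))"
    and \<kappa>: "\<kappa> = real N powr (16 / real J)"
  shows "(\<delta> / 2) ^ (4 ^ J) * \<delta>\<^sup>2 * (real (RLGP R N \<alpha>) - 2) \<le> 2 ^ 81 * \<kappa> ^ 152"
proof -
  obtain Y L where Y: "Y \<subseteq> carrier R" "finite Y" "card Y = N"
    and L: "L \<in> rich_gp_families R Y \<alpha>" "card L = RLGP R N \<alpha>"
    using RLGP_attained[OF N(1) \<alpha>(1) N(2)] by metis
  have Ll: "L \<subseteq> affine_lines R" "finite L" "\<And>l. l \<in> L \<Longrightarrow> rich Y \<alpha> l" "general_position L"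
    using L(1) by (auto simp: rich_gp_families_def)
  have meet: "l \<inter> m \<noteq> {}" if "l \<in> L" "m \<in> L" "l \<noteq> m" for l m
    using Ll(4) that unfolding general_position_def by blast
  have triple: "l \<inter> m \<inter> n = {}" if "l \<in> L" "m \<in> L" "n \<in> L" "l \<noteq> m" "l \<noteq> n" "m \<noteq> n" for l m n
    using Ll(4) that unfolding general_position_def by blast
  have Yne: "Y \<noteq> {}" using Y N by auto
  define G where "G = {f \<in> affines. graph f \<in> L}"
  have graphG: "graph ` G \<subseteq> L" by (auto simp: G_def)
  have injG: "inj_on graph G" by (rule inj_on_subset[OF inj_on_graph]) (auto simp: G_def)
  have finG: "finite G" using inj_on_finite[OF injG graphG Ll(2)] .
  define V where "V = {l \<in> L. \<exists>x0\<in>carrier R. l = {x0} \<times> carrier R}"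
  define H where "H = {l \<in> L. \<exists>y0\<in>carrier R. l = carrier R \<times> {y0}}"
  have finVH: "finite V" "finite H" using Ll(2) by (auto simp: V_def H_def)
  have V1: "card V \<le> 1"
  proof -
    have "l = m" if lm: "l \<in> V" "m \<in> V" for l m
    proof (rule ccontr)
      assume "l \<noteq> m"
      with meet lm have "l \<inter> m \<noteq> {}" by (auto simp: V_def)
      with lm \<open>l \<noteq> m\<close> show False by (auto simp: V_def)
    qed
    then show ?thesis unfolding One_nat_def card_le_Suc0_iff_eq[OF finVH(1)] by blast
  qed
  have H1: "card H \<le> 1"
  proof -
    have "l = m" if lm: "l \<in> H" "m \<in> H" for l m
    proof (rule ccontr)
      assume "l \<noteq> m"
      with meet lm have "l \<inter> m \<noteq> {}" by (auto simp: H_def)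
      with lm \<open>l \<noteq> m\<close> show False by (auto simp: H_def)
    qed
    then show ?thesis unfolding One_nat_def card_le_Suc0_iff_eq[OF finVH(2)] by blast
  qed
  have "L \<subseteq> graph ` G \<union> (V \<union> H)"
  proof
    fix l assume l: "l \<in> L"
    with Ll(1) have "l \<in> affine_lines R" by blast
    from affine_lines_cases[OF this] l show "l \<in> graph ` G \<union> (V \<union> H)"
      by (auto simp: G_def V_def H_def)
  qed
  then have "card L \<le> card (graph ` G \<union> (V \<union> H))"
    using finG finVH by (intro card_mono) auto
  also have "\<dots> \<le> card (graph ` G) + (card V + card H)"
    by (meson add_left_mono card_Un_le le_trans)
  also have "\<dots> \<le> card G + 2" using V1 H1 by (simp add: card_image[OF injG])
  finally have cardG: "real (RLGP R N \<alpha>) - 2 \<le> real (card G)" using L(2) by simp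
  have \<delta>0: "0 < \<delta>" using \<alpha> by (simp add: \<delta>(1))
  have "(\<delta> / 2) ^ (4 ^ J) * \<delta>\<^sup>2 * real (card G) \<le> 2 ^ 81 * \<kappa> ^ 152"
  proof (cases "G = {}")
    case False
    have G_aff: "G \<subseteq> affines" by (auto simp: G_def)
    have neq: "graph f \<noteq> graph g" if "f \<in> G" "g \<in> G" "f \<noteq> g" for f g
      using inj_onD[OF injG] that by blast
    show ?thesis
    proof (rule rich_family_bound[OF finG False G_aff _ _ generic Y(2,1) Yne \<alpha>(1) _ J])
      show "inj_on slope G"
      proof (rule inj_onI, rule ccontr)
        fix f g assume fg: "f \<in> G" "g \<in> G" "slope f = slope g" "f \<noteq> g"
        from fg G_aff have "f \<in> affines" "g \<in> affines" by auto
        from this(1) obtain a b where f: "a \<in> carrier R" "a \<noteq> \<zero>" "b \<in> carrier R" "f = affine a b" "slope f = a"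
          by (rule affinesE)
        from \<open>g \<in> affines\<close> obtain c d where g: "c \<in> carrier R" "c \<noteq> \<zero>" "d \<in> carrier R" "g = affine c d" "slope g = c"
          by (rule affinesE)
        have "graph f \<inter> graph g \<noteq> {}" using neq[OF fg(1,2,4)] fg by (intro meet) (auto simp: G_def)
        then obtain x where x: "x \<in> carrier R" "app f x = app g x" by (auto simp: graph_def)
        then have "a \<otimes> x \<oplus> b = a \<otimes> x \<oplus> d" using f g fg(3) by (simp add: app_affine aff_fun_def)
        then have "b = d" using f g x add.l_cancel[of "a \<otimes> x" b d] by simp
        with f g fg(3,4) show False by simp
      qed
      show "\<not> (app f x = app g x \<and> app g x = app h x)"
        if fgh: "f \<in> G" "g \<in> G" "h \<in> G" "f \<noteq> g" "f \<noteq> h" "g \<noteq> h" "x \<in> carrier R" for f g h x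
      proof
        assume "app f x = app g x \<and> app g x = app h x"
        then have "(x, app f x) \<in> graph f \<inter> graph g \<inter> graph h" using fgh by (simp add: graph_def)
        moreover have "graph f \<inter> graph g \<inter> graph h = {}"
          using fgh neq by (intro triple) (auto simp: G_def)
        ultimately show False by simp
      qed
      show "\<alpha> * real (card Y) \<le> real (rcount Y f)" if "f \<in> G" for f
        using Ll(3)[of "graph f"] that card_graph_inter[OF Y(1), of f] by (simp add: G_def rich_def)
    qed (use \<alpha> \<delta> \<kappa> Y(3) in simp_all)
  qed (simp add: \<kappa>)
  moreover have "(\<delta> / 2) ^ (4 ^ J) * \<delta>\<^sup>2 * (real (RLGP R N \<alpha>) - 2) \<le> (\<delta> / 2) ^ (4 ^ J) * \<delta>\<^sup>2 * real (card G)"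
    using cardG \<delta>0 by (intro mult_left_mono) auto
  ultimately show ?thesis by linarith
qed

end

section \<open>Choice of the parameters\<close>

text \<open>Needed to have \<open>ln (ln N) > 0\<close> already at \<open>N = 3\<close>. The sixth
  power of \<open>1 - 1/6 \<le> exp (- (1/6))\<close> is just sharp enough.\<close>

lemma exp_1_less_3: "exp 1 < (3::real)"
proof -
  have "(5/6) ^ 6 \<le> exp (- (1/6) :: real) ^ 6"
    using exp_ge_add_one_self[of "- (1/6)"] by (intro power_mono) auto
  also have "\<dots> = exp (- 1)" by (simp flip: exp_of_nat_mult)
  finally have "1/3 < exp (- 1 :: real)" by (simp add: power_numeral_reduce)
  then show ?thesis by (simp add: exp_minus field_simps)
qed

lemma ln_ln_props:
  fixes N :: nat
  assumes "3 \<le> N"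
  shows "1 < ln (real N)" "ln (ln 3) \<le> ln (ln (real N))" "0 < ln (ln 3 :: real)" "1 \<le> ln (real N) / ln (ln (real N))"
proof -
  have l3: "1 < ln (3::real)" using exp_1_less_3 ln_less_cancel_iff[of "exp 1" 3] by simp
  have le: "ln 3 \<le> ln (real N)" using assms by simp
  with l3 show L1: "1 < ln (real N)" by linarith
  show "ln (ln 3) \<le> ln (ln (real N))" using le l3 by (subst ln_le_cancel_iff) auto
  show "0 < ln (ln 3 :: real)" using l3 by (rule ln_gt_zero)
  have "0 < ln (ln (real N))" using L1 by (rule ln_gt_zero)
  moreover have "ln (ln (real N)) \<le> ln (real N) - 1" using L1 by (intro ln_le_minus_one) auto
  ultimately show "1 \<le> ln (real N) / ln (ln (real N))" by (simp add: le_divide_eq)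
qed

text \<open>With \<open>J\<close> about \<open>ln (ln N) / 6\<close> one has
  \<open>8 ^ J \<le> s\<close>, where \<open>s = sqrt (ln N)\<close>. Then
  \<open>(\<delta> / 2) ^ (4 ^ J)\<close>, which is \<open>exp (- O (4 ^ J * 2 ^ J))\<close>, costs
  only \<open>exp (O (s))\<close>, and the main term is \<open>\<kappa> ^ 152\<close>, of size
  \<open>exp (O (ln N / J))\<close>. The variables \<open>r\<close> and \<open>p\<close> stand for
  the number of lines and the size of the field; \<open>p\<close> is real so that it can be chosen
  freely over an infinite field.\<close>

lemma upper_asymptotics:
  fixes \<alpha> :: real
  assumes \<alpha>: "0 < \<alpha>" "\<alpha> < 1"
  shows "\<exists>C>0. \<forall>(N::nat) (p::real) (r::real). 3 \<le> N \<longrightarrow> 2 \<le> r \<longrightarrow> r \<le> 2 * (real N)\<^sup>2 \<longrightarrow>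
    real N powr (1 + ln (2 / \<alpha>) / ln (ln (real N))) \<le> p \<longrightarrow>
    (\<forall>(J::nat) \<delta> \<kappa>. 1 \<le> J \<longrightarrow> \<delta> = \<alpha> ^ (2 ^ Suc J) / 2 \<longrightarrow> 2 \<le> \<delta> * real N \<longrightarrow> 2 * real N \<le> \<delta> * p \<longrightarrow>
      \<kappa> = real N powr (16 / real J) \<longrightarrow> (\<delta> / 2) ^ (4 ^ J) * \<delta>\<^sup>2 * (r - 2) \<le> 2 ^ 81 * \<kappa> ^ 152) \<longrightarrow>
    ln r \<le> C * (ln (real N) / ln (ln (real N)))"
proof -
  define a where "a = ln (1 / \<alpha>)"
  have a0: "0 < a" using \<alpha> by (simp add: a_def)
  have \<alpha>a: "\<alpha> = exp (- a)" using \<alpha> by (simp add: a_def ln_div)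
  \<comment> \<open>\<open>4096 = 64^2\<close> gives \<open>s \<ge> 64\<close>, enough for
    \<open>ln (ln N) \<le> s / 2\<close>. The second entry gives \<open>s \<ge> 2 * a + 2\<close>,
    which yields \<open>2 \<le> \<delta> * N\<close>. Below \<open>L0\<close> the bound
    \<open>r \<le> 2 * N^2\<close> suffices.\<close>
  define L0 where "L0 = max 4096 ((2 * a + 2)\<^sup>2)"
  define C where "C = 2 * L0 + 12 * (a + 1) + 29300"
  have L00: "4096 \<le> L0" by (simp add: L0_def)
  have C0: "0 < C" using a0 L00 by (simp add: C_def)
  show ?thesis
  proof (intro exI[of _ C] conjI C0 allI impI)
    fix N :: nat and p r :: real
    assume N: "3 \<le> N" and r: "2 \<le> r" "r \<le> 2 * (real N)\<^sup>2"
      and p: "real N powr (1 + ln (2 / \<alpha>) / ln (ln (real N))) \<le> p"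
      and main: "\<forall>(J::nat) \<delta> \<kappa>. 1 \<le> J \<longrightarrow> \<delta> = \<alpha> ^ (2 ^ Suc J) / 2 \<longrightarrow> 2 \<le> \<delta> * real N \<longrightarrow> 2 * real N \<le> \<delta> * p \<longrightarrow>
        \<kappa> = real N powr (16 / real J) \<longrightarrow> (\<delta> / 2) ^ (4 ^ J) * \<delta>\<^sup>2 * (r - 2) \<le> 2 ^ 81 * \<kappa> ^ 152"
    define L where "L = ln (real N)"
    define e where "e = ln L"
    define g where "g = L / e"
    have L1: "1 < L" using ln_ln_props(1)[OF N] by (simp add: L_def)
    have e0: "0 < e" using L1 by (simp add: e_def)
    have g1: "1 \<le> g" using ln_ln_props(4)[OF N] by (simp add: g_def e_def L_def)
    have N0: "0 < real N" using N by simp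
    have NL: "real N = exp L" using N0 by (simp add: L_def)
    show "ln r \<le> C * (ln (real N) / ln (ln (real N)))"
      unfolding L_def[symmetric] e_def[symmetric] g_def[symmetric]
    proof (cases "L \<le> L0")
      case True
      have "ln r \<le> ln (2 * (real N)\<^sup>2)" using r N0 by (subst ln_le_cancel_iff) auto
      also have "\<dots> = ln 2 + 2 * L" using N0 by (simp add: ln_mult ln_realpow L_def)
      also have "\<dots> \<le> 1 + 2 * L0" using True ln_2_less_1 by simp
      also have "\<dots> \<le> C * 1" using a0 by (simp add: C_def)
      also have "\<dots> \<le> C * g" using C0 g1 by (intro mult_left_mono) auto
      finally show "ln r \<le> C * g" .
    next
      case False
      define s where "s = sqrt L"
      have s0: "0 < s" and ss: "s * s = L" using L1 by (simp_all add: s_def)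
      have s64: "64 \<le> s" unfolding s_def using False L00 by (intro real_le_rsqrt) simp
      have sa: "2 * a + 2 \<le> s" unfolding s_def using False by (intro real_le_rsqrt) (simp add: L0_def)
      have e_le: "e \<le> s / 2"
      proof -
        define q where "q = sqrt s"
        have q0: "0 < q" and qq: "q * q = s" using s0 by (simp_all add: q_def)
        have q8: "8 \<le> q" unfolding q_def using s64 by (intro real_le_rsqrt) simp
        have "L = (q * q) * (q * q)" using ss qq by simp
        then have "L = q ^ 4" by (simp add: power4_eq_xxxx mult.assoc)
        then have "e = 4 * ln q" using q0 by (simp add: e_def ln_realpow)
        also have "\<dots> \<le> 4 * (q - 1)" using q0 by (intro mult_left_mono ln_le_minus_one) auto
        also have "\<dots> \<le> 4 * q" by simp
        also have "\<dots> \<le> (q / 2) * q" using q8 by (simp add: mult_right_mono)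
        finally show ?thesis using qq by simp
      qed
      have gs: "2 * s \<le> g"
      proof -
        have "2 * s * e \<le> 2 * s * (s / 2)" using e_le s0 by (intro mult_left_mono) auto
        then show ?thesis using e0 ss by (simp add: g_def le_divide_eq)
      qed
      have e6: "6 \<le> e"
      proof -
        have "exp 6 = (exp 1 :: real) ^ 6" by (simp flip: exp_of_nat_mult)
        also have "\<dots> \<le> 3 ^ 6" using exp_1_less_3 by (intro power_mono) auto
        also have "\<dots> \<le> L" using False L00 by simp
        finally show ?thesis using L1 by (simp add: e_def ln_ge_iff)
      qed
      \<comment> \<open>The divisor \<open>6\<close> and \<open>ln 8 \<le> 3\<close> give
        \<open>8 ^ J \<le> exp (e / 2) = s\<close>. Rounding down loses at most a factor of two, as
        \<open>e \<ge> 6\<close>.\<close>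
      define J where "J = nat \<lfloor>e / 6\<rfloor>"
      have J_le: "real J \<le> e / 6" using of_nat_floor[of "e / 6"] e6 by (simp add: J_def)
      have J_ge: "e / 12 \<le> real J"
      proof -
        have "e / 6 - 1 \<le> real J" using e6 unfolding J_def by linarith
        moreover have "1 \<le> real J" using e6 by (simp add: J_def le_nat_floor)
        ultimately show ?thesis by linarith
      qed
      have J1: "1 \<le> J" using e6 by (simp add: J_def le_nat_floor)
      have J8: "8 ^ J \<le> s"
      proof -
        have "(8::real) ^ J = exp (real J * ln 8)" by (simp add: exp_of_nat_mult)
        also have "\<dots> \<le> exp (e / 2)"
        proof -
          have "ln (8::real) = 3 * ln 2" using ln_realpow[of 2 3] by simp
          then have "ln (8::real) \<le> 3" using ln_2_less_1 by simp
          then have "real J * ln 8 \<le> e / 6 * 3" using J_le e0 by (intro mult_mono) auto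
          then show ?thesis by simp
        qed
        also have "exp (e / 2) = s"
        proof -
          have "e = ln s + ln s" using ss s0 ln_mult[of s s] by (simp add: e_def)
          then show ?thesis using s0 by simp
        qed
        finally show ?thesis .
      qed
      define t where "t = (2::real) ^ J"
      define f where "f = (4::real) ^ J"
      have t1: "1 \<le> t" and f1: "1 \<le> f" by (simp_all add: t_def f_def)
      have tf: "f * t = 8 ^ J" by (simp add: t_def f_def flip: power_mult_distrib)
      have ts: "t \<le> s" using J8 tf t1 f1 mult_right_mono[of 1 f t] by linarith
      define \<delta> where "\<delta> = \<alpha> ^ (2 ^ Suc J) / 2"
      have \<alpha>p: "\<alpha> ^ (2 ^ Suc J) = exp (- (2 * t * a))"
        unfolding \<alpha>a exp_of_nat_mult[symmetric] by (simp add: t_def)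
      have \<delta>e: "\<delta> = exp (- (2 * t * a) - ln 2)"
        unfolding \<delta>_def \<alpha>p by (simp add: exp_diff)
      have \<delta>0: "0 < \<delta>" by (simp add: \<delta>e)
      have ln2: "ln 2 < (1::real)" "0 < ln (2::real)" using ln_2_less_1 by auto
      have c1: "2 \<le> \<delta> * real N"
      proof -
        have "2 * t * a + 2 \<le> 2 * s * a + 2 * s"
          using ts a0 s64 by (intro add_mono mult_right_mono) auto
        also have "\<dots> = s * (2 * a + 2)" by (simp add: algebra_simps)
        also have "\<dots> \<le> s * s" using sa s0 by (intro mult_left_mono) auto
        finally have "2 * t * a + 2 \<le> L" using ss by simp
        then have "ln 2 \<le> - (2 * t * a) - ln 2 + L" using ln2 by simp
        then have "exp (ln 2) \<le> exp (- (2 * t * a) - ln 2 + L)" by (simp only: exp_le_cancel_iff)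
        then show ?thesis by (simp add: \<delta>e NL flip: exp_add)
      qed
      \<comment> \<open>The assumption on \<open>p\<close> reads
        \<open>p \<ge> N * (2 / \<alpha>) powr g\<close>, and \<open>2 * t \<le> g\<close> compares
        this with \<open>2 / \<delta> = 4 / \<alpha> powr (2 * t)\<close>. This is the origin of the
        threshold for \<open>p\<close>.\<close>
      have c2: "2 * real N \<le> \<delta> * p"
      proof -
        have "ln (2 / \<alpha>) = ln 2 + a" using \<alpha> by (simp add: a_def ln_div)
        then have "exp (L * (1 + (ln 2 + a) / e)) \<le> p"
          using p N0 by (simp add: powr_def L_def e_def mult.commute)
        moreover have "L * (1 + (ln 2 + a) / e) = L + g * (ln 2 + a)"
          by (simp add: g_def algebra_simps add_divide_distrib)
        ultimately have pe: "exp (L + g * (ln 2 + a)) \<le> p" by simp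
        have "2 * t \<le> g" using ts gs by simp
        then have "2 * t * a \<le> g * a" using a0 by (intro mult_right_mono) auto
        moreover have "2 * ln (2::real) \<le> g * ln 2" using gs s64 ln2(2) by (intro mult_right_mono) auto
        moreover have "g * (ln 2 + a) = g * ln 2 + g * a" by (rule distrib_left)
        ultimately have "ln 2 + L \<le> (- (2 * t * a) - ln 2) + (L + g * (ln 2 + a))"
          by linarith
        then have "exp (ln 2 + L) \<le> exp ((- (2 * t * a) - ln 2) + (L + g * (ln 2 + a)))"
          by (simp only: exp_le_cancel_iff)
        also have "\<dots> = \<delta> * exp (L + g * (ln 2 + a))" by (simp only: \<delta>e exp_add)
        also have "\<dots> \<le> \<delta> * p" using pe \<delta>0 by (intro mult_left_mono) auto
        finally show ?thesis by (simp add: exp_add NL)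
      qed
      define \<kappa> where "\<kappa> = real N powr (16 / real J)"
      have "(\<delta> / 2) ^ (4 ^ J) * \<delta>\<^sup>2 * (r - 2) \<le> 2 ^ 81 * \<kappa> ^ 152"
        using main J1 \<delta>_def c1 c2 \<kappa>_def by blast
      \<comment> \<open>The coefficient is \<open>152 * 16 * 12\<close>, the last factor coming from
        \<open>e / 12 \<le> J\<close>.\<close>
      also have "(2::real) ^ 81 * \<kappa> ^ 152 \<le> exp (81 + 29184 * g)"
      proof -
        have "\<kappa> ^ 152 = exp (152 * (16 / real J * L))"
          using N0 by (simp add: \<kappa>_def powr_def L_def flip: exp_of_nat_mult)
        also have "\<dots> \<le> exp (29184 * g)"
        proof -
          have "1 / real J \<le> 12 / e" using J_ge J1 e0 by (simp add: field_simps)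
          then have "2432 * L * (1 / real J) \<le> 2432 * L * (12 / e)" using L1 by (intro mult_left_mono) auto
          then show ?thesis by (simp add: g_def)
        qed
        finally have k: "\<kappa> ^ 152 \<le> exp (29184 * g)" .
        have "(2::real) ^ 81 \<le> exp 1 ^ 81" using exp_ge_add_one_self[of 1] by (intro power_mono) auto
        also have "\<dots> = exp 81" by (simp flip: exp_of_nat_mult)
        finally have "(2::real) ^ 81 * \<kappa> ^ 152 \<le> exp 81 * exp (29184 * g)"
          using k by (intro mult_mono) (auto simp: \<kappa>_def)
        then show ?thesis by (simp add: exp_add)
      qed
      finally have up: "(\<delta> / 2) ^ (4 ^ J) * \<delta>\<^sup>2 * (r - 2) \<le> exp (81 + 29184 * g)" .
      have lo: "exp (- (6 * (a + 1) * s)) \<le> (\<delta> / 2) ^ (4 ^ J) * \<delta>\<^sup>2"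
      proof -
        define u where "u = 2 * t * a + 2"
        have u0: "0 \<le> u" using t1 a0 by (simp add: u_def)
        have "\<delta> / 2 = exp (- (2 * t * a) - 2 * ln 2)"
        proof -
          have "exp (- (2 * t * a) - 2 * ln 2) = exp ((- (2 * t * a) - ln 2) - ln 2)" by simp
          also have "\<dots> = \<delta> / 2" unfolding \<delta>e by (subst exp_diff) simp
          finally show ?thesis by simp
        qed
        then have d2: "exp (- u) \<le> \<delta> / 2" using ln2 by (simp add: u_def)
        then have d1: "exp (- u) \<le> \<delta>" using \<delta>0 by simp
        have "(f + 2) * u \<le> (3 * f) * (2 * t * (a + 1))"
        proof (rule mult_mono)
          show "u \<le> 2 * t * (a + 1)" using t1 by (simp add: u_def algebra_simps)
        qed (use f1 u0 in auto)
        also have "\<dots> = 6 * (a + 1) * (f * t)" by simp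
        also have "\<dots> \<le> 6 * (a + 1) * s" using J8 tf a0 by (intro mult_left_mono) auto
        finally have "exp (- (6 * (a + 1) * s)) \<le> exp (- ((f + 2) * u))" by simp
        also have "\<dots> = exp (- (f * u)) * exp (- (2 * u))"
          by (simp add: algebra_simps flip: exp_add)
        also have "exp (- (f * u)) = exp (- u) ^ (4 ^ J)"
          by (simp add: f_def flip: exp_of_nat_mult)
        also have "exp (- (2 * u)) = exp (- u) ^ 2"
          by (simp flip: exp_of_nat_mult)
        also have "exp (- u) ^ (4 ^ J) * exp (- u) ^ 2 \<le> (\<delta> / 2) ^ (4 ^ J) * \<delta>\<^sup>2"
          using d1 d2 \<delta>0 by (intro mult_mono power_mono) auto
        finally show ?thesis .
      qed
      define E where "E = 6 * (a + 1) * s + (81 + 29184 * g)"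
      have E0: "0 \<le> E" using a0 s0 g1 by (simp add: E_def)
      have "exp (- (6 * (a + 1) * s)) * (r - 2) \<le> (\<delta> / 2) ^ (4 ^ J) * \<delta>\<^sup>2 * (r - 2)"
        using lo r by (intro mult_right_mono) auto
      with up have "exp (- (6 * (a + 1) * s)) * (r - 2) \<le> exp (81 + 29184 * g)" by linarith
      then have "exp (6 * (a + 1) * s) * (exp (- (6 * (a + 1) * s)) * (r - 2)) \<le> exp (6 * (a + 1) * s) * exp (81 + 29184 * g)"
        by (intro mult_left_mono) auto
      also have "\<dots> = exp E" by (simp only: E_def exp_add)
      also have "exp (6 * (a + 1) * s) * (exp (- (6 * (a + 1) * s)) * (r - 2)) = r - 2"
        by (simp add: exp_minus)
      finally have "r \<le> 2 + exp E" by simp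
      also have "\<dots> \<le> exp 2 * exp E"
      proof -
        have "1 \<le> exp E" using E0 by simp
        moreover have "(3::real) * exp E \<le> exp 2 * exp E"
          using exp_ge_add_one_self[of 2] by (intro mult_right_mono) auto
        ultimately show ?thesis by linarith
      qed
      also have "\<dots> = exp (2 + E)" by (simp add: exp_add)
      finally have "ln r \<le> ln (exp (2 + E))" using r by (subst ln_le_cancel_iff) auto
      then have "ln r \<le> 2 + E" by simp
      also have "6 * (a + 1) * s \<le> 6 * (a + 1) * g" using gs s0 a0 by (intro mult_left_mono) auto
      then have "2 + E \<le> (6 * (a + 1) + 29267) * g" using g1 unfolding E_def by (simp add: algebra_simps)
      also have "\<dots> \<le> C * g" using g1 a0 L00 by (intro mult_right_mono) (auto simp: C_def)
      finally show "ln r \<le> C * g" .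
    qed
  qed
qed

text \<open>With \<open>M\<close> fixed by \<open>\<alpha>\<close>, the number \<open>F\<close> of
  maps in the construction has a logarithm of order at most \<open>M * d^2 * (1 + ln d)\<close>.
  Keeping it below \<open>ln N / 4\<close> allows \<open>d\<close> of order
  \<open>sqrt (ln N / ln (ln N))\<close>.\<close>

lemma lower_asymptotics:
  fixes \<alpha> :: real
  assumes \<alpha>: "0 < \<alpha>" "\<alpha> < 1"
  shows "\<exists>C>0. \<forall>(N::nat) (r::real). 3 \<le> N \<longrightarrow> 2 \<le> r \<longrightarrow>
    (\<forall>d M. 1 \<le> d \<longrightarrow> 2 \<le> M \<longrightarrow> 16 \<le> (1 - \<alpha>)\<^sup>2 * real M \<longrightarrow>
      8 * (real ((M * d) ^ d * (M * ((9 * d\<^sup>2) ^ d) ^ (M * d))))\<^sup>2 \<le> (1 - \<alpha>) * real N \<longrightarrow> 2 ^ d \<le> r) \<longrightarrow>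
    sqrt (ln (real N) / ln (ln (real N))) \<le> C * ln r"
proof -
  define M where "M = nat \<lceil>16 / (1 - \<alpha>)\<^sup>2\<rceil> + 2"
  have M2: "2 \<le> M" by (simp add: M_def)
  have M16: "16 \<le> (1 - \<alpha>)\<^sup>2 * real M"
  proof -
    have "16 / (1 - \<alpha>)\<^sup>2 \<le> real M" unfolding M_def using of_nat_ceiling[of "16 / (1 - \<alpha>)\<^sup>2"] by linarith
    then show ?thesis using \<alpha> by (simp add: divide_le_eq mult.commute)
  qed
  define m where "m = real M"
  have m2: "2 \<le> m" using M2 by (simp add: m_def)
  \<comment> \<open>The estimate to come is \<open>ln F \<le> 10 * m * d^2 * e\<close>. With
    \<open>d \<le> c * S\<close> and \<open>40 * m * c^2 = 1\<close> it becomes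
    \<open>L / 4\<close>.\<close>
  define c where "c = 1 / sqrt (40 * m)"
  have c0: "0 < c" using m2 by (simp add: c_def)
  have cc: "40 * m * c\<^sup>2 = 1" using m2 by (simp add: c_def power_divide)
  have c1: "c \<le> 1" using m2 by (simp add: c_def)
  \<comment> \<open>\<open>exp 1\<close> ensures \<open>e \<ge> 1\<close>, and the other entry
    ensures \<open>8 \<le> (1 - \<alpha>) * exp (L / 2)\<close>, which absorbs the constants of the
    size condition. For \<open>L \<le> L0\<close> the quantity \<open>S\<close> is at most
    \<open>K\<close>.\<close>
  define L0 where "L0 = max (exp 1) (ln (64 / (1 - \<alpha>)\<^sup>2))"
  define K where "K = sqrt (L0 / ln (ln 3))"
  define C where "C = 4 / c + 2 * K"
  have l3: "0 < ln (ln 3 :: real)" using ln_ln_props(3)[of 3] by simp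
  have L00: "0 < L0" by (simp add: L0_def less_max_iff_disj)
  have K0: "0 \<le> K" using L00 l3 by (simp add: K_def)
  have C0: "0 < C" using c0 K0 by (simp add: C_def add_pos_nonneg)
  show ?thesis
  proof (intro exI[of _ C] conjI C0 allI impI)
    fix N :: nat and r :: real
    assume N: "3 \<le> N" and r: "2 \<le> r"
      and main: "\<forall>d M. 1 \<le> d \<longrightarrow> 2 \<le> M \<longrightarrow> 16 \<le> (1 - \<alpha>)\<^sup>2 * real M \<longrightarrow>
      8 * (real ((M * d) ^ d * (M * ((9 * d\<^sup>2) ^ d) ^ (M * d))))\<^sup>2 \<le> (1 - \<alpha>) * real N \<longrightarrow> 2 ^ d \<le> r"
    define L where "L = ln (real N)"
    define e where "e = ln L"
    define S where "S = sqrt (L / e)"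
    have L1: "1 < L" using ln_ln_props(1)[OF N] by (simp add: L_def)
    have e3: "ln (ln 3) \<le> e" using ln_ln_props(2)[OF N] by (simp add: L_def e_def)
    have e0: "0 < e" using e3 l3 by linarith
    have N0: "0 < real N" using N by simp
    have NL: "real N = exp L" using N0 by (simp add: L_def)
    have S0: "0 \<le> S" using L1 e0 by (simp add: S_def)
    have lnr: "1 / 2 \<le> ln r"
    proof -
      have "1 / 2 \<le> ln (2::real)" using ln2_ge_two_thirds by simp
      also have "\<dots> \<le> ln r" using r by simp
      finally show ?thesis .
    qed
    have K_case: "S \<le> C * ln r" if "S \<le> K"
    proof -
      have "S \<le> 2 * K * (1 / 2)" using that by simp
      also have "\<dots> \<le> 2 * K * ln r" using lnr K0 by (intro mult_left_mono) auto
      also have "\<dots> \<le> C * ln r" using lnr c0 by (intro mult_right_mono) (auto simp: C_def)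
      finally show ?thesis .
    qed
    have c_case: "S \<le> C * ln r" if "c * S \<le> 4 * ln r"
    proof -
      have "S \<le> 4 / c * ln r" using that c0 by (simp add: field_simps)
      also have "\<dots> \<le> C * ln r" using lnr K0 by (intro mult_right_mono) (auto simp: C_def)
      finally show ?thesis .
    qed
    show "sqrt (ln (real N) / ln (ln (real N))) \<le> C * ln r"
      unfolding L_def[symmetric] e_def[symmetric] S_def[symmetric]
    proof (cases "L \<le> L0")
      case True
      have "L / e \<le> L0 / ln (ln 3)" using True e3 l3 L1 by (intro frac_le) auto
      then have "S \<le> K" by (simp add: S_def K_def)
      then show "S \<le> C * ln r" by (rule K_case)
    next
      case False
      define d where "d = nat \<lfloor>c * S\<rfloor>"
      show "S \<le> C * ln r"
      proof (cases "c * S < 1")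
        \<comment> \<open>Here \<open>d\<close> would be \<open>0\<close>; the bound
          \<open>ln r \<ge> 1 / 2\<close> is enough.\<close>
        case True
        then show ?thesis using lnr by (intro c_case) simp
      next
        case cS: False
        have d1: "1 \<le> d" using cS by (simp add: d_def le_nat_floor)
        have d_le: "real d \<le> c * S" unfolding d_def using cS by (intro of_nat_floor) simp
        have d_ge: "c * S / 2 \<le> real d"
        proof -
          have "c * S - 1 \<le> real d" using cS unfolding d_def by linarith
          then show ?thesis using d1 by simp
        qed
        have e1: "1 \<le> e"
        proof -
          have "exp 1 \<le> L" using False by (simp add: L0_def)
          then show ?thesis using L1 by (simp add: e_def ln_ge_iff)
        qed
        have dd: "(real d)\<^sup>2 \<le> c\<^sup>2 * (L / e)"
        proof -
          have "(real d)\<^sup>2 \<le> (c * S)\<^sup>2" using d_le by (intro power_mono) auto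
          also have "\<dots> = c\<^sup>2 * (L / e)" using L1 e0 by (simp add: S_def power_mult_distrib)
          finally show ?thesis .
        qed
        define b where "b = ln (real d)"
        have b0: "0 \<le> b" using d1 by (simp add: b_def)
        have b_le: "1 + b \<le> 2 * e"
        proof -
          have "c\<^sup>2 * (L / e) \<le> 1 * (L / 1)"
            using c0 c1 e1 L1 by (intro mult_mono frac_le power_le_one) auto
          with dd have "(real d)\<^sup>2 \<le> L" by simp
          then have "ln ((real d)\<^sup>2) \<le> e" unfolding e_def using d1 L1 by (subst ln_le_cancel_iff) auto
          then have "2 * b \<le> e" using d1 by (simp add: b_def ln_realpow)
          then show ?thesis using e1 by simp
        qed
        define F where "F = real ((M * d) ^ d * (M * ((9 * d\<^sup>2) ^ d) ^ (M * d)))"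
        have F0: "0 < F" using M2 d1 by (simp add: F_def)
        have lnF: "ln F = real d * (ln m + b) + (ln m + m * (real d)\<^sup>2 * (ln 9 + 2 * b))"
          using M2 d1 by (simp add: F_def m_def b_def ln_mult ln_realpow power2_eq_square algebra_simps)
        have lnm: "0 \<le> ln m" "ln m \<le> m" using m2 ln_le_minus_one[of m] by auto
        have ln9: "ln (9::real) \<le> 3"
        proof -
          have "ln (9::real) \<le> ln (2 ^ 4)" by simp
          also have "\<dots> = 4 * ln 2" by (subst ln_realpow) auto
          also have "\<dots> \<le> 3" using ln2_le_25_over_36 by simp
          finally show ?thesis .
        qed
        have d2: "real d \<le> (real d)\<^sup>2" "1 \<le> (real d)\<^sup>2"
          using d1 by (auto simp: self_le_power one_le_power)
        have "ln F \<le> m * (real d)\<^sup>2 * (1 + b) + (m * (real d)\<^sup>2 + m * (real d)\<^sup>2 * (3 + 2 * b))"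
        proof -
          have "real d * (ln m + b) \<le> (real d)\<^sup>2 * (m * (1 + b))"
          proof (rule mult_mono)
            have "ln m + b \<le> m + m * b" using lnm m2 b0 mult_right_mono[of 1 m b] by simp
            then show "ln m + b \<le> m * (1 + b)" by (simp add: algebra_simps)
          qed (use d2 lnm b0 in auto)
          moreover have "m * 1 \<le> m * (real d)\<^sup>2" using m2 d2(2) by (intro mult_left_mono) auto
          then have "ln m \<le> m * (real d)\<^sup>2" using lnm by linarith
          moreover have "m * (real d)\<^sup>2 * (ln 9 + 2 * b) \<le> m * (real d)\<^sup>2 * (3 + 2 * b)"
            using ln9 m2 by (intro mult_left_mono) auto
          ultimately show ?thesis unfolding lnF by (simp add: mult_ac)
        qed
        also have "\<dots> = m * (real d)\<^sup>2 * (5 + 3 * b)" by (simp add: algebra_simps)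
        also have "\<dots> \<le> m * (real d)\<^sup>2 * (10 * e)"
          using b_le b0 m2 by (intro mult_left_mono) auto
        also have "\<dots> \<le> m * (c\<^sup>2 * (L / e)) * (10 * e)"
          using dd m2 e0 by (intro mult_right_mono mult_left_mono) auto
        also have "\<dots> = (40 * m * c\<^sup>2) * L / 4" using e0 by simp
        also have "\<dots> = L / 4" unfolding cc by simp
        finally have "exp (ln F) \<le> exp (L / 4)" by simp
        then have "F \<le> exp (L / 4)" using F0 by simp
        then have "F\<^sup>2 \<le> exp (L / 4) ^ 2" using F0 by (intro power_mono) auto
        also have "\<dots> = exp (L / 2)" by (simp flip: exp_of_nat_mult)
        finally have F2: "F\<^sup>2 \<le> exp (L / 2)" .
        have "8 \<le> (1 - \<alpha>) * exp (L / 2)"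
        proof -
          have "ln (64 / (1 - \<alpha>)\<^sup>2) \<le> L" using False by (simp add: L0_def)
          then have "exp (ln (64 / (1 - \<alpha>)\<^sup>2)) \<le> exp L" by (simp only: exp_le_cancel_iff)
          then have "64 / (1 - \<alpha>)\<^sup>2 \<le> exp L" using \<alpha> by simp
          also have "exp L = exp (L / 2) ^ 2" by (simp flip: exp_of_nat_mult)
          finally have "(8 / (1 - \<alpha>))\<^sup>2 \<le> exp (L / 2) ^ 2" by (simp add: power_divide)
          then have "8 / (1 - \<alpha>) \<le> exp (L / 2)" by (rule power2_le_imp_le) simp
          then show ?thesis using \<alpha> by (simp add: divide_le_eq mult.commute)
        qed
        then have "8 * exp (L / 2) \<le> (1 - \<alpha>) * exp (L / 2) * exp (L / 2)" by (intro mult_right_mono) auto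
        also have "\<dots> = (1 - \<alpha>) * real N" by (simp add: NL mult.assoc flip: exp_add)
        finally have "8 * F\<^sup>2 \<le> (1 - \<alpha>) * real N" using F2 by simp
        then have "2 ^ d \<le> r" using main d1 M2 M16 unfolding F_def by blast
        then have "ln (2 ^ d) \<le> ln r" using r by (subst ln_le_cancel_iff) auto
        then have "real d * ln 2 \<le> ln r" by (simp add: ln_realpow)
        moreover have "real d * (1 / 2) \<le> real d * ln 2" using ln2_ge_two_thirds by (intro mult_left_mono) auto
        ultimately show ?thesis using d_ge by (intro c_case) simp
      qed
    qed
  qed
qed

section \<open>The complex numbers and the prime fields\<close>

context field_nat begin

lemma add_pow_eq: "x \<in> carrier R \<Longrightarrow> \<iota> 1 = \<one> \<Longrightarrow> [m] \<cdot> x = \<iota> m \<otimes> x"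
  for m :: nat
proof (induction m)
  case (Suc m)
  then have "[Suc m] \<cdot> x = \<iota> m \<otimes> x \<oplus> \<iota> 1 \<otimes> x" by simp
  also have "\<dots> = \<iota> (m + 1) \<otimes> x" using Suc.prems(1) by (simp only: \<iota>_add l_distr[OF \<iota>_closed \<iota>_closed])
  finally show ?case by simp
qed (simp add: \<iota>_0)

end

lemma residue_ring_field_nat:
  assumes p: "Factorial_Ring.prime (p :: nat)" and N: "N \<le> p"
  shows "field_nat (residue_ring (int p)) (\<lambda>n. int n mod int p) N"
proof -
  interpret residues_prime p "residue_ring (int p)" by unfold_locales (use p in auto)
  interpret field "residue_ring (int p)" by (rule is_field)
  have p1: "0 < p" using p by (simp add: prime_gt_0_nat)
  show ?thesis
  proof unfold_locales
    show "int n mod int p \<in> carrier (residue_ring (int p))" for n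
      using p1 by (simp add: residue_ring_def)
    show "inj_on (\<lambda>n. int n mod int p) {..<N}"
      using N by (auto simp: inj_on_def)
    show "infinite (carrier (residue_ring (int p))) \<or> N \<le> card (carrier (residue_ring (int p)))"
      using N by (simp add: residue_ring_def)
  qed (simp_all add: residue_ring_def mod_add_eq mod_mult_eq)
qed

text \<open>The multiples of \<open>x\<close> by \<open>0, ..., p - 1\<close> are distinct and hence
  exhaust the field: every nonzero element generates a group of prime order.\<close>

lemma residue_ring_generic:
  fixes p :: nat
  assumes p: "Factorial_Ring.prime p"
    and x: "x \<in> carrier (residue_ring (int p))" "x \<noteq> \<zero>\<^bsub>residue_ring (int p)\<^esub>"
  shows "finite (carrier (residue_ring (int p))) \<and>
    range (\<lambda>m::nat. [m] \<cdot>\<^bsub>residue_ring (int p)\<^esub> x) = carrier (residue_ring (int p))"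
proof -
  define \<iota> where "\<iota> n = int n mod int p" for n :: nat
  interpret field_nat "residue_ring (int p)" \<iota> p
    unfolding \<iota>_def by (rule residue_ring_field_nat[OF p order.refl])
  have fin: "finite (carrier (residue_ring (int p)))" and card: "card (carrier (residue_ring (int p))) = p"
    by (simp_all add: residue_ring_def)
  have \<iota>1: "\<iota> 1 = \<one>\<^bsub>residue_ring (int p)\<^esub>"
    using prime_gt_1_nat[OF p] by (simp add: \<iota>_def residue_ring_def)
  define h where "h m = [m] \<cdot>\<^bsub>residue_ring (int p)\<^esub> x" for m :: nat
  have h: "h m = \<iota> m \<otimes>\<^bsub>residue_ring (int p)\<^esub> x" for m
    unfolding h_def by (rule add_pow_eq[OF x(1) \<iota>1])
  have "inj_on h {..<p}"
    using m_rcancel[OF x(2,1)] \<iota>_inj by (auto simp: inj_on_def h)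
  then have "card (h ` {..<p}) = p" by (simp add: card_image)
  moreover have sub: "h ` UNIV \<subseteq> carrier (residue_ring (int p))" using x(1) by (auto simp: h)
  ultimately have "h ` {..<p} = carrier (residue_ring (int p))"
    using card fin by (intro card_subset_eq) auto
  then have "carrier (residue_ring (int p)) \<subseteq> range h" by (metis image_mono subset_UNIV)
  with sub have "range h = carrier (residue_ring (int p))" by blast
  with fin show ?thesis unfolding h_def by simp
qed

lemma complex_field_nat: "field_nat (ring_of_type_algebra :: complex ring) of_nat N"
proof -
  interpret field "ring_of_type_algebra :: complex ring" by (rule field_from_type_algebra)
  show ?thesis
    by unfold_locales (auto simp: ring_of_type_algebra_def inj_on_def infinite_UNIV_char_0)
qed

lemma complex_generic:
  fixes x :: complex
  assumes "x \<noteq> \<zero>\<^bsub>ring_of_type_algebra\<^esub>"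
  shows "infinite (range (\<lambda>m::nat. [m] \<cdot>\<^bsub>ring_of_type_algebra\<^esub> x))"
proof -
  interpret field_nat "ring_of_type_algebra :: complex ring" of_nat 1 by (rule complex_field_nat)
  have eq: "[m] \<cdot>\<^bsub>ring_of_type_algebra\<^esub> x = of_nat m * x" for m :: nat
    using add_pow_eq[of x m] by (simp add: ring_of_type_algebra_def)
  have "inj (\<lambda>m::nat. of_nat m * x)" using assms by (auto simp: inj_def ring_of_type_algebra_def)
  then show ?thesis unfolding eq by (rule range_inj_infinite)
qed

theorem theorem1p3:
  fixes \<alpha> :: real
  assumes "0 < \<alpha>" and "\<alpha> < 1"
  shows "\<exists>C>0.
    (\<forall>N::nat. 3 \<le> N \<longrightarrow>
       1 / C * sqrt (ln (real N) / ln (ln (real N)))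
         \<le> ln (real (RLGP (ring_of_type_algebra :: complex ring) N \<alpha>)) \<and>
       ln (real (RLGP (ring_of_type_algebra :: complex ring) N \<alpha>))
         \<le> C * (ln (real N) / ln (ln (real N)))) \<and>
    (\<forall>p N::nat. Factorial_Ring.prime p \<and> 3 \<le> N \<and> N \<le> p \<longrightarrow>
       1 / C * sqrt (ln (real N) / ln (ln (real N)))
         \<le> ln (real (RLGP (residue_ring (int p)) N \<alpha>)) \<and>
       (real N powr (1 + ln (2 / \<alpha>) / ln (ln (real N))) \<le> real p \<longrightarrow>
        ln (real (RLGP (residue_ring (int p)) N \<alpha>))
          \<le> C * (ln (real N) / ln (ln (real N)))))"
proof -
  obtain C1 where C1: "0 < C1" "\<And>(N::nat) (p::real) (r::real). \<lbrakk>3 \<le> N; 2 \<le> r; r \<le> 2 * (real N)\<^sup>2;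
      real N powr (1 + ln (2 / \<alpha>) / ln (ln (real N))) \<le> p;
      \<And>(J::nat) \<delta> \<kappa>. \<lbrakk>1 \<le> J; \<delta> = \<alpha> ^ (2 ^ Suc J) / 2; 2 \<le> \<delta> * real N; 2 * real N \<le> \<delta> * p;
        \<kappa> = real N powr (16 / real J)\<rbrakk> \<Longrightarrow> (\<delta> / 2) ^ (4 ^ J) * \<delta>\<^sup>2 * (r - 2) \<le> 2 ^ 81 * \<kappa> ^ 152\<rbrakk>
      \<Longrightarrow> ln r \<le> C1 * (ln (real N) / ln (ln (real N)))"
    using upper_asymptotics[OF assms] by metis
  obtain C2 where C2: "0 < C2" "\<And>(N::nat) (r::real). \<lbrakk>3 \<le> N; 2 \<le> r;
      \<And>d M. \<lbrakk>1 \<le> d; 2 \<le> M; 16 \<le> (1 - \<alpha>)\<^sup>2 * real M;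
        8 * (real ((M * d) ^ d * (M * ((9 * d\<^sup>2) ^ d) ^ (M * d))))\<^sup>2 \<le> (1 - \<alpha>) * real N\<rbrakk> \<Longrightarrow> 2 ^ d \<le> r\<rbrakk>
      \<Longrightarrow> sqrt (ln (real N) / ln (ln (real N))) \<le> C2 * ln r"
    using lower_asymptotics[OF assms] by metis
  define C where "C = max C1 C2"
  have C0: "0 < C" using C1(1) by (simp add: C_def less_max_iff_disj)
  have lower: "1 / C * sqrt (ln (real N) / ln (ln (real N))) \<le> ln (real (RLGP R N \<alpha>))"
    if fn: "field_nat R \<iota> N" and N: "3 \<le> N" for R :: "('b, 'c) ring_scheme" and \<iota> N
  proof -
    interpret field_nat R \<iota> N by (rule fn)
    have r2: "2 \<le> RLGP R N \<alpha>" using two_le_RLGP[OF _ N_le assms] N by simp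
    have "sqrt (ln (real N) / ln (ln (real N))) \<le> C2 * ln (real (RLGP R N \<alpha>))"
    proof (rule C2(2)[OF N])
      fix d M :: nat
      assume dM: "1 \<le> d" "2 \<le> M" "16 \<le> (1 - \<alpha>)\<^sup>2 * real M"
        "8 * (real ((M * d) ^ d * (M * ((9 * d\<^sup>2) ^ d) ^ (M * d))))\<^sup>2 \<le> (1 - \<alpha>) * real N"
      have "2 ^ d \<le> RLGP R N \<alpha>" by (rule RLGP_ge_power_2[OF assms dM])
      then have "real (2 ^ d) \<le> real (RLGP R N \<alpha>)" by (rule of_nat_mono)
      then show "2 ^ d \<le> real (RLGP R N \<alpha>)" by simp
    qed (use r2 in simp)
    also have "\<dots> \<le> C * ln (real (RLGP R N \<alpha>))"
      using r2 by (intro mult_right_mono) (auto simp: C_def)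
    finally show ?thesis using C0 by (simp add: field_simps)
  qed
  have upper: "ln (real (RLGP R N \<alpha>)) \<le> C * (ln (real N) / ln (ln (real N)))"
    if fn: "field_nat R \<iota> N" and N: "3 \<le> N"
      and p: "real N powr (1 + ln (2 / \<alpha>) / ln (ln (real N))) \<le> p" "infinite (carrier R) \<or> p = real (card (carrier R))"
      and generic: "\<And>x. x \<in> carrier R \<Longrightarrow> x \<noteq> \<zero>\<^bsub>R\<^esub> \<Longrightarrow> infinite (range (\<lambda>m::nat. [m] \<cdot>\<^bsub>R\<^esub> x)) \<or>
        finite (carrier R) \<and> range (\<lambda>m::nat. [m] \<cdot>\<^bsub>R\<^esub> x) = carrier R"
    for R :: "('b, 'c) ring_scheme" and \<iota> N and p :: real
  proof -
    interpret field_nat R \<iota> N by (rule fn)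
    have N0: "0 < N" using N by simp
    have r2: "2 \<le> RLGP R N \<alpha>" by (rule two_le_RLGP[OF N0 N_le assms])
    have rN: "RLGP R N \<alpha> \<le> 2 * N\<^sup>2" using RLGP_attained[OF N0 assms(1) N_le] by metis
    have "ln (real (RLGP R N \<alpha>)) \<le> C1 * (ln (real N) / ln (ln (real N)))"
    proof (rule C1(2)[OF N _ _ p(1)])
      show "real (RLGP R N \<alpha>) \<le> 2 * (real N)\<^sup>2"
        using of_nat_mono[OF rN, where ?'a = real] by simp
      fix J :: nat and \<delta> \<kappa> :: real
      assume J: "1 \<le> J" "\<delta> = \<alpha> ^ (2 ^ Suc J) / 2" "2 \<le> \<delta> * real N" "2 * real N \<le> \<delta> * p"
        "\<kappa> = real N powr (16 / real J)"
      show "(\<delta> / 2) ^ (4 ^ J) * \<delta>\<^sup>2 * (real (RLGP R N \<alpha>) - 2) \<le> 2 ^ 81 * \<kappa> ^ 152"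
        by (rule RLGP_upper[OF N0 N_le assms generic J(1,2,3) _ J(5)]) (use J(4) p(2) in auto)
    qed (use r2 in simp)
    also have "\<dots> \<le> C * (ln (real N) / ln (ln (real N)))"
      using ln_ln_props(4)[OF N] by (intro mult_right_mono) (auto simp: C_def)
    finally show ?thesis .
  qed
  show ?thesis
  proof (intro exI[of _ C] conjI C0 allI impI)
    fix N :: nat assume N: "3 \<le> N"
    show "1 / C * sqrt (ln (real N) / ln (ln (real N))) \<le> ln (real (RLGP (ring_of_type_algebra :: complex ring) N \<alpha>))"
      by (rule lower[OF complex_field_nat N])
    \<comment> \<open>Over an infinite field \<open>p\<close> may be any real number;
      \<open>order.refl\<close> takes it equal to the required lower bound.\<close>
    show "ln (real (RLGP (ring_of_type_algebra :: complex ring) N \<alpha>)) \<le> C * (ln (real N) / ln (ln (real N)))"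
      by (rule upper[OF complex_field_nat N order.refl])
        (use complex_generic in \<open>auto simp: ring_of_type_algebra_def infinite_UNIV_char_0\<close>)
  next
    fix p N :: nat assume pN: "Factorial_Ring.prime p \<and> 3 \<le> N \<and> N \<le> p"
    then have p: "Factorial_Ring.prime p" and N: "3 \<le> N" "N \<le> p" by auto
    show "1 / C * sqrt (ln (real N) / ln (ln (real N))) \<le> ln (real (RLGP (residue_ring (int p)) N \<alpha>))"
      by (rule lower[OF residue_ring_field_nat[OF p N(2)] N(1)])
    assume le: "real N powr (1 + ln (2 / \<alpha>) / ln (ln (real N))) \<le> real p"
    show "ln (real (RLGP (residue_ring (int p)) N \<alpha>)) \<le> C * (ln (real N) / ln (ln (real N)))"
    proof (rule upper[OF residue_ring_field_nat[OF p N(2)] N(1) le])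
      show "infinite (carrier (residue_ring (int p))) \<or> real p = real (card (carrier (residue_ring (int p))))"
        by (simp add: residue_ring_def)
    qed (use residue_ring_generic[OF p] in blast)
  qed
qed

end
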